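(* There is an undetermined game on $\{0,1\}$ of length $\omega_1+\omega$ with ordinal definable payoff set.
   Context: We work in ZFC. Games: a game is given by an ordinal $\theta$ (its length), a nonempty set $S$ (the move set; one says the game is "on $S$"), and a payoff set $A$ of sequences of moves. It is a perfect information game of two players who move in turns, and at limit ordinals the first player moves (so the first player makes the moves with index $\lambda+2n$ and the second player those with index $\lambda+2n+1$, for $\lambda$ zero or a limit ordinal and $n<\omega$). Each move consists of picking an element of $S$. A position is the sequence of moves made so far at a point before the game ends. The game ends once the sequence of moves has length $\theta$; this sequence is the play. The first player wins if the play belongs to $A$; otherwise the second player wins. A strategy for a player is a mapping that assigns a valid move to every position at which it is that player's turn. A strategy is winning if the player wins whenever he follows it, regardless of the choices of the other player. A game is determined if one of the players has a winning strategy, and undetermined otherwise. A set is ordinal definable if there is an ordinal $\lambda$ such that the set is definable in $V_\lambda$ by a first-order formula with ordinal parameters. *)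

theory Defs
  imports Main
begin

section \<open>First-order formulas of set theory\<close>

datatype fm = Mem nat nat | Eq nat nat | Neg fm | Conj fm fm | Ex nat fm

primrec sat :: "('v \<Rightarrow> 'v \<Rightarrow> bool) \<Rightarrow> 'v set \<Rightarrow> (nat \<Rightarrow> 'v) \<Rightarrow> fm \<Rightarrow> bool" where
  "sat E D e (Mem i j) \<longleftrightarrow> E (e i) (e j)"
| "sat E D e (Eq i j) \<longleftrightarrow> e i = e j"
| "sat E D e (Neg p) \<longleftrightarrow> \<not> sat E D e p"
| "sat E D e (Conj p q) \<longleftrightarrow> sat E D e p \<and> sat E D e q"
| "sat E D e (Ex i p) \<longleftrightarrow> (\<exists>x\<in>D. sat E D (e(i := x)) p)"


section \<open>Models of ZFC\<close>

text \<open>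
  An arbitrary model of first-order ZFC; Separation and Replacement are schemas over
  \<^typ>\<open>fm\<close>, with the variables other than 0 (resp. 0 and 1) serving as parameters. A theorem of
  ZFC is a statement that holds in all such models. Everything defined below is to be read inside
  the model: all functions, sequences and strategies are elements of \<^typ>\<open>'v\<close>.
\<close>

locale ZFC =
  fixes mem :: "'v \<Rightarrow> 'v \<Rightarrow> bool"  (infix "\<epsilon>" 50)
  assumes extensionality: "(\<And>z. z \<epsilon> x \<longleftrightarrow> z \<epsilon> y) \<Longrightarrow> x = y"
    and foundation: "z \<epsilon> x \<Longrightarrow> \<exists>y. y \<epsilon> x \<and> \<not> (\<exists>w. w \<epsilon> y \<and> w \<epsilon> x)"
    and pairing: "\<exists>p. \<forall>z. z \<epsilon> p \<longleftrightarrow> z = x \<or> z = y"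
    and union: "\<exists>u. \<forall>z. z \<epsilon> u \<longleftrightarrow> (\<exists>y. y \<epsilon> x \<and> z \<epsilon> y)"
    and powerset: "\<exists>p. \<forall>z. z \<epsilon> p \<longleftrightarrow> (\<forall>w. w \<epsilon> z \<longrightarrow> w \<epsilon> x)"
    and infinity: "\<exists>x. (\<exists>z. z \<epsilon> x \<and> (\<forall>w. \<not> w \<epsilon> z)) \<and>
      (\<forall>y. y \<epsilon> x \<longrightarrow> (\<exists>s. s \<epsilon> x \<and> (\<forall>w. w \<epsilon> s \<longleftrightarrow> w \<epsilon> y \<or> w = y)))"
    and separation: "\<exists>y. \<forall>z. z \<epsilon> y \<longleftrightarrow> z \<epsilon> x \<and> sat mem UNIV (e(0 := z)) \<phi>"
    and replacement: "(\<And>a. a \<epsilon> x \<Longrightarrow> \<exists>!b. sat mem UNIV (e(0 := a, 1 := b)) \<phi>) \<Longrightarrow>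
      \<exists>y. \<forall>b. b \<epsilon> y \<longleftrightarrow> (\<exists>a. a \<epsilon> x \<and> sat mem UNIV (e(0 := a, 1 := b)) \<phi>)"
    and choice: "(\<And>y. y \<epsilon> x \<Longrightarrow> \<exists>w. w \<epsilon> y) \<Longrightarrow>
      (\<And>y z w. y \<epsilon> x \<Longrightarrow> z \<epsilon> x \<Longrightarrow> w \<epsilon> y \<Longrightarrow> w \<epsilon> z \<Longrightarrow> y = z) \<Longrightarrow>
      \<exists>c. \<forall>y. y \<epsilon> x \<longrightarrow> (\<exists>!w. w \<epsilon> y \<and> w \<epsilon> c)"
begin

text \<open>Only meaningful for those classes that are sets.\<close>

definition set_of :: "('v \<Rightarrow> bool) \<Rightarrow> 'v" where
  "set_of P = (THE x. \<forall>z. z \<epsilon> x \<longleftrightarrow> P z)"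

definition zero :: 'v where
  "zero = set_of (\<lambda>z. False)"

definition subset :: "'v \<Rightarrow> 'v \<Rightarrow> bool" where
  "subset x y \<longleftrightarrow> (\<forall>z. z \<epsilon> x \<longrightarrow> z \<epsilon> y)"

definition upair :: "'v \<Rightarrow> 'v \<Rightarrow> 'v" where
  "upair x y = set_of (\<lambda>z. z = x \<or> z = y)"

definition opair :: "'v \<Rightarrow> 'v \<Rightarrow> 'v" where
  "opair x y = upair (upair x x) (upair x y)"

definition succ :: "'v \<Rightarrow> 'v" where
  "succ x = set_of (\<lambda>z. z \<epsilon> x \<or> z = x)"

definition one :: 'v where
  "one = succ zero"


subsection \<open>Functions\<close>

definition fun_on :: "'v \<Rightarrow> 'v \<Rightarrow> bool" where
  "fun_on f d \<longleftrightarrow> (\<forall>p. p \<epsilon> f \<longrightarrow> (\<exists>x y. x \<epsilon> d \<and> p = opair x y)) \<and>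
     (\<forall>x. x \<epsilon> d \<longrightarrow> (\<exists>!y. opair x y \<epsilon> f))"

definition app :: "'v \<Rightarrow> 'v \<Rightarrow> 'v" where
  "app f x = (THE y. opair x y \<epsilon> f)"

definition fun_into :: "'v \<Rightarrow> 'v \<Rightarrow> 'v \<Rightarrow> bool" where
  "fun_into f d r \<longleftrightarrow> fun_on f d \<and> (\<forall>x. x \<epsilon> d \<longrightarrow> app f x \<epsilon> r)"

definition restr :: "'v \<Rightarrow> 'v \<Rightarrow> 'v" where
  "restr f d = set_of (\<lambda>p. p \<epsilon> f \<and> (\<exists>x y. x \<epsilon> d \<and> p = opair x y))"


subsection \<open>Ordinals and the cumulative hierarchy\<close>

definition transitive :: "'v \<Rightarrow> bool" where
  "transitive x \<longleftrightarrow> (\<forall>y. y \<epsilon> x \<longrightarrow> subset y x)"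

definition Ord :: "'v \<Rightarrow> bool" where
  "Ord a \<longleftrightarrow> transitive a \<and> (\<forall>b. b \<epsilon> a \<longrightarrow> transitive b)"

definition Limit :: "'v \<Rightarrow> bool" where
  "Limit l \<longleftrightarrow> Ord l \<and> zero \<epsilon> l \<and> (\<forall>a. a \<epsilon> l \<longrightarrow> succ a \<epsilon> l)"

definition omega :: 'v where
  "omega = (THE l. Limit l \<and> (\<forall>k. k \<epsilon> l \<longrightarrow> \<not> Limit k))"

definition at_most_countable :: "'v \<Rightarrow> bool" where
  "at_most_countable x \<longleftrightarrow> (\<exists>f. fun_into f x omega \<and>
     (\<forall>u v. u \<epsilon> x \<longrightarrow> v \<epsilon> x \<longrightarrow> app f u = app f v \<longrightarrow> u = v))"

definition omega1 :: 'v where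
  "omega1 = (THE a. Ord a \<and> \<not> at_most_countable a \<and> (\<forall>b. b \<epsilon> a \<longrightarrow> at_most_countable b))"

text \<open>
  The value at \<open>a\<close> of the function \<open>F\<close> with \<open>F(x) = H(F, x)\<close> for all ordinals \<open>x \<le> a\<close>, where
  \<open>H(F, x)\<close> may only use the values of \<open>F\<close> below \<open>x\<close>.
\<close>

definition ord_rec :: "(('v \<Rightarrow> 'v) \<Rightarrow> 'v \<Rightarrow> 'v) \<Rightarrow> 'v \<Rightarrow> 'v" where
  "ord_rec H a = (THE c. \<exists>f. fun_on f (succ a) \<and>
     (\<forall>x. x \<epsilon> succ a \<longrightarrow> app f x = H (app f) x) \<and> c = app f a)"

text \<open>\<open>a + x = a \<union> {a + y | y < x}\<close>\<close>

definition oadd :: "'v \<Rightarrow> 'v \<Rightarrow> 'v" where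
  "oadd a = ord_rec (\<lambda>F x. set_of (\<lambda>z. z \<epsilon> a \<or> (\<exists>y. y \<epsilon> x \<and> z = F y)))"

text \<open>\<open>V\<^sub>x\<close> is the union of the power sets of the \<open>V\<^sub>y\<close> with \<open>y < x\<close>.\<close>

definition Vset :: "'v \<Rightarrow> 'v" where
  "Vset = ord_rec (\<lambda>F x. set_of (\<lambda>z. \<exists>y. y \<epsilon> x \<and> subset z (F y)))"


subsection \<open>Ordinal definability\<close>

text \<open>
  \<open>X\<close> is the set of all \<open>z \<in> V\<^sub>l\<close> with \<open>V\<^sub>l \<Turnstile> \<phi>(z)\<close>; the ordinals \<open>e n\<close> with \<open>n > 0\<close> are the
  parameters, and \<open>z\<close> is the value of variable 0. Formulas are the standard ones of
  type \<^typ>\<open>fm\<close>, also when the \<open>\<omega>\<close> of the model has nonstandard elements. Nothing is lost: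
  coded formulas are natural numbers of the model, hence ordinals, and satisfaction in \<open>V\<^sub>l\<close> of
  coded formulas is expressed over a larger \<open>V\<^sub>m\<close> by one standard formula with the code as an
  additional ordinal parameter.
\<close>

definition ordinal_definable :: "'v \<Rightarrow> bool" where
  "ordinal_definable X \<longleftrightarrow> (\<exists>l \<phi> e. Ord l \<and> (\<forall>n. Ord (e n) \<and> e n \<epsilon> Vset l) \<and>
     (\<forall>z. z \<epsilon> X \<longleftrightarrow> z \<epsilon> Vset l \<and> sat mem {y. y \<epsilon> Vset l} (e(0 := z)) \<phi>))"


subsection \<open>Games\<close>

definition game :: "'v \<Rightarrow> 'v \<Rightarrow> 'v \<Rightarrow> bool" where
  "game \<theta> S A \<longleftrightarrow> Ord \<theta> \<and> (\<exists>s. s \<epsilon> S) \<and> (\<forall>f. f \<epsilon> A \<longrightarrow> fun_into f \<theta> S)"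

definition first_turn :: "'v \<Rightarrow> bool" where
  "first_turn a \<longleftrightarrow> (\<exists>l n. (l = zero \<or> Limit l) \<and> n \<epsilon> omega \<and> a = oadd l (oadd n n))"

definition second_turn :: "'v \<Rightarrow> bool" where
  "second_turn a \<longleftrightarrow> (\<exists>l n. (l = zero \<or> Limit l) \<and> n \<epsilon> omega \<and> a = oadd l (succ (oadd n n)))"

text \<open>
  In the following, \<open>T\<close> is \<^const>\<open>first_turn\<close> or \<^const>\<open>second_turn\<close>, i.e. it determines the
  player concerned.
\<close>

definition positions :: "('v \<Rightarrow> bool) \<Rightarrow> 'v \<Rightarrow> 'v \<Rightarrow> 'v" where
  "positions T \<theta> S = set_of (\<lambda>p. \<exists>a. a \<epsilon> \<theta> \<and> T a \<and> fun_into p a S)"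

definition strategy :: "('v \<Rightarrow> bool) \<Rightarrow> 'v \<Rightarrow> 'v \<Rightarrow> 'v \<Rightarrow> bool" where
  "strategy T \<theta> S \<sigma> \<longleftrightarrow> fun_into \<sigma> (positions T \<theta> S) S"

definition follows :: "('v \<Rightarrow> bool) \<Rightarrow> 'v \<Rightarrow> 'v \<Rightarrow> 'v \<Rightarrow> bool" where
  "follows T \<theta> f \<sigma> \<longleftrightarrow> (\<forall>a. a \<epsilon> \<theta> \<longrightarrow> T a \<longrightarrow> app f a = app \<sigma> (restr f a))"

definition first_wins_by :: "'v \<Rightarrow> 'v \<Rightarrow> 'v \<Rightarrow> 'v \<Rightarrow> bool" where
  "first_wins_by \<theta> S A \<sigma> \<longleftrightarrow> strategy first_turn \<theta> S \<sigma> \<and>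
     (\<forall>f. fun_into f \<theta> S \<longrightarrow> follows first_turn \<theta> f \<sigma> \<longrightarrow> f \<epsilon> A)"

definition second_wins_by :: "'v \<Rightarrow> 'v \<Rightarrow> 'v \<Rightarrow> 'v \<Rightarrow> bool" where
  "second_wins_by \<theta> S A \<sigma> \<longleftrightarrow> strategy second_turn \<theta> S \<sigma> \<and>
     (\<forall>f. fun_into f \<theta> S \<longrightarrow> follows second_turn \<theta> f \<sigma> \<longrightarrow> \<not> f \<epsilon> A)"

definition determined :: "'v \<Rightarrow> 'v \<Rightarrow> 'v \<Rightarrow> bool" where
  "determined \<theta> S A \<longleftrightarrow> (\<exists>\<sigma>. first_wins_by \<theta> S A \<sigma>) \<or> (\<exists>\<sigma>. second_wins_by \<theta> S A \<sigma>)"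

end

end

theory Submission
  imports Defs
begin

text \<open>
  The first \<open>\<omega>\<^sub>1\<close> moves of the first player code a family of reals \<open>x\<^sub>\<lambda>\<close>, indexed by 0 and the
  limit ordinals \<open>\<lambda> < \<omega>\<^sub>1\<close>. In the last \<open>\<omega>\<close> moves a perfect set game for \<open>{x\<^sub>\<lambda>}\<close> is played:
  the first player has to produce the bits of some \<open>x\<^sub>\<lambda>\<close>, and infinitely often he has to give a
  signal, upon which the second player prescribes the next bit. In addition the first player loses
  if he has a winning strategy for the last \<open>\<omega>\<close> moves (the position is not \<open>safe\<close>). Hence he has
  no winning strategy for the whole game.

  The second player's strategies are defeated by a family that is uncountable but does not include
  the range of any continuous injection of \<open>2\<^sup>\<omega>\<close>: if the continuum hypothesis fails, any \<open>\<omega>\<^sub>1\<close>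
  distinct reals will do, otherwise one diagonalizes. Winning the perfect set game would give
  the first player such an injection, so the family is safe. If the second player had a winning
  strategy, each \<open>x\<^sub>\<lambda>\<close> could be computed from a finite position: the first player plays \<open>x\<^sub>\<lambda>\<close> and
  signals exactly when the answer will be the right bit; after the last signal every bit is the
  opposite of the answer that the strategy would give. So there would be only countably many \<open>x\<^sub>\<lambda>\<close>.

  The payoff set is defined in the universe from ordinals; by the reflection principle it is also
  definable in some \<open>V\<^sub>l\<close>.
\<close>

text \<open>Choice easily produces undetermined games, but a family of reals as above need not be
  ordinal definable. So it is not built into the payoff set; the first player writes it down during
  the game, and the payoff condition refers only to what has been played. This is what the first
  \<open>omega1\<close> moves are for.

  In the usual perfect set game the first player picks finite strings of any length and the second
  player single bits. With moves restricted to two values, the end of a string has to be announced;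
  this is the origin of the signals, and demanding infinitely many of them makes every string
  finite.

  The formal obstacle is that the universe is an arbitrary model of first-order ZFC: each use of
  Separation, Replacement, induction or recursion needs a formula. Formulas are almost never written
  out. Instead, definability is a predicate closed under the constructions of the language, and the
  rules in \<open>dfn_intros\<close> prove it. A flag separates its two uses: arbitrary parameters
  for work inside the model, ordinal parameters for the payoff set.\<close>

named_theorems dfn_intros

section \<open>Syntax of formulas: occurring variables and renaming\<close>

primrec vars :: "fm \<Rightarrow> nat set" where
  "vars (Mem i j) = {i, j}"
| "vars (Eq i j) = {i, j}"
| "vars (Neg p) = vars p"
| "vars (Conj p q) = vars p \<union> vars q"
| "vars (Ex i p) = insert i (vars p)"

lemma finite_vars: "finite (vars p)"
  by (induction p) auto

lemma sat_cong: "(\<And>i. i \<in> vars p \<Longrightarrow> e i = e' i) \<Longrightarrow> sat E D e p \<longleftrightarrow> sat E D e' p"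
proof (induction p arbitrary: e e')
  case (Neg p)
  have "sat E D e p \<longleftrightarrow> sat E D e' p" by (rule Neg.IH) (simp add: Neg.prems)
  then show ?case by simp
next
  case (Conj p q)
  have "sat E D e p \<longleftrightarrow> sat E D e' p" "sat E D e q \<longleftrightarrow> sat E D e' q"
    by (rule Conj.IH; simp add: Conj.prems)+
  then show ?case by simp
next
  case (Ex i p)
  have "sat E D (e(i := x)) p \<longleftrightarrow> sat E D (e'(i := x)) p" for x
    by (rule Ex.IH) (use Ex.prems in auto)
  then show ?case by simp
qed simp_all

text \<open>Renamings may identify variables, so a quantified variable could capture a free one. In
  the case of \<open>Ex\<close> the quantifier therefore moves to \<open>k\<close>, which exceeds
  the new names of all variables of the body.\<close>

lemma sat_rename: "\<exists>q. \<forall>e. sat E D e q \<longleftrightarrow> sat E D (\<lambda>i. e (r i)) p"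
proof (induction p arbitrary: r)
  case (Mem i j)
  show ?case by (rule exI[of _ "Mem (r i) (r j)"]) simp
next
  case (Eq i j)
  show ?case by (rule exI[of _ "Eq (r i) (r j)"]) simp
next
  case (Neg p)
  then obtain q where "\<forall>e. sat E D e q \<longleftrightarrow> sat E D (\<lambda>i. e (r i)) p" by blast
  then show ?case by (intro exI[of _ "Neg q"]) simp
next
  case (Conj p1 p2)
  obtain q1 where "\<forall>e. sat E D e q1 \<longleftrightarrow> sat E D (\<lambda>i. e (r i)) p1" using Conj.IH(1) by blast
  moreover obtain q2 where "\<forall>e. sat E D e q2 \<longleftrightarrow> sat E D (\<lambda>i. e (r i)) p2"
    using Conj.IH(2) by blast
  ultimately show ?case by (intro exI[of _ "Conj q1 q2"]) simp
next
  case (Ex i p)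
  obtain k where k: "\<forall>j\<in>vars p. r j < k"
    by (metis (no_types) finite_vars finite_imageI finite_nat_set_iff_bounded imageI)
  obtain q where q: "\<forall>e. sat E D e q \<longleftrightarrow> sat E D (\<lambda>j. e ((r(i := k)) j)) p"
    using Ex.IH by blast
  have "sat E D (e(k := x)) q \<longleftrightarrow> sat E D ((\<lambda>j. e (r j))(i := x)) p" for e x
    unfolding q[rule_format] by (rule sat_cong) (use k in auto)
  then show ?case by (intro exI[of _ "Ex k q"]) simp
qed

text \<open>Variables in even positions, parameters in odd positions.\<close>

definition mix :: "(nat \<Rightarrow> 'v) \<Rightarrow> (nat \<Rightarrow> 'v) \<Rightarrow> nat \<Rightarrow> 'v" where
  "mix e a n = (if even n then e (n div 2) else a (n div 2))"

lemma mix_simps [simp]: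
  "mix e a 0 = e 0" "mix e a (2 * n) = e n" "mix e a (Suc (2 * n)) = a n"
  by (simp_all add: mix_def)

lemma parity_ext:
  assumes "\<And>k. f (2 * k) = g (2 * k)" "\<And>k. f (Suc (2 * k)) = g (Suc (2 * k))"
  shows "f = (g :: nat \<Rightarrow> 'v)"
proof
  fix n show "f n = g n" using assms[of "n div 2"] by (cases "even n") auto
qed

context ZFC
begin

subsection \<open>Definability\<close>

text \<open>
  \<open>dfn b P\<close>: the predicate \<open>P\<close> on environments is given by a first-order formula with parameters,
  which have to be ordinals if \<open>b\<close> holds. \<open>dft\<close> is the same for functions. In the rules
  below environments are de Bruijn: \<^term>\<open>e 0\<close> is the innermost bound variable.
\<close>

definition dfn :: "bool \<Rightarrow> ((nat \<Rightarrow> 'v) \<Rightarrow> bool) \<Rightarrow> bool" where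
  "dfn b P \<longleftrightarrow> (\<exists>\<phi> a. (\<forall>n. b \<longrightarrow> Ord (a n)) \<and> (\<forall>e. P e \<longleftrightarrow> sat mem UNIV (mix e a) \<phi>))"

definition dft :: "bool \<Rightarrow> ((nat \<Rightarrow> 'v) \<Rightarrow> 'v) \<Rightarrow> bool" where
  "dft b t \<longleftrightarrow> dfn b (\<lambda>e. e 0 = t (\<lambda>n. e (Suc n)))"

lemma set_of_mem: "\<exists>x. \<forall>z. z \<epsilon> x \<longleftrightarrow> P z \<Longrightarrow> z \<epsilon> set_of P \<longleftrightarrow> P z"
proof -
  assume "\<exists>x. \<forall>z. z \<epsilon> x \<longleftrightarrow> P z"
  then have "\<exists>!x. \<forall>z. z \<epsilon> x \<longleftrightarrow> P z" using extensionality by metis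
  from theI'[OF this] show ?thesis unfolding set_of_def by blast
qed

lemma mem_upair [simp]: "z \<epsilon> upair x y \<longleftrightarrow> z = x \<or> z = y"
  unfolding upair_def by (rule set_of_mem) (rule pairing)

lemma mem_zero [simp]: "\<not> z \<epsilon> zero"
proof -
  have "\<exists>x. \<forall>z. \<not> z \<epsilon> x" using infinity by blast
  then show ?thesis unfolding zero_def using set_of_mem[of "\<lambda>_. False"] by blast
qed

lemma Ord_zero [simp]: "Ord zero"
  by (simp add: Ord_def transitive_def)

lemma dfnI:
  assumes "\<And>n. b \<Longrightarrow> Ord (a n)" and "\<And>e. P e \<longleftrightarrow> sat mem UNIV (\<lambda>n. mix e a (r n)) \<phi>"
  shows "dfn b P"
proof -
  obtain q where "\<forall>e. sat mem UNIV e q \<longleftrightarrow> sat mem UNIV (\<lambda>i. e (r i)) \<phi>" using sat_rename by blast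
  then have "\<forall>e. P e \<longleftrightarrow> sat mem UNIV (mix e a) q" using assms(2) by simp
  then show ?thesis unfolding dfn_def using assms(1) by (intro exI[of _ q] exI[of _ a]) simp
qed

lemma dfn_const [dfn_intros]: "dfn b (\<lambda>e. B)"
  by (rule dfnI[where a="\<lambda>_. zero" and r="\<lambda>n. n" and \<phi>="if B then Eq 0 0 else Neg (Eq 0 0)"]) auto

lemma dfn_mem_var: "dfn b (\<lambda>e. e i \<epsilon> e j)"
  by (rule dfnI[where a="\<lambda>_. zero" and r="\<lambda>n. n" and \<phi>="Mem (2*i) (2*j)"]) auto

lemma dfn_eq_var: "dfn b (\<lambda>e. e i = e j)"
  by (rule dfnI[where a="\<lambda>_. zero" and r="\<lambda>n. n" and \<phi>="Eq (2*i) (2*j)"]) auto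

lemma dfn_eq_param: "(b \<Longrightarrow> Ord c) \<Longrightarrow> dfn b (\<lambda>e. e i = c)"
  by (rule dfnI[where a="\<lambda>_. c" and r="\<lambda>n. n" and \<phi>="Eq (2*i) 1"])
    (auto simp: mix_def)

lemma dfn_neg [dfn_intros]: "dfn b P \<Longrightarrow> dfn b (\<lambda>e. \<not> P e)"
  unfolding dfn_def by (metis sat.simps(3))

lemma dfn_conj [dfn_intros]:
  assumes "dfn b P" "dfn b P'"
  shows "dfn b (\<lambda>e. P e \<and> P' e)"
proof -
  obtain \<phi> a where 1: "\<And>n. b \<Longrightarrow> Ord (a n)" "\<And>e. P e \<longleftrightarrow> sat mem UNIV (mix e a) \<phi>"
    using assms(1) unfolding dfn_def by blast
  obtain \<phi>' a' where 2: "\<And>n. b \<Longrightarrow> Ord (a' n)" "\<And>e. P' e \<longleftrightarrow> sat mem UNIV (mix e a') \<phi>'"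
    using assms(2) unfolding dfn_def by blast
  \<comment> \<open>The two parameter sequences are interleaved: variable 2k+1, which holds a
    parameter, is redirected to 4k+1 for \<open>a\<close> and to 4k+3 for \<open>a'\<close>.\<close>
  define c where "c = mix a a'"
  define r where "r n = (if even n then n else 4 * (n div 2) + 1)" for n :: nat
  define r' where "r' n = (if even n then n else 4 * (n div 2) + 3)" for n :: nat
  obtain q where q: "\<forall>e. sat mem UNIV e q \<longleftrightarrow> sat mem UNIV (\<lambda>i. e (r i)) \<phi>" using sat_rename by blast
  obtain q' where q': "\<forall>e. sat mem UNIV e q' \<longleftrightarrow> sat mem UNIV (\<lambda>i. e (r' i)) \<phi>'" using sat_rename by blast
  have four: "(4 * k + 3) div 2 = Suc (2 * k)" for k :: nat by presburger
  have e: "(\<lambda>n. mix e c (r n)) = mix e a" "(\<lambda>n. mix e c (r' n)) = mix e a'" for e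
    by (rule parity_ext; simp add: r_def r'_def c_def mix_def four)+
  have "b \<longrightarrow> Ord (c n)" for n using 1(1) 2(1) by (simp add: c_def mix_def)
  moreover have "P e \<and> P' e \<longleftrightarrow> sat mem UNIV (mix e c) (Conj q q')" for e
    by (simp add: q q' e 1(2) 2(2))
  ultimately show ?thesis unfolding dfn_def by (intro exI[of _ "Conj q q'"] exI[of _ c]) blast
qed

lemma dfn_ex [dfn_intros]: "dfn b (\<lambda>e. P (e 0) (\<lambda>n. e (Suc n))) \<Longrightarrow> dfn b (\<lambda>e. \<exists>x. P x e)"
proof -
  assume "dfn b (\<lambda>e. P (e 0) (\<lambda>n. e (Suc n)))"
  then obtain \<phi> a where 1: "\<And>n. b \<Longrightarrow> Ord (a n)"
    "\<And>e. P (e 0) (\<lambda>n. e (Suc n)) \<longleftrightarrow> sat mem UNIV (mix e a) \<phi>"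
    unfolding dfn_def by blast
  \<comment> \<open>With the parameters spread over the variables 4k+1, variable 3 is free to be
    quantified. The even variables move down by one place, since the bound variable leaves the
    environment.\<close>
  define c where "c = mix a a"
  define r where "r n = (if n = 0 then 3 else if even n then n - 2 else 4 * (n div 2) + 1)" for n :: nat
  obtain q where q: "\<forall>e. sat mem UNIV e q \<longleftrightarrow> sat mem UNIV (\<lambda>i. e (r i)) \<phi>" using sat_rename by blast
  have e: "(\<lambda>n. ((mix e c)(3 := x)) (r n)) = mix (case_nat x e) a" for e x
  proof (rule parity_ext)
    fix k
    show "((mix e c)(3 := x)) (r (2 * k)) = mix (case_nat x e) a (2 * k)"
    proof (cases k)
      case (Suc j)
      have "2 * j \<noteq> 3" by presburger
      moreover have "mix (case_nat x e) a (2 * Suc j) = e j" by (simp only: mix_simps) simp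
      ultimately show ?thesis by (simp add: Suc r_def)
    qed (simp add: r_def)
    have "4 * k + 1 \<noteq> 3" by presburger
    then show "((mix e c)(3 := x)) (r (Suc (2 * k))) = mix (case_nat x e) a (Suc (2 * k))"
      by (simp add: r_def c_def mix_def)
  qed
  have "P x e \<longleftrightarrow> sat mem UNIV ((mix e c)(3 := x)) q" for x e
    unfolding q[rule_format] e using 1(2)[of "case_nat x e"] by simp
  then have "(\<exists>x. P x e) \<longleftrightarrow> sat mem UNIV (mix e c) (Ex 3 q)" for e by simp
  moreover have "b \<longrightarrow> Ord (c n)" for n using 1(1) by (simp add: c_def mix_def)
  ultimately show ?thesis unfolding dfn_def by blast
qed

lemma dfn_all [dfn_intros]:
  assumes "dfn b (\<lambda>e. P (e 0) (\<lambda>n. e (Suc n)))" shows "dfn b (\<lambda>e. \<forall>x. P x e)"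
proof -
  have "dfn b (\<lambda>e. \<not> (\<exists>x. \<not> P x e))" by (intro dfn_neg dfn_ex assms)
  then show ?thesis by simp
qed

lemma dfn_imp [dfn_intros]: "dfn b P \<Longrightarrow> dfn b P' \<Longrightarrow> dfn b (\<lambda>e. P e \<longrightarrow> P' e)"
  using dfn_neg[OF dfn_conj[OF _ dfn_neg, of b P P']] by simp

lemma dfn_disj [dfn_intros]: "dfn b P \<Longrightarrow> dfn b P' \<Longrightarrow> dfn b (\<lambda>e. P e \<or> P' e)"
  using dfn_imp[OF dfn_neg, of b P P'] by (simp add: disj_imp)

lemma dfn_iff [dfn_intros]: "dfn b P \<Longrightarrow> dfn b P' \<Longrightarrow> dfn b (\<lambda>e. P e \<longleftrightarrow> P' e)"
  using dfn_conj[OF dfn_imp dfn_imp, of b P P' P' P] by (simp add: iff_conv_conj_imp)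

lemma dfn_ren:
  assumes "dfn b P" shows "dfn b (\<lambda>e. P (\<lambda>n. e (r n)))"
proof -
  obtain \<phi> a where 1: "\<And>n. b \<Longrightarrow> Ord (a n)" "\<And>e. P e \<longleftrightarrow> sat mem UNIV (mix e a) \<phi>"
    using assms unfolding dfn_def by blast
  define s where "s n = (if even n then 2 * r (n div 2) else n)" for n
  have "(\<lambda>n. mix e a (s n)) = mix (\<lambda>n. e (r n)) a" for e
    by (rule parity_ext) (simp_all add: s_def)
  then show ?thesis
    by (intro dfnI[where a=a and r=s and \<phi>=\<phi>]) (use 1 in auto)
qed

text \<open>Turns infinitely many variables into parameters at once, namely those with
  \<open>r n = None\<close>. Bounding witnesses for reflection requires this, as a whole environment
  is fixed there.\<close>

lemma dfn_params:
  assumes "dfn False P"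
  shows "dfn False (\<lambda>e. P (\<lambda>n. case r n of None \<Rightarrow> c n | Some k \<Rightarrow> e k))"
proof -
  obtain \<phi> a where 1: "\<And>e. P e \<longleftrightarrow> sat mem UNIV (mix e a) \<phi>"
    using assms unfolding dfn_def by blast
  define s where "s n = (if even n then (case r (n div 2) of None \<Rightarrow> Suc (2 * n) | Some k \<Rightarrow> 2 * k)
    else Suc (2 * n))" for n
  have "(\<lambda>n. mix e (mix c a) (s n)) = mix (\<lambda>n. case r n of None \<Rightarrow> c n | Some k \<Rightarrow> e k) a" for e
  proof (rule parity_ext)
    fix k
    show "mix e (mix c a) (s (2 * k)) = mix (\<lambda>n. case r n of None \<Rightarrow> c n | Some k \<Rightarrow> e k) a (2 * k)"
      using mix_simps(3)[of e "mix c a" "2 * k"] by (simp add: s_def split: option.split)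
    show "mix e (mix c a) (s (Suc (2 * k))) =
      mix (\<lambda>n. case r n of None \<Rightarrow> c n | Some k \<Rightarrow> e k) a (Suc (2 * k))"
      using mix_simps(3)[of e "mix c a" "Suc (2 * k)"] by (simp add: s_def)
  qed
  then show ?thesis by (intro dfnI[where a="mix c a" and r=s and \<phi>=\<phi>]) (simp_all add: 1)
qed

lemma dft_ren: "dft b t \<Longrightarrow> dft b (\<lambda>e. t (\<lambda>n. e (r n)))"
  unfolding dft_def using dfn_ren[where r="case_nat 0 (\<lambda>n. Suc (r n))"] by force

lemma dft_var [dfn_intros]: "dft b (\<lambda>e. e n)"
  unfolding dft_def by (rule dfn_eq_var)

lemma dft_const [dfn_intros]: "dft False (\<lambda>e. c)"
  unfolding dft_def by (rule dfn_eq_param) simp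

lemma dft_Ord: "Ord c \<Longrightarrow> dft b (\<lambda>e. c)"
  unfolding dft_def by (rule dfn_eq_param)

lemma dfn_sub:
  assumes "dfn b (\<lambda>e. P (e 0) (\<lambda>n. e (Suc n)))" and "dft b t"
  shows "dfn b (\<lambda>e. P (t e) e)"
proof -
  have "dfn b (\<lambda>e. \<exists>x. x = t e \<and> P x e)"
    by (intro dfn_ex dfn_conj assms(1)) (use assms(2) in \<open>simp add: dft_def\<close>)
  then show ?thesis by simp
qed

text \<open>Reduces a claim about arbitrary definable terms to one about variables. The closure
  rules for defined notions all start with a rule of this kind, after which the definition can be
  unfolded.\<close>

lemma dfn_sub1: "dfn b (\<lambda>e. P (e 0)) \<Longrightarrow> dft b t \<Longrightarrow> dfn b (\<lambda>e. P (t e))"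
  by (rule dfn_sub)

lemma dft_sub:
  assumes "dft b (\<lambda>e. F (e 0) (\<lambda>n. e (Suc n)))" and "dft b t"
  shows "dft b (\<lambda>e. F (t e) e)"
proof -
  have "dfn b (\<lambda>e. e 0 = F (t (\<lambda>n. e (Suc n))) (\<lambda>n. e (Suc n)))"
  proof (rule dfn_sub[where P="\<lambda>x e. e 0 = F x (\<lambda>n. e (Suc n))"])
    show "dft b (\<lambda>e. t (\<lambda>n. e (Suc n)))" by (rule dft_ren[OF assms(2)])
    have "dfn b (\<lambda>e. e 0 = F (e 1) (\<lambda>n. e (Suc (Suc n))))"
      using assms(1) unfolding dft_def by simp
    from dfn_ren[OF this, of "\<lambda>n. if n = 0 then 1 else if n = 1 then 0 else n"]
    show "dfn b (\<lambda>e. e (Suc 0) = F (e 0) (\<lambda>n. e (Suc (Suc n))))" by simp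
  qed
  then show ?thesis unfolding dft_def .
qed

lemma dft_sub1: "dft b (\<lambda>e. F (e 0)) \<Longrightarrow> dft b t \<Longrightarrow> dft b (\<lambda>e. F (t e))"
  by (rule dft_sub)

lemma dft_sub2:
  assumes "dft b (\<lambda>e. F (e 0) (e (Suc 0)))" and "dft b s" "dft b t"
  shows "dft b (\<lambda>e. F (s e) (t e))"
proof (rule dft_sub[where F="\<lambda>x e. F x (t e)", OF _ assms(2)])
  show "dft b (\<lambda>e. F (e 0) (t (\<lambda>n. e (Suc n))))"
    by (rule dft_sub[where F="\<lambda>x e. F (e 0) x"])
      (use dft_ren[OF assms(1), of "case_nat 1 (\<lambda>_. 0)"] dft_ren[OF assms(3)] in auto)
qed

lemma dft_sub3:
  assumes "dft b (\<lambda>e. F (e 0) (e (Suc 0)) (e (Suc (Suc 0))))" and "dft b s" "dft b t" "dft b u"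
  shows "dft b (\<lambda>e. F (s e) (t e) (u e))"
proof (rule dft_sub[where F="\<lambda>x e. F x (t e) (u e)", OF _ assms(2)])
  show "dft b (\<lambda>e. F (e 0) (t (\<lambda>n. e (Suc n))) (u (\<lambda>n. e (Suc n))))"
  proof (rule dft_sub[where F="\<lambda>x e. F (e 0) x (u (\<lambda>n. e (Suc n)))"])
    show "dft b (\<lambda>e. F (e (Suc 0)) (e 0) (u (\<lambda>n. e (Suc (Suc n)))))"
      by (rule dft_sub[where F="\<lambda>x e. F (e (Suc 0)) (e 0) x"])
        (use dft_ren[OF assms(1), of "case_nat 2 (case_nat 1 (\<lambda>_. 0))"] dft_ren[OF assms(4)]
          in \<open>auto simp: numeral_2_eq_2\<close>)
  qed (rule dft_ren[OF assms(3)])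
qed

lemma dfn_sub2:
  assumes "dfn b (\<lambda>e. P (e 0) (e (Suc 0)))" and "dft b s" "dft b t"
  shows "dfn b (\<lambda>e. P (s e) (t e))"
proof (rule dfn_sub[where P="\<lambda>x e. P x (t e)", OF _ assms(2)])
  show "dfn b (\<lambda>e. P (e 0) (t (\<lambda>n. e (Suc n))))"
    by (rule dfn_sub[where P="\<lambda>x e. P (e 0) x"])
      (use dfn_ren[OF assms(1), of "case_nat 1 (\<lambda>_. 0)"] dft_ren[OF assms(3)] in auto)
qed

lemma dfn_sub3:
  assumes "dfn b (\<lambda>e. P (e 0) (e (Suc 0)) (e (Suc (Suc 0))))" and "dft b s" "dft b t" "dft b u"
  shows "dfn b (\<lambda>e. P (s e) (t e) (u e))"
proof (rule dfn_sub[where P="\<lambda>x e. P x (t e) (u e)", OF _ assms(2)])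
  show "dfn b (\<lambda>e. P (e 0) (t (\<lambda>n. e (Suc n))) (u (\<lambda>n. e (Suc n))))"
  proof (rule dfn_sub[where P="\<lambda>x e. P (e 0) x (u (\<lambda>n. e (Suc n)))"])
    show "dfn b (\<lambda>e. P (e (Suc 0)) (e 0) (u (\<lambda>n. e (Suc (Suc n)))))"
      by (rule dfn_sub[where P="\<lambda>x e. P (e (Suc 0)) (e 0) x"])
        (use dfn_ren[OF assms(1), of "case_nat 2 (case_nat 1 (\<lambda>_. 0))"] dft_ren[OF assms(4)]
          in \<open>auto simp: numeral_2_eq_2\<close>)
  qed (rule dft_ren[OF assms(3)])
qed

lemma dfn_mem [dfn_intros]: "dft b s \<Longrightarrow> dft b t \<Longrightarrow> dfn b (\<lambda>e. s e \<epsilon> t e)"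
  by (rule dfn_sub2[where P=mem]) (rule dfn_mem_var)

lemma dfn_eq [dfn_intros]: "dft b s \<Longrightarrow> dft b t \<Longrightarrow> dfn b (\<lambda>e. s e = t e)"
  by (rule dfn_sub2[where P="(=)"]) (rule dfn_eq_var)

lemma dfn_ex1 [dfn_intros]:
  assumes "dfn b (\<lambda>e. P (e 0) (\<lambda>n. e (Suc n)))"
  shows "dfn b (\<lambda>e. \<exists>!x. P x e)"
proof -
  have "dfn b (\<lambda>e. P (e 0) (\<lambda>n. e (Suc (Suc n))))"
    using dfn_ren[OF assms, of "case_nat 0 (\<lambda>n. Suc (Suc n))"] by simp
  then show ?thesis unfolding Ex1_def by (intro dfn_intros assms)
qed

subsection \<open>Comprehension\<close>

text \<open>
  Unlike \<open>THE\<close>, these operators have a definable value also where no suitable object exists, so that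
  no definedness conditions are needed in proofs of definability.
\<close>

definition the0 :: "('v \<Rightarrow> bool) \<Rightarrow> 'v" where
  "the0 P = (if \<exists>!x. P x then THE x. P x else zero)"

definition coll :: "('v \<Rightarrow> bool) \<Rightarrow> 'v" where
  "coll P = the0 (\<lambda>x. \<forall>z. z \<epsilon> x \<longleftrightarrow> P z)"

lemma the0I: "\<exists>!x. P x \<Longrightarrow> P (the0 P)"
  unfolding the0_def using theI' by simp

lemma the0_eq: "P x \<Longrightarrow> (\<And>y. P y \<Longrightarrow> y = x) \<Longrightarrow> the0 P = x"
  using the0I[of P] by blast

lemma mem_coll: "\<exists>x. \<forall>z. z \<epsilon> x \<longleftrightarrow> P z \<Longrightarrow> z \<epsilon> coll P \<longleftrightarrow> P z"
proof -
  assume "\<exists>x. \<forall>z. z \<epsilon> x \<longleftrightarrow> P z"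
  then have "\<exists>!x. \<forall>z. z \<epsilon> x \<longleftrightarrow> P z" using extensionality by metis
  from the0I[OF this] show ?thesis unfolding coll_def by blast
qed

lemma set_of_eq_coll: "\<exists>x. \<forall>z. z \<epsilon> x \<longleftrightarrow> P z \<Longrightarrow> set_of P = coll P"
  by (rule extensionality) (simp add: mem_coll set_of_mem)

lemma dft_the0 [dfn_intros]:
  assumes "dfn b (\<lambda>e. P (e 0) (\<lambda>n. e (Suc n)))"
  shows "dft b (\<lambda>e. the0 (\<lambda>x. P x e))"
proof -
  have eq: "y = the0 Q \<longleftrightarrow> ((\<exists>!x. Q x) \<and> Q y) \<or> (\<not> (\<exists>!x. Q x) \<and> (\<forall>z. \<not> z \<epsilon> y))" for y Q
  proof (cases "\<exists>!x. Q x")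
    case True
    then show ?thesis using the0I[OF True] by blast
  next
    case False
    moreover have "(\<forall>z. \<not> z \<epsilon> y) \<longleftrightarrow> y = zero" using extensionality[of y zero] by auto
    ultimately show ?thesis by (simp add: the0_def)
  qed
  have 1: "dfn b (\<lambda>e. P (e 0) (\<lambda>n. e (Suc (Suc n))))"
    using dfn_ren[OF assms, of "case_nat 0 (\<lambda>n. Suc (Suc n))"] by simp
  show ?thesis unfolding dft_def eq by (intro dfn_intros 1 assms)
qed

lemma dft_coll [dfn_intros]:
  assumes "dfn b (\<lambda>e. P (e 0) (\<lambda>n. e (Suc n)))"
  shows "dft b (\<lambda>e. coll (\<lambda>x. P x e))"
proof -
  have 1: "dfn b (\<lambda>e. P (e 0) (\<lambda>n. e (Suc (Suc n))))"
    using dfn_ren[OF assms, of "case_nat 0 (\<lambda>n. Suc (Suc n))"] by simp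
  show ?thesis unfolding coll_def by (intro dfn_intros 1)
qed

lemma dft_if [dfn_intros]:
  assumes "dfn b P" "dft b s" "dft b t" shows "dft b (\<lambda>e. if P e then s e else t e)"
proof -
  have eq: "y = (if p then s else t) \<longleftrightarrow> (p \<longrightarrow> y = s) \<and> (\<not> p \<longrightarrow> y = t)"
    for y s t :: 'v and p by simp
  show ?thesis unfolding dft_def eq
    by (intro dfn_intros dfn_ren[OF assms(1)] dft_ren[OF assms(2)] dft_ren[OF assms(3)])
qed

lemma sep_ex: "dfn False (\<lambda>e. P (e 0)) \<Longrightarrow> \<exists>y. \<forall>z. z \<epsilon> y \<longleftrightarrow> z \<epsilon> x \<and> P z"
proof -
  assume "dfn False (\<lambda>e. P (e 0))"
  then obtain \<phi> a where 1: "\<And>e. P (e 0) \<longleftrightarrow> sat mem UNIV (mix e a) \<phi>" unfolding dfn_def by blast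
  define e where "e = mix (\<lambda>_. zero) a"
  have "e(0 := z) = mix (\<lambda>n. if n = 0 then z else zero) a" for z
    by (rule parity_ext) (simp_all add: e_def)
  then have "P z \<longleftrightarrow> sat mem UNIV (e(0 := z)) \<phi>" for z
    using 1[of "\<lambda>n. if n = 0 then z else zero"] by simp
  then show ?thesis using separation[of x e \<phi>] by simp
qed

lemma repl_ex:
  assumes "dft False (\<lambda>e. F (e 0))" shows "\<exists>y. \<forall>z. z \<epsilon> y \<longleftrightarrow> (\<exists>w. w \<epsilon> x \<and> z = F w)"
proof -
  obtain \<phi> a where 1: "\<And>e. e 0 = F (e 1) \<longleftrightarrow> sat mem UNIV (mix e a) \<phi>"
    using assms unfolding dft_def dfn_def by auto
  \<comment> \<open>Replacement wants the argument in variable 0 and the value in variable 1. In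
    \<open>\<phi>\<close> the value is variable 0 and the argument, being \<open>e 1\<close>, is
    variable 2 of \<open>mix\<close>; everything else moves up by two.\<close>
  define r where "r n = (if n = 0 then 1 else if n = 2 then 0 else n + 2)" for n :: nat
  obtain q where q: "\<forall>e. sat mem UNIV e q \<longleftrightarrow> sat mem UNIV (\<lambda>i. e (r i)) \<phi>" using sat_rename by blast
  define e where "e n = (mix (\<lambda>_. zero) a) (n - 2)" for n
  have *: "sat mem UNIV (e(0 := u, 1 := v)) q \<longleftrightarrow> v = F u" for u v
  proof -
    let ?e = "\<lambda>n. if n = 0 then v else if n = 1 then u else zero"
    have "(\<lambda>i. (e(0 := u, 1 := v)) (r i)) = mix ?e a"
    proof (rule parity_ext)
      fix k
      have "Suc (2 * k) \<noteq> 2" by presburger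
      then show "(e(0 := u, 1 := v)) (r (Suc (2 * k))) = mix ?e a (Suc (2 * k))"
        by (simp add: e_def r_def)
      have "2 * k - 0 = 2 * k" by simp
      then show "(e(0 := u, 1 := v)) (r (2 * k)) = mix ?e a (2 * k)"
        by (auto simp: e_def r_def)
    qed
    then show ?thesis unfolding q[rule_format] using 1[of ?e] by simp
  qed
  show ?thesis using replacement[of x e q] unfolding * by simp
qed

lemma mem_coll_sep:
  assumes "dfn False (\<lambda>e. P (e 0))" "\<And>z. P z \<Longrightarrow> z \<epsilon> x"
  shows "z \<epsilon> coll P \<longleftrightarrow> P z"
proof -
  obtain y where "\<forall>z. z \<epsilon> y \<longleftrightarrow> z \<epsilon> x \<and> P z" using sep_ex[OF assms(1)] by blast
  then have "\<forall>z. z \<epsilon> y \<longleftrightarrow> P z" using assms(2) by blast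
  then show ?thesis by (intro mem_coll exI)
qed

lemma dft_zero [dfn_intros]: "dft b (\<lambda>e. zero)"
  by (rule dft_Ord) simp

lemma upair_coll: "upair x y = coll (\<lambda>z. z = x \<or> z = y)"
  unfolding upair_def by (rule set_of_eq_coll) (rule pairing)

lemma dft_upair [dfn_intros]: "dft b s \<Longrightarrow> dft b t \<Longrightarrow> dft b (\<lambda>e. upair (s e) (t e))"
  by (rule dft_sub2[where F=upair], unfold upair_coll) (intro dfn_intros)

lemma dft_opair [dfn_intros]: "dft b s \<Longrightarrow> dft b t \<Longrightarrow> dft b (\<lambda>e. opair (s e) (t e))"
  unfolding opair_def by (intro dfn_intros)

lemma upair_eq: "upair x y = upair u v \<longleftrightarrow> (x = u \<and> y = v) \<or> (x = v \<and> y = u)"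
proof
  assume "upair x y = upair u v"
  then have "z = x \<or> z = y \<longleftrightarrow> z = u \<or> z = v" for z by (metis mem_upair)
  then show "(x = u \<and> y = v) \<or> (x = v \<and> y = u)" by metis
qed (auto intro: extensionality)

lemma opair_inj [simp]: "opair x y = opair u v \<longleftrightarrow> x = u \<and> y = v"
  unfolding opair_def by (auto simp: upair_eq)

definition Uni :: "'v \<Rightarrow> 'v" where "Uni x = coll (\<lambda>z. \<exists>y. y \<epsilon> x \<and> z \<epsilon> y)"

lemma mem_Uni [simp]: "z \<epsilon> Uni x \<longleftrightarrow> (\<exists>y. y \<epsilon> x \<and> z \<epsilon> y)"
  unfolding Uni_def by (rule mem_coll) (rule union)

lemma dft_Uni [dfn_intros]: "dft b s \<Longrightarrow> dft b (\<lambda>e. Uni (s e))"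
  by (rule dft_sub1[where F=Uni], unfold Uni_def) (intro dfn_intros)

lemma succ_ex: "\<exists>s. \<forall>z. z \<epsilon> s \<longleftrightarrow> z \<epsilon> x \<or> z = x"
  by (rule exI[of _ "Uni (upair x (upair x x))"]) auto

lemma mem_succ [simp]: "z \<epsilon> succ x \<longleftrightarrow> z \<epsilon> x \<or> z = x"
  unfolding succ_def by (rule set_of_mem) (rule succ_ex)

lemma dft_succ [dfn_intros]: "dft b s \<Longrightarrow> dft b (\<lambda>e. succ (s e))"
proof (rule dft_sub1[where F=succ])
  have "succ x = coll (\<lambda>z. z \<epsilon> x \<or> z = x)" for x
    unfolding succ_def by (rule set_of_eq_coll) (rule succ_ex)
  then show "dft b (\<lambda>e. succ (e 0))" by (simp only:) (intro dfn_intros)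
qed

lemma dft_one [dfn_intros]: "dft b (\<lambda>e. one)"
  unfolding one_def by (intro dfn_intros)

lemma zero_neq_one [simp]: "zero \<noteq> one" "one \<noteq> zero"
  unfolding one_def by (metis mem_succ mem_zero)+

lemma dfn_subset [dfn_intros]: "dft b s \<Longrightarrow> dft b t \<Longrightarrow> dfn b (\<lambda>e. subset (s e) (t e))"
  by (rule dfn_sub2[where P=subset], unfold subset_def) (intro dfn_intros)

definition Pws :: "'v \<Rightarrow> 'v" where "Pws x = coll (\<lambda>z. subset z x)"

lemma mem_Pws [simp]: "z \<epsilon> Pws x \<longleftrightarrow> subset z x"
  unfolding Pws_def subset_def by (rule mem_coll) (rule powerset)

definition img :: "'v \<Rightarrow> ('v \<Rightarrow> 'v) \<Rightarrow> 'v" where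
  "img d F = coll (\<lambda>z. \<exists>x. x \<epsilon> d \<and> z = F x)"

lemma mem_img: "dft False (\<lambda>e. F (e 0)) \<Longrightarrow> z \<epsilon> img d F \<longleftrightarrow> (\<exists>x. x \<epsilon> d \<and> z = F x)"
  unfolding img_def by (rule mem_coll) (rule repl_ex)

lemma dft_img [dfn_intros]:
  assumes "dft b d" "dft b (\<lambda>e. F (e 0) (\<lambda>n. e (Suc n)))"
  shows "dft b (\<lambda>e. img (d e) (\<lambda>x. F x e))"
proof -
  have 1: "dft b (\<lambda>e. F (e 0) (\<lambda>n. e (Suc (Suc n))))"
    using dft_ren[OF assms(2), of "case_nat 0 (\<lambda>n. Suc (Suc n))"] by simp
  show ?thesis unfolding img_def by (intro dfn_intros 1 dft_ren[OF assms(1)])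
qed

subsection \<open>Functions\<close>

definition ap :: "'v \<Rightarrow> 'v \<Rightarrow> 'v" where "ap f x = the0 (\<lambda>y. opair x y \<epsilon> f)"

lemma dft_ap [dfn_intros]: "dft b s \<Longrightarrow> dft b t \<Longrightarrow> dft b (\<lambda>e. ap (s e) (t e))"
  by (rule dft_sub2[where F=ap], unfold ap_def) (intro dfn_intros)

lemma dfn_fun_on [dfn_intros]: "dft b s \<Longrightarrow> dft b t \<Longrightarrow> dfn b (\<lambda>e. fun_on (s e) (t e))"
  by (rule dfn_sub2[where P=fun_on], unfold fun_on_def) (intro dfn_intros)

lemma fun_on_ap: "fun_on f d \<Longrightarrow> x \<epsilon> d \<Longrightarrow> opair x y \<epsilon> f \<longleftrightarrow> y = ap f x"
  unfolding ap_def fun_on_def using the0I[of "\<lambda>y. opair x y \<epsilon> f"] by blast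

lemma fun_on_dom: "fun_on f d \<Longrightarrow> opair x y \<epsilon> f \<Longrightarrow> x \<epsilon> d"
  unfolding fun_on_def by (metis opair_inj)

lemma app_ap: "fun_on f d \<Longrightarrow> x \<epsilon> d \<Longrightarrow> app f x = ap f x"
  unfolding app_def using fun_on_ap by simp

lemma fun_into_iff: "fun_into f d r \<longleftrightarrow> fun_on f d \<and> (\<forall>x. x \<epsilon> d \<longrightarrow> ap f x \<epsilon> r)"
  unfolding fun_into_def using app_ap by auto

lemma dfn_fun_into [dfn_intros]:
  "dft b s \<Longrightarrow> dft b t \<Longrightarrow> dft b u \<Longrightarrow> dfn b (\<lambda>e. fun_into (s e) (t e) (u e))"
  by (rule dfn_sub3[where P=fun_into], unfold fun_into_iff) (intro dfn_intros)

lemma fun_ext: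
  assumes "fun_on f d" "fun_on g d" "\<And>x. x \<epsilon> d \<Longrightarrow> ap f x = ap g x" shows "f = g"
proof (rule extensionality)
  have "p \<epsilon> g" if *: "fun_on f d" "fun_on g d" "\<And>x. x \<epsilon> d \<Longrightarrow> ap f x = ap g x" "p \<epsilon> f" for f g p
  proof -
    obtain x y where p: "x \<epsilon> d" "p = opair x y" using *(1,4) unfolding fun_on_def by blast
    then show ?thesis using * fun_on_ap by auto
  qed
  then show "p \<epsilon> f \<longleftrightarrow> p \<epsilon> g" for p using assms by metis
qed

definition Lam :: "'v \<Rightarrow> ('v \<Rightarrow> 'v) \<Rightarrow> 'v" where
  "Lam d F = img d (\<lambda>x. opair x (F x))"

lemma dft_Lam [dfn_intros]:
  assumes "dft b d" "dft b (\<lambda>e. F (e 0) (\<lambda>n. e (Suc n)))"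
  shows "dft b (\<lambda>e. Lam (d e) (\<lambda>x. F x e))"
  unfolding Lam_def by (intro dfn_intros assms)

lemma fun_on_Lam:
  assumes "dft False (\<lambda>e. F (e 0))" shows "fun_on (Lam d F) d"
proof -
  have "dft False (\<lambda>e. opair (e 0) (F (e 0)))" by (intro dfn_intros assms)
  from mem_img[OF this] show ?thesis unfolding fun_on_def Lam_def by auto
qed

lemma ap_Lam:
  assumes "dft False (\<lambda>e. F (e 0))" "x \<epsilon> d" shows "ap (Lam d F) x = F x"
proof -
  have "dft False (\<lambda>e. opair (e 0) (F (e 0)))" by (intro dfn_intros assms)
  from mem_img[OF this] have "opair x (F x) \<epsilon> Lam d F" using assms(2) unfolding Lam_def by auto
  then show ?thesis using fun_on_ap[OF fun_on_Lam[OF assms(1)] assms(2)] by simp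
qed

lemma restr_ex: "\<exists>y. \<forall>p. p \<epsilon> y \<longleftrightarrow> p \<epsilon> f \<and> (\<exists>x y. x \<epsilon> d \<and> p = opair x y)"
  by (rule sep_ex) (intro dfn_intros)

lemma mem_restr: "p \<epsilon> restr f d \<longleftrightarrow> p \<epsilon> f \<and> (\<exists>x y. x \<epsilon> d \<and> p = opair x y)"
  unfolding restr_def by (rule set_of_mem) (rule restr_ex)

lemma dft_restr [dfn_intros]: "dft b s \<Longrightarrow> dft b t \<Longrightarrow> dft b (\<lambda>e. restr (s e) (t e))"
proof (rule dft_sub2[where F=restr])
  have "restr f d = coll (\<lambda>p. p \<epsilon> f \<and> (\<exists>x y. x \<epsilon> d \<and> p = opair x y))" for f d
    unfolding restr_def by (rule set_of_eq_coll) (rule restr_ex)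
  then show "dft b (\<lambda>e. restr (e 0) (e (Suc 0)))" by (simp only:) (intro dfn_intros)
qed

lemma ap_restr: "x \<epsilon> d \<Longrightarrow> ap (restr f d) x = ap f x"
  unfolding ap_def by (simp add: mem_restr)

lemma fun_on_restr: "fun_on f d \<Longrightarrow> subset c d \<Longrightarrow> fun_on (restr f c) c"
  unfolding fun_on_def by (auto simp: mem_restr subset_def)

lemma fun_into_restr: "fun_into f d r \<Longrightarrow> subset c d \<Longrightarrow> fun_into (restr f c) c r"
  by (auto simp: fun_into_iff ap_restr fun_on_restr subset_def)

lemma fun_into_Lam:
  assumes "dft False (\<lambda>e. F (e 0))" "\<And>x. x \<epsilon> d \<Longrightarrow> F x \<epsilon> r" shows "fun_into (Lam d F) d r"
  unfolding fun_into_iff using fun_on_Lam[OF assms(1)] ap_Lam[OF assms(1)] assms(2) by simp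

definition Fsp :: "'v \<Rightarrow> 'v \<Rightarrow> 'v" where "Fsp d r = coll (\<lambda>f. fun_into f d r)"

lemma mem_Fsp [simp]: "f \<epsilon> Fsp d r \<longleftrightarrow> fun_into f d r"
  unfolding Fsp_def
proof (rule mem_coll_sep)
  show "dfn False (\<lambda>e. fun_into (e 0) d r)" by (intro dfn_intros)
  \<comment> \<open>A Kuratowski pair of elements of \<open>d\<close> and \<open>r\<close> is a set
    of subsets of their union, hence three power sets.\<close>
  show "f \<epsilon> Pws (Pws (Pws (Uni (upair d r))))" if f: "fun_into f d r" for f
  proof -
    have "subset p (Pws (Uni (upair d r)))" if "p \<epsilon> f" for p
    proof -
      obtain x y where p: "x \<epsilon> d" "p = opair x y"
        using f \<open>p \<epsilon> f\<close> unfolding fun_into_def fun_on_def by blast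
      then have "y \<epsilon> r" using f \<open>p \<epsilon> f\<close> fun_on_ap unfolding fun_into_iff by auto
      then show ?thesis using p by (auto simp: subset_def opair_def)
    qed
    then show ?thesis by (simp add: subset_def)
  qed
qed

lemma dft_Fsp [dfn_intros]: "dft b s \<Longrightarrow> dft b t \<Longrightarrow> dft b (\<lambda>e. Fsp (s e) (t e))"
  by (rule dft_sub2[where F=Fsp], unfold Fsp_def) (intro dfn_intros)

text \<open>The axiom of choice speaks about disjoint families only, so each \<open>A\<close> is
  replaced by its product with the singleton of \<open>A\<close>. The resulting \<open>C\<close>
  serves as a choice function on the nonempty subsets of \<open>R\<close>.\<close>

lemma choice_ex:
  "\<exists>C. \<forall>A. subset A R \<longrightarrow> (\<exists>w. w \<epsilon> A) \<longrightarrow> (\<exists>!w. w \<epsilon> A \<and> opair A w \<epsilon> C)"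
proof -
  define F where "F A = img A (\<lambda>w. opair A w)" for A
  have F: "dft False (\<lambda>e. F (e 0))" unfolding F_def by (intro dfn_intros)
  have memF: "p \<epsilon> F A \<longleftrightarrow> (\<exists>w. w \<epsilon> A \<and> p = opair A w)" for p A
    unfolding F_def by (rule mem_img) (intro dfn_intros)
  have "dfn False (\<lambda>e. \<exists>w. w \<epsilon> e 0)" by (intro dfn_intros)
  from sep_ex[of "\<lambda>A. \<exists>w. w \<epsilon> A", OF this, of "Pws R"]
  obtain D where D: "\<forall>A. A \<epsilon> D \<longleftrightarrow> A \<epsilon> Pws R \<and> (\<exists>w. w \<epsilon> A)" ..
  have "\<exists>c. \<forall>y. y \<epsilon> img D F \<longrightarrow> (\<exists>!w. w \<epsilon> y \<and> w \<epsilon> c)"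
    by (rule choice) (auto simp: mem_img[OF F] memF D)
  then obtain C where C: "\<And>y. y \<epsilon> img D F \<Longrightarrow> (\<exists>!w. w \<epsilon> y \<and> w \<epsilon> C)" by blast
  have "\<exists>!w. w \<epsilon> A \<and> opair A w \<epsilon> C" if "subset A R" "\<exists>w. w \<epsilon> A" for A
  proof -
    have "F A \<epsilon> img D F" unfolding mem_img[OF F] using that D by (intro exI[of _ A]) simp
    from C[OF this] obtain p where p: "p \<epsilon> F A" "p \<epsilon> C"
      and u: "\<And>q. q \<epsilon> F A \<Longrightarrow> q \<epsilon> C \<Longrightarrow> q = p" by blast
    from p(1) obtain w where w: "w \<epsilon> A" "p = opair A w" unfolding memF by blast
    show ?thesis
    proof (rule ex1I[of _ w])
      show "v = w" if "v \<epsilon> A \<and> opair A v \<epsilon> C" for v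
        using that u[of "opair A v"] w by (auto simp: memF)
    qed (use p w in simp)
  qed
  then show ?thesis by blast
qed

subsection \<open>Ordinals\<close>

lemma dfn_transitive [dfn_intros]: "dft b s \<Longrightarrow> dfn b (\<lambda>e. transitive (s e))"
  by (rule dfn_sub1[where P=transitive], unfold transitive_def) (intro dfn_intros)

lemma dfn_Ord [dfn_intros]: "dft b s \<Longrightarrow> dfn b (\<lambda>e. Ord (s e))"
  by (rule dfn_sub1[where P=Ord], unfold Ord_def) (intro dfn_intros)

lemma dfn_Limit [dfn_intros]: "dft b s \<Longrightarrow> dfn b (\<lambda>e. Limit (s e))"
  by (rule dfn_sub1[where P=Limit], unfold Limit_def) (intro dfn_intros)

lemma mem_irrefl [simp]: "\<not> x \<epsilon> x"
  using foundation[of x "upair x x"] by auto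

lemma mem_asym: "x \<epsilon> y \<Longrightarrow> \<not> y \<epsilon> x"
  using foundation[of x "upair x y"] by auto

lemma Ord_in: "Ord a \<Longrightarrow> b \<epsilon> a \<Longrightarrow> Ord b"
  unfolding Ord_def transitive_def subset_def by blast

lemma Ord_trans: "Ord a \<Longrightarrow> b \<epsilon> a \<Longrightarrow> c \<epsilon> b \<Longrightarrow> c \<epsilon> a"
  unfolding Ord_def transitive_def subset_def by blast

lemma OrdI: "(\<And>x. x \<epsilon> a \<Longrightarrow> Ord x) \<Longrightarrow> (\<And>x y. x \<epsilon> a \<Longrightarrow> y \<epsilon> x \<Longrightarrow> y \<epsilon> a) \<Longrightarrow> Ord a"
  unfolding Ord_def transitive_def subset_def by blast

lemma Ord_succ [simp]: "Ord (succ a) \<longleftrightarrow> Ord a"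
proof
  assume "Ord (succ a)" then show "Ord a" by (rule Ord_in) simp
next
  assume a: "Ord a" show "Ord (succ a)"
    by (rule OrdI) (use a Ord_in Ord_trans in \<open>simp, blast\<close>)+
qed

lemma Ord_one [simp]: "Ord one"
  by (simp add: one_def)

lemma Ord_Uni:
  assumes "\<And>x. x \<epsilon> a \<Longrightarrow> Ord x" shows "Ord (Uni a)"
proof (rule OrdI)
  show "Ord x" if "x \<epsilon> Uni a" for x using that assms Ord_in by (simp, blast)
  show "y \<epsilon> Uni a" if "x \<epsilon> Uni a" "y \<epsilon> x" for x y
    using that assms Ord_trans by (simp, blast)
qed

lemma Ord_least:
  assumes "Ord a" "dfn False (\<lambda>e. P (e 0))" "P a"
  shows "\<exists>m. Ord m \<and> P m \<and> (\<forall>y. y \<epsilon> m \<longrightarrow> \<not> P y)"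
proof -
  obtain s where s: "\<forall>z. z \<epsilon> s \<longleftrightarrow> z \<epsilon> succ a \<and> P z" using sep_ex[OF assms(2)] by blast
  then have "a \<epsilon> s" using assms(3) by simp
  from foundation[OF this] obtain m where m: "m \<epsilon> s" "\<not> (\<exists>w. w \<epsilon> m \<and> w \<epsilon> s)" by blast
  then have "Ord m" "P m" using s assms(1) Ord_in Ord_succ by blast+
  moreover have "\<not> P y" if "y \<epsilon> m" for y
    using m that s Ord_trans[of "succ a" m y] assms(1) by auto
  ultimately show ?thesis by blast
qed

definition ord_least :: "('v \<Rightarrow> bool) \<Rightarrow> 'v" where
  "ord_least P = the0 (\<lambda>a. Ord a \<and> P a \<and> (\<forall>b. b \<epsilon> a \<longrightarrow> \<not> P b))"

lemma dft_ord_least [dfn_intros]: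
  assumes "dfn b (\<lambda>e. P (e 0) (\<lambda>n. e (Suc n)))"
  shows "dft b (\<lambda>e. ord_least (\<lambda>a. P a e))"
proof -
  have 1: "dfn b (\<lambda>e. P (e 0) (\<lambda>n. e (Suc (Suc n))))"
    using dfn_ren[OF assms, of "case_nat 0 (\<lambda>n. Suc (Suc n))"] by simp
  show ?thesis unfolding ord_least_def by (intro dfn_intros 1 assms)
qed

lemma Ord_induct:
  assumes "Ord a" "dfn False (\<lambda>e. P (e 0))"
    and step: "\<And>x. Ord x \<Longrightarrow> (\<And>y. y \<epsilon> x \<Longrightarrow> P y) \<Longrightarrow> P x"
  shows "P a"
proof (rule ccontr)
  assume "\<not> P a"
  then obtain m where "Ord m" "\<not> P m" "\<forall>y. y \<epsilon> m \<longrightarrow> \<not> \<not> P y"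
    using Ord_least[OF assms(1), of "\<lambda>x. \<not> P x"] dfn_neg[OF assms(2)] by blast
  then show False using step by blast
qed

lemma Ord_linear:
  assumes "Ord a" "Ord b" shows "a \<epsilon> b \<or> a = b \<or> b \<epsilon> a"
proof -
  have "\<forall>b. Ord b \<longrightarrow> a \<epsilon> b \<or> a = b \<or> b \<epsilon> a"
    using assms(1)
  proof (rule Ord_induct[where P="\<lambda>a. \<forall>b. Ord b \<longrightarrow> a \<epsilon> b \<or> a = b \<or> b \<epsilon> a"])
    show "dfn False (\<lambda>e. \<forall>b. Ord b \<longrightarrow> e 0 \<epsilon> b \<or> e 0 = b \<or> b \<epsilon> e 0)" by (intro dfn_intros)
    fix x assume x: "Ord x" and IH: "\<And>y. y \<epsilon> x \<Longrightarrow> \<forall>b. Ord b \<longrightarrow> y \<epsilon> b \<or> y = b \<or> b \<epsilon> y"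
    have "x \<epsilon> b \<or> x = b \<or> b \<epsilon> x" if "Ord b" for b
      using that
    proof (rule Ord_induct[where P="\<lambda>b. x \<epsilon> b \<or> x = b \<or> b \<epsilon> x"])
      show "dfn False (\<lambda>e. x \<epsilon> e 0 \<or> x = e 0 \<or> e 0 \<epsilon> x)" by (intro dfn_intros)
      fix c assume c: "Ord c" and IH2: "\<And>y. y \<epsilon> c \<Longrightarrow> x \<epsilon> y \<or> x = y \<or> y \<epsilon> x"
      show "x \<epsilon> c \<or> x = c \<or> c \<epsilon> x"
      proof (rule ccontr)
        assume n: "\<not> ?thesis"
        have "z \<epsilon> x \<longleftrightarrow> z \<epsilon> c" for z
          using n IH IH2 x c Ord_trans by metis
        then have "x = c" by (rule extensionality)
        then show False using n by blast
      qed
    qed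
    then show "\<forall>b. Ord b \<longrightarrow> x \<epsilon> b \<or> x = b \<or> b \<epsilon> x" by blast
  qed
  then show ?thesis using assms(2) by blast
qed

lemma ord_least:
  assumes "Ord a" "dfn False (\<lambda>e. P (e 0))" "P a"
  shows "Ord (ord_least P) \<and> P (ord_least P)"
proof -
  obtain m where m: "Ord m" "P m" "\<forall>y. y \<epsilon> m \<longrightarrow> \<not> P y" using Ord_least[of a P] assms by blast
  have "ord_least P = m" unfolding ord_least_def
    by (rule the0_eq) (use m Ord_linear in blast)+
  then show ?thesis using m by simp
qed

lemma Ord_subset_iff: "Ord a \<Longrightarrow> Ord b \<Longrightarrow> subset a b \<longleftrightarrow> a \<epsilon> b \<or> a = b"
  unfolding subset_def using Ord_linear[of a b] Ord_trans[of b a] mem_irrefl mem_asym by blast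

lemma succ_inj [simp]: "succ a = succ b \<longleftrightarrow> a = b"
  by (metis mem_succ mem_asym)

lemma succ_neq_zero [simp]: "succ a \<noteq> zero" "zero \<noteq> succ a"
  by (metis mem_succ mem_zero)+

lemma succ_mem_succ: "Ord b \<Longrightarrow> succ a \<epsilon> succ b \<longleftrightarrow> a \<epsilon> b"
proof
  assume b: "Ord b" and "a \<epsilon> b"
  then have "Ord a" by (rule Ord_in)
  then show "succ a \<epsilon> succ b"
    using Ord_linear[of "succ a" "succ b"] b \<open>a \<epsilon> b\<close> mem_asym by auto
next
  assume "Ord b" "succ a \<epsilon> succ b" then show "a \<epsilon> b" using Ord_trans[of b] by auto
qed

lemma Ord_cases:
  assumes "Ord a" obtains "a = zero" | b where "a = succ b" "Ord b" | "Limit a"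
proof (cases "\<exists>b. a = succ b")
  case True
  then show ?thesis using that assms by auto
next
  case False
  have "succ c \<epsilon> a" if "c \<epsilon> a" for c
    using Ord_linear[of "succ c" a] that Ord_in[OF assms that] assms False mem_asym by auto
  moreover have "zero \<epsilon> a \<or> a = zero" using Ord_linear[OF assms Ord_zero] by auto
  ultimately show ?thesis using that assms unfolding Limit_def by blast
qed

lemma Limit_Ord: "Limit a \<Longrightarrow> Ord a" unfolding Limit_def by blast

lemma not_Limit_succ: "\<not> Limit (succ a)"
  unfolding Limit_def by (metis mem_succ mem_irrefl)

subsection \<open>Recursion\<close>

text \<open>A variant of \<open>ord_rec\<close> in which the step function receives the earlier
  values as a set of the model instead of a function of the metatheory. This is what makes
  definability pass from \<open>G\<close> to \<open>trec G\<close>.\<close>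

definition trec :: "('v \<Rightarrow> 'v \<Rightarrow> 'v) \<Rightarrow> 'v \<Rightarrow> 'v" where
  "trec G a = the0 (\<lambda>c. \<exists>f. fun_on f (succ a) \<and>
     (\<forall>x. x \<epsilon> succ a \<longrightarrow> ap f x = G x (restr f x)) \<and> c = ap f a)"

lemma dft_trec [dfn_intros]:
  assumes "dft b (\<lambda>e. G (e 0) (e (Suc 0)) (\<lambda>n. e (Suc (Suc n))))" "dft b a"
  shows "dft b (\<lambda>e. trec (\<lambda>x f. G x f e) (a e))"
proof -
  have "dft b (\<lambda>e. G (e 0) (restr (e (Suc 0)) (e 0)) (\<lambda>n. e (Suc (Suc n))))"
    by (rule dft_sub[where F="\<lambda>r e. G (e 0) r (\<lambda>n. e (Suc (Suc n)))"])
      (use dft_ren[OF assms(1), of "case_nat 1 (case_nat 0 (\<lambda>n. Suc (Suc (Suc n))))"]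
        in \<open>auto intro: dfn_intros\<close>)
  from dft_ren[OF this, of "case_nat 0 (case_nat 1 (\<lambda>n. Suc (Suc (Suc n))))"]
  have 1: "dft b (\<lambda>e. G (e 0) (restr (e (Suc 0)) (e 0)) (\<lambda>n. e (Suc (Suc (Suc n)))))" by simp
  show ?thesis unfolding trec_def by (intro dfn_intros 1 dft_ren[OF assms(2)])
qed

context
  fixes G assumes G: "dft False (\<lambda>e. G (e 0) (e (Suc 0)))"
begin

definition attempt :: "'v \<Rightarrow> 'v \<Rightarrow> bool" where
  "attempt f a \<longleftrightarrow> fun_on f (succ a) \<and> (\<forall>x. x \<epsilon> succ a \<longrightarrow> ap f x = G x (restr f x))"

lemma subset_succ_Ord: "Ord a \<Longrightarrow> x \<epsilon> succ a \<Longrightarrow> subset x (succ a)"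
  using Ord_trans[of "succ a" x] by (simp add: subset_def)

lemma attempt_unique:
  assumes "Ord x" "Ord a" "Ord c" "attempt f a" "attempt g c" "x \<epsilon> succ a" "x \<epsilon> succ c"
  shows "ap f x = ap g x"
proof -
  have "x \<epsilon> succ a \<longrightarrow> x \<epsilon> succ c \<longrightarrow> ap f x = ap g x"
    using assms(1)
  proof (rule Ord_induct[where P="\<lambda>x. x \<epsilon> succ a \<longrightarrow> x \<epsilon> succ c \<longrightarrow> ap f x = ap g x"])
    show "dfn False (\<lambda>e. e 0 \<epsilon> succ a \<longrightarrow> e 0 \<epsilon> succ c \<longrightarrow> ap f (e 0) = ap g (e 0))"
      by (intro dfn_intros)
    fix x assume "Ord x"
      and IH: "\<And>y. y \<epsilon> x \<Longrightarrow> y \<epsilon> succ a \<longrightarrow> y \<epsilon> succ c \<longrightarrow> ap f y = ap g y"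
    show "x \<epsilon> succ a \<longrightarrow> x \<epsilon> succ c \<longrightarrow> ap f x = ap g x"
    proof (intro impI)
      assume x: "x \<epsilon> succ a" "x \<epsilon> succ c"
      have s: "subset x (succ a)" "subset x (succ c)"
        using x subset_succ_Ord assms(2,3) by blast+
      have "restr f x = restr g x"
        by (rule fun_ext[of _ x])
          (use s assms(4,5) IH in \<open>auto simp: attempt_def ap_restr subset_def intro!: fun_on_restr\<close>)
      then show "ap f x = ap g x" using x assms(4,5) unfolding attempt_def by metis
    qed
  qed
  then show ?thesis using assms by blast
qed

lemma trec_eq_attempt: "Ord a \<Longrightarrow> attempt f a \<Longrightarrow> trec G a = ap f a"
  unfolding trec_def
  by (rule the0_eq) (use attempt_unique[of a a a] in \<open>auto simp: attempt_def\<close>)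

lemma attempt_restr: "Ord a \<Longrightarrow> attempt f a \<Longrightarrow> x \<epsilon> a \<Longrightarrow> attempt (restr f (succ x)) x"
proof -
  assume a: "Ord a" "attempt f a" "x \<epsilon> a"
  have s: "subset (succ x) (succ a)" using a Ord_trans[of a x] by (auto simp: subset_def)
  have "restr (restr f (succ x)) y = restr f y" if "y \<epsilon> succ x" for y
  proof (rule extensionality)
    have "Ord x" using a Ord_in by blast
    then have "subset y (succ x)" using that subset_succ_Ord by blast
    then show "p \<epsilon> restr (restr f (succ x)) y \<longleftrightarrow> p \<epsilon> restr f y" for p
      unfolding mem_restr subset_def by blast
  qed
  then show ?thesis using a s unfolding attempt_def
    by (auto simp: ap_restr subset_def intro!: fun_on_restr)
qed

lemma attempt_trec: "Ord a \<Longrightarrow> attempt f a \<Longrightarrow> x \<epsilon> succ a \<Longrightarrow> trec G x = ap f x"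
  using attempt_restr[of a f x] trec_eq_attempt[of x "restr f (succ x)"] trec_eq_attempt[of a f]
    ap_restr[of x "succ x" f] Ord_in[of a x] by auto

lemma dft_trec1: "dft False (\<lambda>e. trec G (e 0))"
  by (rule dft_trec[where G="\<lambda>x f e. G x f"]) (intro G dfn_intros)+

text \<open>Partial solutions agree where both are defined, so below \<open>a\<close> their values
  are those of \<open>trec G\<close>. Replacement collects them in \<open>g\<close>, and only the
  value at \<open>a\<close> has to be added.\<close>

lemma attempt_ex: "Ord a \<Longrightarrow> \<exists>f. attempt f a"
proof (rule Ord_induct[where P="\<lambda>a. \<exists>f. attempt f a"])
  show "dfn False (\<lambda>e. \<exists>f. attempt f (e 0))" unfolding attempt_def
    by (intro dfn_intros dft_sub2[where F=G, OF G])
  fix a assume a: "Ord a" and IH: "\<And>y. y \<epsilon> a \<Longrightarrow> \<exists>f. attempt f y"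
  define g where "g = Lam a (trec G)"
  define f where "f = Lam (succ a) (\<lambda>x. if x = a then G a g else trec G x)"
  have d: "dft False (\<lambda>e. if e 0 = a then G a g else trec G (e 0))"
    by (intro dfn_intros dft_trec1)
  have apf: "ap f x = (if x = a then G a g else trec G x)" if "x \<epsilon> succ a" for x
    unfolding f_def using ap_Lam[OF d that] .
  have fon: "fun_on f (succ a)" unfolding f_def by (rule fun_on_Lam[OF d])
  have "restr f a = g"
    by (rule fun_ext[of _ a])
      (auto simp: g_def subset_def ap_restr apf ap_Lam[OF dft_trec1] fun_on_Lam[OF dft_trec1]
        intro!: fun_on_restr[OF fon])
  then have 1: "ap f a = G a (restr f a)" using apf[of a] by simp
  have 2: "ap f x = G x (restr f x)" if x: "x \<epsilon> a" for x
  proof -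
    obtain h where h: "attempt h x" using IH[OF x] by blast
    have ox: "Ord x" using a x Ord_in by blast
    have s: "subset x (succ a)" using a x subset_succ_Ord by simp
    have "restr h x = restr f x"
    proof (rule fun_ext[of _ x])
      show "fun_on (restr h x) x"
        using h unfolding attempt_def by (auto simp: subset_def intro!: fun_on_restr)
      show "fun_on (restr f x) x" using s by (intro fun_on_restr[OF fon])
      show "ap (restr h x) y = ap (restr f x) y" if "y \<epsilon> x" for y
        using that attempt_trec[OF ox h, of y] apf[of y] s Ord_trans[OF a x that]
        by (auto simp: ap_restr)
    qed
    moreover have "ap f x = ap h x" using attempt_trec[OF ox h, of x] apf[of x] x by auto
    ultimately show ?thesis using h unfolding attempt_def by simp
  qed
  have "attempt f a" unfolding attempt_def using fon 1 2 by auto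
  then show "\<exists>f. attempt f a" by blast
qed

lemma trec_unfold:
  assumes "Ord a" shows "trec G a = G a (Lam a (trec G))"
proof -
  obtain f where f: "attempt f a" using attempt_ex[OF assms] by blast
  have fon: "fun_on f (succ a)" using f unfolding attempt_def by blast
  have "restr f a = Lam a (trec G)"
    by (rule fun_ext[of _ a])
      (auto simp: subset_def ap_restr ap_Lam[OF dft_trec1] fun_on_Lam[OF dft_trec1]
          attempt_trec[OF assms f] intro!: fun_on_restr[OF fon])
  then show ?thesis using attempt_trec[OF assms f, of a] f unfolding attempt_def by simp
qed

text \<open>The hypothesis on \<open>H\<close> says that \<open>H F x\<close> depends only on the
  values of \<open>F\<close> below \<open>x\<close>; hence \<open>F\<close> may be replaced by a
  restriction that is a set.\<close>

lemma ord_rec_eq_trec: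
  assumes "Ord a" and H: "\<And>F x g. (\<And>y. y \<epsilon> x \<Longrightarrow> F y = ap g y) \<Longrightarrow> H F x = G x g"
  shows "ord_rec H a = trec G a"
proof -
  have "(fun_on f (succ a) \<and> (\<forall>x. x \<epsilon> succ a \<longrightarrow> app f x = H (app f) x) \<and> c = app f a) \<longleftrightarrow>
    attempt f a \<and> c = ap f a" for c f
  proof -
    have "app f x = ap f x \<and> H (app f) x = G x (restr f x)" if "fun_on f (succ a)" "x \<epsilon> succ a" for x
      using that H[of x "app f" "restr f x"] subset_succ_Ord[OF assms(1) that(2)] app_ap[OF that(1)]
      by (simp add: ap_restr subset_def)
    then show ?thesis unfolding attempt_def by auto
  qed
  then have "ord_rec H a = (THE c. \<exists>f. attempt f a \<and> c = ap f a)"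
    unfolding ord_rec_def by simp
  also have "\<dots> = trec G a"
  proof (rule the_equality)
    obtain f where f: "attempt f a" using attempt_ex[OF assms(1)] by blast
    then show "\<exists>f. attempt f a \<and> trec G a = ap f a"
      using trec_eq_attempt[OF assms(1) f] by blast
    show "c = trec G a" if "\<exists>f. attempt f a \<and> c = ap f a" for c
      using that trec_eq_attempt[OF assms(1)] by auto
  qed
  finally show ?thesis .
qed

end

subsection \<open>Natural numbers\<close>

text \<open>The finite ordinals described without \<open>omega\<close>, which is itself only given
  as the least limit ordinal and has to be shown to exist.\<close>

definition natv :: "'v \<Rightarrow> bool" where
  "natv x \<longleftrightarrow> Ord x \<and> (\<forall>y. y \<epsilon> succ x \<longrightarrow> y = zero \<or> (\<exists>z. y = succ z))"

lemma dfn_natv [dfn_intros]: "dft b s \<Longrightarrow> dfn b (\<lambda>e. natv (s e))"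
  by (rule dfn_sub1[where P=natv], unfold natv_def) (intro dfn_intros)

lemma natv_zero: "natv zero"
  by (simp add: natv_def)

lemma natv_succ: "natv x \<Longrightarrow> natv (succ x)"
  by (simp add: natv_def)

lemma natv_in: "natv x \<Longrightarrow> y \<epsilon> x \<Longrightarrow> natv y"
  unfolding natv_def using Ord_in Ord_trans mem_succ by metis

lemma natv_cases: "natv x \<Longrightarrow> x = zero \<or> (\<exists>z. x = succ z \<and> natv z)"
  using natv_in by (metis mem_succ natv_def)

lemma natv_induct:
  assumes "natv x" "dfn False (\<lambda>e. P (e 0))" "P zero"
    and step: "\<And>k. natv k \<Longrightarrow> P k \<Longrightarrow> P (succ k)"
  shows "P x"
proof -
  have "natv x \<longrightarrow> P x"
  proof (rule Ord_induct[where P="\<lambda>x. natv x \<longrightarrow> P x"])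
    show "Ord x" using assms(1) by (simp add: natv_def)
    show "dfn False (\<lambda>e. natv (e 0) \<longrightarrow> P (e 0))" by (intro dfn_intros assms(2))
    show "natv a \<longrightarrow> P a" if "\<And>y. y \<epsilon> a \<Longrightarrow> natv y \<longrightarrow> P y" for a
      using that natv_cases[of a] step assms(3) by auto
  qed
  then show ?thesis using assms(1) by blast
qed

lemma not_Limit_natv: "natv x \<Longrightarrow> \<not> Limit x"
  using natv_cases[of x] not_Limit_succ mem_zero unfolding Limit_def by metis

text \<open>The axiom of infinity provides some inductive set \<open>I\<close>. By induction all
  finite ordinals belong to it, so Separation makes them a set \<open>N\<close>, and this is a limit
  ordinal without limit ordinals in it.\<close>

lemma mem_omega_natv: "x \<epsilon> omega \<longleftrightarrow> natv x" and Limit_omega: "Limit omega"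
proof -
  obtain I z0 where I: "z0 \<epsilon> I" "\<forall>w. \<not> w \<epsilon> z0"
    "\<And>y. y \<epsilon> I \<Longrightarrow> \<exists>s. s \<epsilon> I \<and> (\<forall>w. w \<epsilon> s \<longleftrightarrow> w \<epsilon> y \<or> w = y)"
    using infinity by metis
  have "z0 = zero" by (rule extensionality) (use I in auto)
  then have 0: "zero \<epsilon> I" using I by simp
  have S: "succ y \<epsilon> I" if y: "y \<epsilon> I" for y
  proof -
    obtain s where s: "s \<epsilon> I" "\<forall>w. w \<epsilon> s \<longleftrightarrow> w \<epsilon> y \<or> w = y" using I(3)[OF y] by blast
    then have "s = succ y" by (intro extensionality) simp
    then show ?thesis using s by simp
  qed
  have in_I: "x \<epsilon> I" if "natv x" for x
    using that by (rule natv_induct[where P="\<lambda>x. x \<epsilon> I"]; (intro dfn_intros)?; simp add: 0 S)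
  have d: "dfn False (\<lambda>e. natv (e 0))" by (intro dfn_intros)
  obtain N where N: "\<forall>x. x \<epsilon> N \<longleftrightarrow> x \<epsilon> I \<and> natv x" using sep_ex[OF d] by blast
  then have N: "x \<epsilon> N \<longleftrightarrow> natv x" for x using in_I by blast
  have oN: "Ord N"
  proof (rule OrdI)
    show "Ord x" if "x \<epsilon> N" for x using that N unfolding natv_def by blast
    show "y \<epsilon> N" if "x \<epsilon> N" "y \<epsilon> x" for x y using that N natv_in by blast
  qed
  have LN: "Limit N" unfolding Limit_def using oN by (simp add: N natv_zero natv_succ)
  have "omega = N" unfolding omega_def
  proof (rule the_equality)
    show "Limit N \<and> (\<forall>k. k \<epsilon> N \<longrightarrow> \<not> Limit k)" using LN not_Limit_natv by (simp add: N)
    show "l = N" if "Limit l \<and> (\<forall>k. k \<epsilon> l \<longrightarrow> \<not> Limit k)" for l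
      using that LN not_Limit_natv Ord_linear[of l N] oN N Limit_Ord by blast
  qed
  then show "x \<epsilon> omega \<longleftrightarrow> natv x" "Limit omega" using N LN by simp_all
qed

lemma Ord_omega [simp]: "Ord omega"
  using Limit_omega by (rule Limit_Ord)

lemma dft_omega [dfn_intros]: "dft b (\<lambda>e. omega)"
  by (rule dft_Ord) simp

lemma zero_omega [simp]: "zero \<epsilon> omega"
  by (simp add: mem_omega_natv natv_zero)

lemma succ_omega [simp]: "succ n \<epsilon> omega \<longleftrightarrow> n \<epsilon> omega"
  using natv_succ natv_in[of "succ n" n] by (auto simp: mem_omega_natv)

lemma omega_cases: "n \<epsilon> omega \<Longrightarrow> n = zero \<or> (\<exists>k. k \<epsilon> omega \<and> n = succ k)"
  using natv_cases by (auto simp: mem_omega_natv)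

lemma omega_Ord: "n \<epsilon> omega \<Longrightarrow> Ord n"
  using Ord_in Ord_omega by blast

lemma omega_trans: "n \<epsilon> omega \<Longrightarrow> k \<epsilon> n \<Longrightarrow> k \<epsilon> omega"
  using Ord_trans Ord_omega by blast

lemma omega_induct:
  assumes "n \<epsilon> omega" "dfn False (\<lambda>e. P (e 0))" "P zero"
    and "\<And>k. k \<epsilon> omega \<Longrightarrow> P k \<Longrightarrow> P (succ k)"
  shows "P n"
  using assms natv_induct[of n P] by (simp add: mem_omega_natv)

lemma Uni_succ: "Ord n \<Longrightarrow> Uni (succ n) = n"
  by (rule extensionality) (use Ord_trans in auto)

text \<open>Primitive recursion as a special case of recursion on ordinals; \<open>Uni n\<close> is
  the predecessor of a successor \<open>n\<close>.\<close>

definition nrec :: "'v \<Rightarrow> ('v \<Rightarrow> 'v \<Rightarrow> 'v) \<Rightarrow> 'v \<Rightarrow> 'v" where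
  "nrec a F n = trec (\<lambda>n g. if n = zero then a else F (Uni n) (ap g (Uni n))) n"

lemma dft_F2:
  assumes "dft b (\<lambda>e. F (e 0) (e (Suc 0)) (\<lambda>n. e (Suc (Suc n))))" "dft b s" "dft b t"
  shows "dft b (\<lambda>e. F (s e) (t e) e)"
proof (rule dft_sub[where F="\<lambda>x e. F x (t e) e", OF _ assms(2)])
  show "dft b (\<lambda>e. F (e 0) (t (\<lambda>n. e (Suc n))) (\<lambda>n. e (Suc n)))"
    by (rule dft_sub[where F="\<lambda>x e. F (e 0) x (\<lambda>n. e (Suc n))"])
      (use dft_ren[OF assms(1), of "case_nat 1 (case_nat 0 (\<lambda>n. Suc (Suc n)))"]
        dft_ren[OF assms(3)] in auto)
qed

lemma dft_nrec [dfn_intros]: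
  assumes "dft b a" "dft b (\<lambda>e. F (e 0) (e (Suc 0)) (\<lambda>n. e (Suc (Suc n))))" "dft b t"
  shows "dft b (\<lambda>e. nrec (a e) (\<lambda>k y. F k y e) (t e))"
proof -
  have "dft b (\<lambda>e. F (e 0) (e (Suc 0)) (\<lambda>n. e (Suc (Suc (Suc (Suc n))))))"
    using dft_ren[OF assms(2), of "case_nat 0 (case_nat 1 (\<lambda>n. Suc (Suc (Suc (Suc n)))))"] by simp
  from dft_F2[where F="\<lambda>x y e. F x y (\<lambda>n. e (Suc (Suc n)))", OF this]
  have 1: "dft b (\<lambda>e. F (s e) (u e) (\<lambda>n. e (Suc (Suc n))))" if "dft b s" "dft b u" for s u
    using that by simp
  show ?thesis unfolding nrec_def by (intro dfn_intros 1 dft_ren[OF assms(1)] assms(3))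
qed

lemma
  assumes F: "dft False (\<lambda>e. F (e 0) (e (Suc 0)))"
  shows nrec_zero: "nrec a F zero = a"
    and nrec_succ: "n \<epsilon> omega \<Longrightarrow> nrec a F (succ n) = F n (nrec a F n)"
proof -
  let ?G = "\<lambda>n g. if n = zero then a else F (Uni n) (ap g (Uni n))"
  have G: "dft False (\<lambda>e. ?G (e 0) (e (Suc 0)))" by (intro dfn_intros dft_sub2[where F=F, OF F])
  have T: "dft False (\<lambda>e. trec ?G (e 0))" by (rule dft_trec1[OF G])
  show "nrec a F zero = a" unfolding nrec_def by (simp add: trec_unfold[OF G])
  show "nrec a F (succ n) = F n (nrec a F n)" if n: "n \<epsilon> omega"
    unfolding nrec_def trec_unfold[OF G, of "succ n", unfolded Ord_succ, OF omega_Ord[OF n]]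
    by (simp add: Uni_succ[OF omega_Ord[OF n]] ap_Lam[OF T])
qed

subsection \<open>Ordinal addition\<close>

definition pl :: "'v \<Rightarrow> 'v \<Rightarrow> 'v" (infixl "\<oplus>" 65) where
  "a \<oplus> x = trec (\<lambda>x g. coll (\<lambda>z. z \<epsilon> a \<or> (\<exists>y. y \<epsilon> x \<and> z = ap g y))) x"

lemma dft_pl [dfn_intros]: "dft b s \<Longrightarrow> dft b t \<Longrightarrow> dft b (\<lambda>e. s e \<oplus> t e)"
  by (rule dft_sub2[where F=pl], unfold pl_def) (intro dfn_intros)

lemma mem_Uni_upair: "z \<epsilon> Uni (upair x y) \<longleftrightarrow> z \<epsilon> x \<or> z \<epsilon> y"
  by auto

lemma pl_aux_ex:
  assumes "dft False (\<lambda>e. F (e 0))" shows "\<exists>w. \<forall>z. z \<epsilon> w \<longleftrightarrow> z \<epsilon> a \<or> (\<exists>y. y \<epsilon> x \<and> z = F y)"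
  by (rule exI[of _ "Uni (upair a (img x F))"]) (simp add: mem_Uni_upair mem_img[OF assms] del: mem_Uni)

lemma oadd_pl: "Ord x \<Longrightarrow> oadd a x = a \<oplus> x"
  unfolding oadd_def pl_def
proof (rule ord_rec_eq_trec)
  show "dft False (\<lambda>e. coll (\<lambda>z. z \<epsilon> a \<or> (\<exists>y. y \<epsilon> e 0 \<and> z = ap (e (Suc 0)) y)))"
    by (intro dfn_intros)
  fix F x g assume F: "\<And>y. y \<epsilon> x \<Longrightarrow> F y = ap g y"
  have "(\<lambda>z. z \<epsilon> a \<or> (\<exists>y. y \<epsilon> x \<and> z = F y)) = (\<lambda>z. z \<epsilon> a \<or> (\<exists>y. y \<epsilon> x \<and> z = ap g y))"
    by (rule ext) (metis F)
  then show "set_of (\<lambda>z. z \<epsilon> a \<or> (\<exists>y. y \<epsilon> x \<and> z = F y)) =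
    coll (\<lambda>z. z \<epsilon> a \<or> (\<exists>y. y \<epsilon> x \<and> z = ap g y))"
    by (simp only:) (intro set_of_eq_coll pl_aux_ex dfn_intros)
qed

lemma mem_pl: "Ord x \<Longrightarrow> z \<epsilon> a \<oplus> x \<longleftrightarrow> z \<epsilon> a \<or> (\<exists>y. y \<epsilon> x \<and> z = a \<oplus> y)"
proof -
  assume x: "Ord x"
  let ?G = "\<lambda>x g. coll (\<lambda>z. z \<epsilon> a \<or> (\<exists>y. y \<epsilon> x \<and> z = ap g y))"
  have G: "dft False (\<lambda>e. ?G (e 0) (e (Suc 0)))" by (intro dfn_intros)
  have d: "dft False (\<lambda>e. a \<oplus> e 0)" by (intro dfn_intros)
  have eq: "trec ?G = pl a" by (rule ext) (simp only: pl_def)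
  have "a \<oplus> x = coll (\<lambda>z. z \<epsilon> a \<or> (\<exists>y. y \<epsilon> x \<and> z = ap (Lam x (pl a)) y))"
    using trec_unfold[OF G x] unfolding eq .
  moreover have "(\<lambda>z. z \<epsilon> a \<or> (\<exists>y. y \<epsilon> x \<and> z = ap (Lam x (pl a)) y)) =
    (\<lambda>z. z \<epsilon> a \<or> (\<exists>y. y \<epsilon> x \<and> z = a \<oplus> y))" by (rule ext) (auto simp: ap_Lam[OF d])
  ultimately show ?thesis using mem_coll[OF pl_aux_ex[OF d]] by simp
qed

lemma pl_zero [simp]: "a \<oplus> zero = a"
  by (rule extensionality) (simp add: mem_pl)

lemma pl_succ: "Ord x \<Longrightarrow> a \<oplus> succ x = succ (a \<oplus> x)"
  by (rule extensionality) (auto simp: mem_pl)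

lemma pl_succ_omega [simp]: "n \<epsilon> omega \<Longrightarrow> a \<oplus> succ n = succ (a \<oplus> n)"
  by (rule pl_succ) (rule omega_Ord)

lemma Ord_pl [simp]: "Ord a \<Longrightarrow> n \<epsilon> omega \<Longrightarrow> Ord (a \<oplus> n)"
  by (rule omega_induct[where P="\<lambda>n. Ord (a \<oplus> n)"]; (intro dfn_intros)?; simp)

lemma pl_mono: "n \<epsilon> omega \<Longrightarrow> m \<epsilon> n \<Longrightarrow> a \<oplus> m \<epsilon> a \<oplus> n"
  using mem_pl[of n "a \<oplus> m" a] omega_Ord by auto

lemma pl_inj: "n \<epsilon> omega \<Longrightarrow> m \<epsilon> omega \<Longrightarrow> a \<oplus> n = a \<oplus> m \<longleftrightarrow> n = m"
  by (metis Ord_linear omega_Ord pl_mono mem_irrefl)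

lemma pl_le: "n \<epsilon> omega \<Longrightarrow> z \<epsilon> a \<Longrightarrow> z \<epsilon> a \<oplus> n"
  by (simp add: mem_pl omega_Ord)

lemma pl_not_mem: "n \<epsilon> omega \<Longrightarrow> \<not> a \<oplus> n \<epsilon> a"
  using pl_le mem_irrefl by blast

lemma Limit_pl: "Limit l \<Longrightarrow> a \<epsilon> l \<Longrightarrow> n \<epsilon> omega \<Longrightarrow> a \<oplus> n \<epsilon> l"
  by (rule omega_induct[where P="\<lambda>n. a \<oplus> n \<epsilon> l"]; (intro dfn_intros)?; simp add: Limit_def)

lemma mem_pl_omega: "z \<epsilon> a \<oplus> omega \<longleftrightarrow> z \<epsilon> a \<or> (\<exists>n. n \<epsilon> omega \<and> z = a \<oplus> n)"
  by (simp add: mem_pl)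

lemma Ord_pl_omega: assumes "Ord a" shows "Ord (a \<oplus> omega)"
proof (rule OrdI)
  show "Ord x" if "x \<epsilon> a \<oplus> omega" for x using that Ord_in assms by (auto simp: mem_pl_omega)
  show "y \<epsilon> a \<oplus> omega" if xy: "x \<epsilon> a \<oplus> omega" "y \<epsilon> x" for x y
  proof (cases "x \<epsilon> a")
    case True
    then show ?thesis using xy(2) Ord_trans[OF assms] by (auto simp: mem_pl_omega)
  next
    case False
    then obtain n where n: "n \<epsilon> omega" "x = a \<oplus> n" using xy(1) by (auto simp: mem_pl_omega)
    then show ?thesis using xy(2) omega_trans[OF n(1)]
      by (auto simp: mem_pl_omega mem_pl[OF omega_Ord])
  qed
qed

lemma pl_omega_mem: "n \<epsilon> omega \<Longrightarrow> a \<oplus> n \<epsilon> a \<oplus> omega"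
  by (auto simp: mem_pl_omega)

definition LZ :: "'v \<Rightarrow> bool" where "LZ l \<longleftrightarrow> l = zero \<or> Limit l"

lemma dfn_LZ [dfn_intros]: "dft b s \<Longrightarrow> dfn b (\<lambda>e. LZ (s e))"
  unfolding LZ_def by (intro dfn_intros)

lemma LZ_Ord: "LZ l \<Longrightarrow> Ord l"
  by (auto simp: LZ_def Limit_def)

lemma Ord_decomp: "Ord a \<Longrightarrow> \<exists>l n. LZ l \<and> n \<epsilon> omega \<and> a = l \<oplus> n"
proof (rule Ord_induct[where P="\<lambda>a. \<exists>l n. LZ l \<and> n \<epsilon> omega \<and> a = l \<oplus> n"])
  show "dfn False (\<lambda>e. \<exists>l n. LZ l \<and> n \<epsilon> omega \<and> e 0 = l \<oplus> n)" by (intro dfn_intros)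
  fix a assume "Ord a" and IH: "\<And>y. y \<epsilon> a \<Longrightarrow> \<exists>l n. LZ l \<and> n \<epsilon> omega \<and> y = l \<oplus> n"
  from \<open>Ord a\<close> show "\<exists>l n. LZ l \<and> n \<epsilon> omega \<and> a = l \<oplus> n"
  proof (cases rule: Ord_cases)
    case (2 b)
    then obtain l n where "LZ l" "n \<epsilon> omega" "b = l \<oplus> n" using IH[of b] by auto
    then show ?thesis using 2 by (intro exI[of _ l] exI[of _ "succ n"]) simp
  next
    case 1
    then show ?thesis by (intro exI[of _ a] exI[of _ zero]) (simp add: LZ_def)
  next
    case 3
    then show ?thesis by (intro exI[of _ a] exI[of _ zero]) (simp add: LZ_def)
  qed
qed

text \<open>If \<open>l\<close> were below \<open>k\<close>, then \<open>k\<close> would be a limit,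
  hence closed under adding natural numbers, and \<open>l \<oplus> n\<close> would already be below
  \<open>k\<close>.\<close>

lemma Ord_decomp_unique:
  assumes "LZ l" "LZ k" "n \<epsilon> omega" "m \<epsilon> omega" "l \<oplus> n = k \<oplus> m"
  shows "l = k" "n = m"
proof -
  have "\<not> l \<epsilon> k" if "LZ l" "LZ k" "n \<epsilon> omega" "m \<epsilon> omega" "l \<oplus> n = k \<oplus> m" for l k n m
  proof
    assume "l \<epsilon> k"
    then have "Limit k" using that by (auto simp: LZ_def)
    then have "l \<oplus> n \<epsilon> k" using \<open>l \<epsilon> k\<close> that Limit_pl by blast
    then show False using that pl_not_mem by simp
  qed
  then show "l = k" using assms Ord_linear[of l k] LZ_Ord by metis
  then show "n = m" using assms pl_inj by blast
qed

definition dbl :: "'v \<Rightarrow> 'v" where "dbl n = n \<oplus> n"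

lemma dft_dbl [dfn_intros]: "dft b s \<Longrightarrow> dft b (\<lambda>e. dbl (s e))"
  unfolding dbl_def by (intro dfn_intros)

lemma succ_pl: "n \<epsilon> omega \<Longrightarrow> succ a \<oplus> n = succ (a \<oplus> n)"
  by (rule omega_induct[where P="\<lambda>n. succ a \<oplus> n = succ (a \<oplus> n)"]; (intro dfn_intros)?; simp)

lemma dbl_zero [simp]: "dbl zero = zero"
  by (simp add: dbl_def)

lemma dbl_succ [simp]: "n \<epsilon> omega \<Longrightarrow> dbl (succ n) = succ (succ (dbl n))"
  by (simp add: dbl_def succ_pl)

lemma dbl_omega [simp]: "n \<epsilon> omega \<Longrightarrow> dbl n \<epsilon> omega"
  by (rule omega_induct[where P="\<lambda>n. dbl n \<epsilon> omega"]; (intro dfn_intros)?; simp)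

lemma dbl_neq_succ_dbl: "n \<epsilon> omega \<Longrightarrow> m \<epsilon> omega \<Longrightarrow> dbl n \<noteq> succ (dbl m)"
proof -
  assume n: "n \<epsilon> omega" and m: "m \<epsilon> omega"
  have "\<forall>m. m \<epsilon> omega \<longrightarrow> dbl n \<noteq> succ (dbl m)"
    using n
  proof (rule omega_induct[where P="\<lambda>n. \<forall>m. m \<epsilon> omega \<longrightarrow> dbl n \<noteq> succ (dbl m)"])
    show "dfn False (\<lambda>e. \<forall>m. m \<epsilon> omega \<longrightarrow> dbl (e 0) \<noteq> succ (dbl m))" by (intro dfn_intros)
    fix k assume k: "k \<epsilon> omega" "\<forall>m. m \<epsilon> omega \<longrightarrow> dbl k \<noteq> succ (dbl m)"
    show "\<forall>m. m \<epsilon> omega \<longrightarrow> dbl (succ k) \<noteq> succ (dbl m)"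
    proof (intro allI impI)
      fix m assume "m \<epsilon> omega"
      from omega_cases[OF this] k show "dbl (succ k) \<noteq> succ (dbl m)" by (elim disjE exE conjE) simp_all
    qed
  qed simp
  then show ?thesis using m by blast
qed

lemma dbl_inj: "n \<epsilon> omega \<Longrightarrow> m \<epsilon> omega \<Longrightarrow> dbl n = dbl m \<longleftrightarrow> n = m"
proof -
  assume n: "n \<epsilon> omega" and m: "m \<epsilon> omega"
  have "\<forall>m. m \<epsilon> omega \<longrightarrow> dbl n = dbl m \<longrightarrow> n = m"
    using n
  proof (rule omega_induct[where P="\<lambda>n. \<forall>m. m \<epsilon> omega \<longrightarrow> dbl n = dbl m \<longrightarrow> n = m"])
    show "dfn False (\<lambda>e. \<forall>m. m \<epsilon> omega \<longrightarrow> dbl (e 0) = dbl m \<longrightarrow> e 0 = m)"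
      by (intro dfn_intros)
    show "\<forall>m. m \<epsilon> omega \<longrightarrow> dbl zero = dbl m \<longrightarrow> zero = m"
    proof (intro allI impI)
      fix m assume "m \<epsilon> omega" "dbl zero = dbl m"
      from omega_cases[OF this(1)] this(2) show "zero = m" by (elim disjE exE conjE) simp_all
    qed
    fix k assume k: "k \<epsilon> omega" "\<forall>m. m \<epsilon> omega \<longrightarrow> dbl k = dbl m \<longrightarrow> k = m"
    show "\<forall>m. m \<epsilon> omega \<longrightarrow> dbl (succ k) = dbl m \<longrightarrow> succ k = m"
    proof (intro allI impI)
      fix m assume "m \<epsilon> omega" "dbl (succ k) = dbl m"
      then obtain j where "j \<epsilon> omega" "m = succ j" using omega_cases[of m] k(1) by auto
      then show "succ k = m" using \<open>dbl (succ k) = dbl m\<close> k(1) k(2)[rule_format, of j] by simp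
    qed
  qed
  then show ?thesis using m by blast
qed

lemma parity: "n \<epsilon> omega \<Longrightarrow> \<exists>k. k \<epsilon> omega \<and> (n = dbl k \<or> n = succ (dbl k))"
proof (rule omega_induct[where P="\<lambda>n. \<exists>k. k \<epsilon> omega \<and> (n = dbl k \<or> n = succ (dbl k))"])
  show "dfn False (\<lambda>e. \<exists>k. k \<epsilon> omega \<and> (e 0 = dbl k \<or> e 0 = succ (dbl k)))" by (intro dfn_intros)
  show "\<exists>k. k \<epsilon> omega \<and> (zero = dbl k \<or> zero = succ (dbl k))" by (rule exI[of _ zero]) simp
  fix n assume "\<exists>k. k \<epsilon> omega \<and> (n = dbl k \<or> n = succ (dbl k))"
  then show "\<exists>k. k \<epsilon> omega \<and> (succ n = dbl k \<or> succ n = succ (dbl k))"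
    by (metis dbl_succ succ_omega)
qed

lemma first_turn_iff:
  assumes "LZ l" "n \<epsilon> omega" shows "first_turn (l \<oplus> n) \<longleftrightarrow> (\<exists>k. k \<epsilon> omega \<and> n = dbl k)"
proof -
  have "oadd k (oadd m m) = k \<oplus> dbl m" if "m \<epsilon> omega" for k m
    using that by (simp add: oadd_pl omega_Ord dbl_def[symmetric])
  then have "first_turn (l \<oplus> n) \<longleftrightarrow> (\<exists>k m. LZ k \<and> m \<epsilon> omega \<and> l \<oplus> n = k \<oplus> dbl m)"
    unfolding first_turn_def LZ_def by metis
  then show ?thesis using assms Ord_decomp_unique dbl_omega by blast
qed

lemma second_turn_iff:
  assumes "LZ l" "n \<epsilon> omega" shows "second_turn (l \<oplus> n) \<longleftrightarrow> (\<exists>k. k \<epsilon> omega \<and> n = succ (dbl k))"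
proof -
  have "oadd k (succ (oadd m m)) = k \<oplus> succ (dbl m)" if "m \<epsilon> omega" for k m
    using that by (simp add: oadd_pl omega_Ord dbl_def[symmetric])
  then have "second_turn (l \<oplus> n) \<longleftrightarrow> (\<exists>k m. LZ k \<and> m \<epsilon> omega \<and> l \<oplus> n = k \<oplus> succ (dbl m))"
    unfolding second_turn_def LZ_def by metis
  then show ?thesis using assms Ord_decomp_unique dbl_omega succ_omega by metis
qed

lemma turn_cases: "Ord a \<Longrightarrow> first_turn a \<longleftrightarrow> \<not> second_turn a"
proof -
  assume "Ord a"
  then obtain l n where "LZ l" "n \<epsilon> omega" "a = l \<oplus> n" using Ord_decomp by blast
  then show ?thesis using first_turn_iff second_turn_iff parity dbl_neq_succ_dbl by metis
qed

subsection \<open>The cumulative hierarchy\<close>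

definition V :: "'v \<Rightarrow> 'v" where
  "V = trec (\<lambda>x g. coll (\<lambda>z. \<exists>y. y \<epsilon> x \<and> subset z (ap g y)))"

lemma dft_V [dfn_intros]: "dft b s \<Longrightarrow> dft b (\<lambda>e. V (s e))"
  by (rule dft_sub1[where F=V], unfold V_def) (intro dfn_intros)

lemma V_aux_ex:
  assumes F: "dft False (\<lambda>e. F (e 0))" shows "\<exists>w. \<forall>z. z \<epsilon> w \<longleftrightarrow> (\<exists>y. y \<epsilon> x \<and> subset z (F y))"
proof -
  have "\<exists>w. \<forall>z. z \<epsilon> w \<longleftrightarrow> z \<epsilon> Pws (Uni (img x F)) \<and> (\<exists>y. y \<epsilon> x \<and> subset z (F y))"
    by (rule sep_ex) (intro dfn_intros dft_sub1[OF F])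
  moreover have "z \<epsilon> Pws (Uni (img x F))" if "\<exists>y. y \<epsilon> x \<and> subset z (F y)" for z
    using that unfolding mem_Pws by (auto simp: subset_def mem_img[OF F])
  ultimately show ?thesis by blast
qed

lemma Vset_eq: "Ord x \<Longrightarrow> Vset x = V x"
  unfolding Vset_def V_def
proof (rule ord_rec_eq_trec)
  show "dft False (\<lambda>e. coll (\<lambda>z. \<exists>y. y \<epsilon> e 0 \<and> subset z (ap (e (Suc 0)) y)))"
    by (intro dfn_intros)
  fix F x g assume F: "\<And>y. y \<epsilon> x \<Longrightarrow> F y = ap g y"
  have "(\<lambda>z. \<exists>y. y \<epsilon> x \<and> subset z (F y)) = (\<lambda>z. \<exists>y. y \<epsilon> x \<and> subset z (ap g y))"
    by (rule ext) (metis F)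
  then show "set_of (\<lambda>z. \<exists>y. y \<epsilon> x \<and> subset z (F y)) =
      coll (\<lambda>z. \<exists>y. y \<epsilon> x \<and> subset z (ap g y))"
    by (simp only:) (intro set_of_eq_coll V_aux_ex dfn_intros)
qed

lemma mem_V: "Ord x \<Longrightarrow> z \<epsilon> V x \<longleftrightarrow> (\<exists>y. y \<epsilon> x \<and> subset z (V y))"
proof -
  assume x: "Ord x"
  let ?G = "\<lambda>x g. coll (\<lambda>z. \<exists>y. y \<epsilon> x \<and> subset z (ap g y))"
  have G: "dft False (\<lambda>e. ?G (e 0) (e (Suc 0)))" by (intro dfn_intros)
  have d: "dft False (\<lambda>e. V (e 0))" by (intro dfn_intros)
  have eq: "trec ?G = V" by (simp only: V_def)
  have "V x = coll (\<lambda>z. \<exists>y. y \<epsilon> x \<and> subset z (ap (Lam x V) y))"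
    using trec_unfold[OF G x] unfolding eq .
  moreover have "(\<lambda>z. \<exists>y. y \<epsilon> x \<and> subset z (ap (Lam x V) y)) =
    (\<lambda>z. \<exists>y. y \<epsilon> x \<and> subset z (V y))" by (rule ext) (metis ap_Lam[OF d])
  ultimately show ?thesis using mem_coll[OF V_aux_ex[OF d]] by simp
qed

lemma V_mono: "Ord a \<Longrightarrow> Ord b \<Longrightarrow> subset a b \<Longrightarrow> z \<epsilon> V a \<Longrightarrow> z \<epsilon> V b"
  by (auto simp: mem_V subset_def)

lemma V_mono_in: "Ord b \<Longrightarrow> a \<epsilon> b \<Longrightarrow> z \<epsilon> V a \<Longrightarrow> z \<epsilon> V b"
  using V_mono[of a b] Ord_in Ord_subset_iff by blast

lemma V_trans: "Ord a \<Longrightarrow> z \<epsilon> V a \<Longrightarrow> w \<epsilon> z \<Longrightarrow> w \<epsilon> V a"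
  using V_mono_in[of a _ w] mem_V[of a z] unfolding subset_def by blast

lemma Ord_in_V: "Ord a \<Longrightarrow> a \<epsilon> V (succ a)"
proof (rule Ord_induct[where P="\<lambda>a. a \<epsilon> V (succ a)"])
  show "dfn False (\<lambda>e. e 0 \<epsilon> V (succ (e 0)))" by (intro dfn_intros)
  fix a assume a: "Ord a" and IH: "\<And>y. y \<epsilon> a \<Longrightarrow> y \<epsilon> V (succ y)"
  have "y \<epsilon> V a" if y: "y \<epsilon> a" for y
  proof (rule V_mono[OF _ a _ IH[OF y]])
    show "Ord (succ y)" using a y Ord_in by simp
    show "subset (succ y) a" using y Ord_trans[OF a] by (auto simp: subset_def)
  qed
  then have "subset a (V a)" by (simp add: subset_def)
  then show "a \<epsilon> V (succ a)" using a by (auto simp: mem_V)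
qed

text \<open>Replacement bounds the least stages at which the elements of \<open>w\<close>
  appear.\<close>

lemma V_step: assumes "\<And>y. y \<epsilon> w \<Longrightarrow> \<exists>a. Ord a \<and> y \<epsilon> V a" shows "\<exists>a. Ord a \<and> w \<epsilon> V a"
proof -
  define rk where "rk y = ord_least (\<lambda>a. y \<epsilon> V a)" for y
  have rk: "Ord (rk y) \<and> y \<epsilon> V (rk y)" if y: "y \<epsilon> w" for y
  proof -
    obtain a where a: "Ord a" "y \<epsilon> V a" using assms[OF y] by blast
    have "dfn False (\<lambda>e. y \<epsilon> V (e 0))" by (intro dfn_intros)
    from ord_least[where P="\<lambda>a. y \<epsilon> V a", OF a(1) this a(2)] show ?thesis unfolding rk_def .
  qed
  have d: "dft False (\<lambda>e. succ (rk (e 0)))" unfolding rk_def by (intro dfn_intros)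
  define \<beta> where "\<beta> = Uni (img w (\<lambda>y. succ (rk y)))"
  have \<beta>: "Ord \<beta>" unfolding \<beta>_def
    by (rule Ord_Uni) (use rk in \<open>auto simp: mem_img[OF d]\<close>)
  have "y \<epsilon> V \<beta>" if y: "y \<epsilon> w" for y
  proof -
    have "succ (rk y) \<epsilon> img w (\<lambda>y. succ (rk y))" unfolding mem_img[OF d] using y by blast
    then have "rk y \<epsilon> \<beta>" unfolding \<beta>_def mem_Uni by (intro exI[of _ "succ (rk y)"]) simp
    then show ?thesis using V_mono_in[OF \<beta>] rk[OF y] by blast
  qed
  then have "subset w (V \<beta>)" by (simp add: subset_def)
  then have "w \<epsilon> V (succ \<beta>)" using \<beta> by (auto simp: mem_V)
  then show ?thesis using \<beta> Ord_succ by blast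
qed

lemma V_universal: "\<exists>a. Ord a \<and> x \<epsilon> V a"
proof (rule ccontr)
  assume n: "\<not> ?thesis"
  \<comment> \<open>\<open>U\<close>, the union of the iterated unions, is the transitive closure of
    \<open>x\<close>. Foundation is applied to those of its elements that belong to no
    \<open>V a\<close>.\<close>
  define T where "T n = nrec x (\<lambda>_ y. Uni y) n" for n
  have F: "dft False (\<lambda>e. Uni (e (Suc 0)))" by (intro dfn_intros)
  have T0: "T zero = x" unfolding T_def by (rule nrec_zero[where F="\<lambda>_ y. Uni y", OF F])
  have TS: "T (succ k) = Uni (T k)" if "k \<epsilon> omega" for k
    unfolding T_def by (rule nrec_succ[where F="\<lambda>_ y. Uni y", OF F that])
  have dT: "dft False (\<lambda>e. T (e 0))" unfolding T_def by (intro dfn_intros)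
  define U where "U = Uni (img omega T)"
  have U: "y \<epsilon> U \<longleftrightarrow> (\<exists>k. k \<epsilon> omega \<and> y \<epsilon> T k)" for y
    unfolding U_def mem_Uni mem_img[OF dT] by blast
  have Utr: "z \<epsilon> U" if yz: "y \<epsilon> U" "z \<epsilon> y" for y z
  proof -
    obtain k where k: "k \<epsilon> omega" "y \<epsilon> T k" using yz U by blast
    then have "z \<epsilon> T (succ k)" using TS yz(2) by auto
    then show ?thesis unfolding U using k(1) succ_omega by blast
  qed
  have d: "dfn False (\<lambda>e. \<not> (\<exists>a. Ord a \<and> e 0 \<epsilon> V a))" by (intro dfn_intros)
  obtain S where S: "\<forall>w. w \<epsilon> S \<longleftrightarrow> w \<epsilon> U \<and> \<not> (\<exists>a. Ord a \<and> w \<epsilon> V a)"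
    using sep_ex[OF d] by blast
  obtain y where y: "y \<epsilon> x" "\<not> (\<exists>a. Ord a \<and> y \<epsilon> V a)" using n V_step[of x] by blast
  have "y \<epsilon> U" unfolding U using T0 y(1) by (intro exI[of _ zero]) simp
  then have "y \<epsilon> S" using S y(2) by blast
  from foundation[OF this] obtain m where m: "m \<epsilon> S" "\<not> (\<exists>w. w \<epsilon> m \<and> w \<epsilon> S)" by blast
  then have "\<exists>a. Ord a \<and> w \<epsilon> V a" if "w \<epsilon> m" for w using that S Utr by blast
  from V_step[OF this] show False using m(1) S by blast
qed

subsection \<open>The reflection principle\<close>

text \<open>
  The Tarski--Vaught condition. It is not imposed for the modified environments, because in the end
  it will hold for all environments with values in \<open>V \<beta>\<close>.
\<close>

primrec wit :: "fm \<Rightarrow> (nat \<Rightarrow> 'v) \<Rightarrow> 'v \<Rightarrow> bool" where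
  "wit (Mem i j) e \<beta> \<longleftrightarrow> True"
| "wit (Eq i j) e \<beta> \<longleftrightarrow> True"
| "wit (Neg p) e \<beta> \<longleftrightarrow> wit p e \<beta>"
| "wit (Conj p q) e \<beta> \<longleftrightarrow> wit p e \<beta> \<and> wit q e \<beta>"
| "wit (Ex i p) e \<beta> \<longleftrightarrow> wit p e \<beta> \<and>
     ((\<exists>x. sat mem UNIV (e(i := x)) p) \<longrightarrow> (\<exists>x. x \<epsilon> V \<beta> \<and> sat mem UNIV (e(i := x)) p))"

lemma wit_cong: "(\<And>i. i \<in> vars p \<Longrightarrow> e i = e' i) \<Longrightarrow> wit p e \<beta> \<longleftrightarrow> wit p e' \<beta>"
proof (induction p)
  case (Neg p)
  then show ?case by (metis vars.simps(3) wit.simps(3))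
next
  case (Conj p q)
  then show ?case by (metis UnCI vars.simps(4) wit.simps(4))
next
  case (Ex i p)
  have "sat mem UNIV (e(i := x)) p \<longleftrightarrow> sat mem UNIV (e'(i := x)) p" for x
    by (rule sat_cong) (use Ex.prems in simp)
  moreover have "wit p e \<beta> \<longleftrightarrow> wit p e' \<beta>" by (rule Ex.IH) (use Ex.prems in simp)
  ultimately show ?case by simp
qed simp_all

lemma wit_mono: "wit p e \<beta> \<Longrightarrow> Ord \<beta> \<Longrightarrow> Ord \<gamma> \<Longrightarrow> subset \<beta> \<gamma> \<Longrightarrow> wit p e \<gamma>"
  by (induction p) (auto dest: V_mono)

lemma wit_mono_all:
  "\<forall>e \<beta> \<gamma>. wit p e \<beta> \<longrightarrow> Ord \<beta> \<longrightarrow> Ord \<gamma> \<longrightarrow> subset \<beta> \<gamma> \<longrightarrow> wit p e \<gamma>"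
  using wit_mono by blast

lemma Ord_upper: "Ord a \<Longrightarrow> Ord b \<Longrightarrow> \<exists>c. Ord c \<and> subset a c \<and> subset b c"
  using Ord_linear[of a b] Ord_subset_iff by blast

lemma wit_ex: "\<exists>\<beta>. Ord \<beta> \<and> wit p e \<beta>"
proof (induction p)
  case (Conj p q)
  then obtain a b where ab: "Ord a" "wit p e a" "Ord b" "wit q e b" by blast
  then obtain c where "Ord c" "subset a c" "subset b c" using Ord_upper by blast
  then show ?case using ab wit_mono by (intro exI[of _ c]) simp
next
  case (Ex i p)
  then obtain a where a: "Ord a" "wit p e a" by blast
  obtain b where b: "Ord b" "(\<exists>x. sat mem UNIV (e(i := x)) p) \<longrightarrow> (\<exists>x. x \<epsilon> V b \<and> sat mem UNIV (e(i := x)) p)"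
    using V_universal Ord_zero by metis
  obtain c where c: "Ord c" "subset a c" "subset b c" using Ord_upper a(1) b(1) by blast
  then have "wit p e c" using a wit_mono by blast
  moreover have "x \<epsilon> V c" if "x \<epsilon> V b" for x using V_mono[OF b(1) c(1,3) that] .
  ultimately show ?case using c(1) b(2) by (intro exI[of _ c]) auto
qed (auto intro!: exI[of _ zero])

lemma dfn_wit: "dfn False (\<lambda>E. wit p (\<lambda>n. E (Suc n)) (E 0))"
proof (induction p)
  case (Ex i p)
  let ?r = "\<lambda>n. if n = i then 0 else Suc (Suc n)"
  have "dfn False (\<lambda>E. sat mem UNIV E p)"
    by (rule dfnI[where a="\<lambda>_. zero" and r="\<lambda>n. 2 * n" and \<phi>=p]) simp_all
  from dfn_ren[OF this, of ?r]
  have 1: "dfn False (\<lambda>E. sat mem UNIV (\<lambda>n. E (?r n)) p)" .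
  have e: "(\<lambda>n. E (?r n)) = (\<lambda>n. E (Suc (Suc n)))(i := E 0)" for E :: "nat \<Rightarrow> 'v" by auto
  have 2: "dfn False (\<lambda>E. sat mem UNIV ((\<lambda>n. E (Suc (Suc n)))(i := E 0)) p)"
    using 1 unfolding e .
  show ?case unfolding wit.simps by (intro dfn_intros Ex.IH 2)
qed (simp_all add: dfn_intros)

text \<open>Environments are functions of the metatheory, so the model cannot quantify over all
  environments with values in \<open>V \<alpha>\<close>. Only finitely many variables matter for a
  formula, and these are quantified one after the other.\<close>

primrec allv :: "nat \<Rightarrow> ((nat \<Rightarrow> 'v) \<Rightarrow> 'v \<Rightarrow> bool) \<Rightarrow> (nat \<Rightarrow> 'v) \<Rightarrow> 'v \<Rightarrow> 'v \<Rightarrow> bool" where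
  "allv 0 S e \<alpha> \<beta> \<longleftrightarrow> S e \<beta>"
| "allv (Suc j) S e \<alpha> \<beta> \<longleftrightarrow> (\<forall>x. x \<epsilon> V \<alpha> \<longrightarrow> allv j S (e(j := x)) \<alpha> \<beta>)"

lemma dfn_allv:
  assumes "dfn False (\<lambda>E. S (\<lambda>n. E (Suc n)) (E 0))"
  shows "dfn False (\<lambda>E. allv j S (\<lambda>n. E (Suc (Suc n))) (E 0) (E (Suc 0)))"
proof (induction j)
  case 0
  then show ?case using dfn_ren[OF assms, of Suc] by simp
next
  case (Suc j)
  let ?r = "\<lambda>n. case n of 0 \<Rightarrow> 1 | Suc 0 \<Rightarrow> 2 | Suc (Suc m) \<Rightarrow> if m = j then 0 else Suc (Suc (Suc m))"
  have e: "(\<lambda>n. E (?r (Suc (Suc n)))) = (\<lambda>n. E (Suc (Suc (Suc n))))(j := E 0)" for E :: "nat \<Rightarrow> 'v"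
    by auto
  from dfn_ren[OF Suc.IH, of ?r]
  have 1: "dfn False (\<lambda>E. allv j S ((\<lambda>n. E (Suc (Suc (Suc n))))(j := E 0)) (E (Suc 0)) (E (Suc (Suc 0))))"
    unfolding e by (simp add: numeral_2_eq_2)
  show ?case unfolding allv.simps by (intro dfn_intros 1)
qed

lemma allv_mono:
  assumes "\<forall>e \<beta> \<gamma>. S e \<beta> \<longrightarrow> Ord \<beta> \<longrightarrow> Ord \<gamma> \<longrightarrow> subset \<beta> \<gamma> \<longrightarrow> S e \<gamma>"
    and "Ord \<beta>" "Ord \<gamma>" "subset \<beta> \<gamma>"
  shows "allv j S e \<alpha> \<beta> \<Longrightarrow> allv j S e \<alpha> \<gamma>"
proof (induction j arbitrary: e)
  case 0
  then show ?case using assms by simp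
qed simp

lemma allv_D:
  "allv j S e0 \<alpha> \<beta> \<Longrightarrow> (\<And>n. n < j \<Longrightarrow> e n \<epsilon> V \<alpha>) \<Longrightarrow> S (\<lambda>n. if n < j then e n else e0 n) \<beta>"
proof (induction j arbitrary: e0)
  case (Suc j)
  then have "allv j S (e0(j := e j)) \<alpha> \<beta>" by simp
  from Suc.IH[OF this] Suc.prems(2)
  have "S (\<lambda>n. if n < j then e n else (e0(j := e j)) n) \<beta>" by simp
  moreover have "(\<lambda>n. if n < j then e n else (e0(j := e j)) n) = (\<lambda>n. if n < Suc j then e n else e0 n)"
    by (auto simp: less_Suc_eq)
  ultimately show ?case by simp
qed simp

text \<open>In the induction on the number of quantified variables, the least bound that works for a
  value \<open>x\<close> is a definable function of \<open>x\<close>, so Replacement yields a common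
  bound for all \<open>x\<close> in \<open>V \<alpha>\<close>.\<close>

lemma allv_ex:
  assumes S: "dfn False (\<lambda>E. S (\<lambda>n. E (Suc n)) (E 0))"
    and mono: "\<forall>e \<beta> \<gamma>. S e \<beta> \<longrightarrow> Ord \<beta> \<longrightarrow> Ord \<gamma> \<longrightarrow> subset \<beta> \<gamma> \<longrightarrow> S e \<gamma>"
    and ex: "\<forall>e. \<exists>\<beta>. Ord \<beta> \<and> S e \<beta>"
  shows "\<exists>\<beta>. Ord \<beta> \<and> allv j S e \<alpha> \<beta>"
proof (induction j arbitrary: e)
  case 0
  then show ?case using ex by simp
next
  case (Suc j)
  define Q where "Q x \<beta> \<longleftrightarrow> allv j S (e(j := x)) \<alpha> \<beta>" for x \<beta>
  have dQ: "dfn False (\<lambda>E. Q (E (Suc 0)) (E 0))"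
  proof -
    \<comment> \<open>In the formula for \<open>allv\<close>, variable 0 is \<alpha>, variable 1 is
      \<beta>, and variable n+2 is entry n of the environment. Only \<beta> and entry
      \<open>j\<close> remain variable; the rest of \<open>e\<close> becomes parameters.\<close>
    define r where "r n = (case n of 0 \<Rightarrow> None | Suc 0 \<Rightarrow> Some 0
      | Suc (Suc m) \<Rightarrow> if m = j then Some (Suc 0) else None)" for n :: nat
    define c where "c n = (case n of 0 \<Rightarrow> \<alpha> | Suc m \<Rightarrow> e (m - 1))" for n
    have "(\<lambda>n. case r (Suc (Suc n)) of None \<Rightarrow> c (Suc (Suc n)) | Some k \<Rightarrow> E k) = e(j := E (Suc 0))"
      for E by (auto simp: r_def c_def)
    then show ?thesis unfolding Q_def
      using dfn_params[OF dfn_allv[OF S, of j], where r=r and c=c] by (simp add: r_def c_def)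
  qed
  define B where "B x = ord_least (Q x)" for x
  have dQ2: "dfn False (\<lambda>E. Q (s E) (t E))" if "dft False s" "dft False t" for s t
    using dfn_sub2[where P="\<lambda>x y. Q y x", OF dQ that(2,1)] .
  have B: "Ord (B x) \<and> Q x (B x)" for x
  proof -
    obtain a where a: "Ord a" "Q x a" unfolding Q_def using Suc.IH by blast
    have "dfn False (\<lambda>E. Q x (E 0))" by (intro dQ2 dfn_intros)
    from ord_least[of a "Q x", OF a(1) this a(2)] show ?thesis unfolding B_def .
  qed
  have dB: "dft False (\<lambda>E. B (E 0))" unfolding B_def by (intro dfn_intros dQ2)
  define \<beta> where "\<beta> = Uni (img (V \<alpha>) B)"
  have \<beta>: "Ord \<beta>" unfolding \<beta>_def by (rule Ord_Uni) (use B in \<open>auto simp: mem_img[OF dB]\<close>)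
  have "allv j S (e(j := x)) \<alpha> \<beta>" if x: "x \<epsilon> V \<alpha>" for x
  proof (rule allv_mono[OF mono])
    show "Ord (B x)" "allv j S (e(j := x)) \<alpha> (B x)" using B[of x] by (auto simp: Q_def)
    show "subset (B x) \<beta>" using x unfolding subset_def \<beta>_def mem_Uni mem_img[OF dB] by blast
  qed (use \<beta> in auto)
  then show ?case using \<beta> by auto
qed

lemma sat_V:
  assumes "\<And>e. (\<And>n. e n \<epsilon> V l) \<Longrightarrow> wit p e l" "\<And>n. e n \<epsilon> V l"
  shows "sat mem {y. y \<epsilon> V l} e p \<longleftrightarrow> sat mem UNIV e p"
  using assms
proof (induction p arbitrary: e)
  case (Ex i p)
  have IH: "sat mem {y. y \<epsilon> V l} (e(i := x)) p \<longleftrightarrow> sat mem UNIV (e(i := x)) p" if "x \<epsilon> V l" for x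
    by (rule Ex.IH) (use Ex.prems that in auto)
  have "wit (Ex i p) e l" by (rule Ex.prems(1)) (rule Ex.prems(2))
  then show ?case using IH by auto
qed simp_all

theorem reflection:
  assumes "Ord \<alpha>"
  shows "\<exists>l. Ord l \<and> \<alpha> \<epsilon> l \<and>
    (\<forall>e. (\<forall>n. e n \<epsilon> V l) \<longrightarrow> sat mem {y. y \<epsilon> V l} e \<phi> = sat mem UNIV e \<phi>)"
proof -
  obtain k where k: "\<forall>i\<in>vars \<phi>. i < k" using finite_vars finite_nat_set_iff_bounded by blast
  define R where "R a b \<longleftrightarrow> allv k (wit \<phi>) (\<lambda>_. zero) a b" for a b
  have R3: "dfn False (\<lambda>E. allv k (wit \<phi>) (\<lambda>_. E (Suc (Suc 0))) (E 0) (E (Suc 0)))"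
    using dfn_ren[OF dfn_allv[OF dfn_wit, of k \<phi>],
        of "\<lambda>n. case n of 0 \<Rightarrow> 0 | Suc 0 \<Rightarrow> Suc 0 | Suc (Suc m) \<Rightarrow> Suc (Suc 0)"] by simp
  have dR: "dfn False (\<lambda>E. R (s E) (t E))" if "dft False s" "dft False t" for s t
    unfolding R_def
    by (rule dfn_sub3[where P="\<lambda>x y z. allv k (wit \<phi>) (\<lambda>_. z) x y", OF R3 that]) (intro dfn_intros)
  define B where "B a = ord_least (\<lambda>\<beta>. a \<epsilon> \<beta> \<and> R a \<beta>)" for a
  have B: "Ord (B a) \<and> a \<epsilon> B a \<and> R a (B a)" if a: "Ord a" for a
  proof -
    obtain b where b: "Ord b" "R a b"
      unfolding R_def using allv_ex[OF dfn_wit wit_mono_all allI[OF wit_ex]] by blast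
    obtain c where c: "Ord c" "subset b c" "subset (succ a) c"
      using Ord_upper[OF b(1), of "succ a"] a Ord_succ by blast
    have "R a c" using allv_mono[OF wit_mono_all b(1) c(1,2)] b(2) unfolding R_def .
    moreover have "a \<epsilon> c" using c(3) by (simp add: subset_def)
    ultimately have ac: "a \<epsilon> c \<and> R a c" by blast
    have "dfn False (\<lambda>E. a \<epsilon> E 0 \<and> R a (E 0))" by (intro dfn_intros dR)
    from ord_least[of c "\<lambda>x. a \<epsilon> x \<and> R a x", OF c(1) this ac] show ?thesis unfolding B_def .
  qed
  have dB: "dft False (\<lambda>E. B (s E))" if "dft False s" for s
    by (rule dft_sub1[OF _ that]) (unfold B_def, intro dfn_intros dR)
  \<comment> \<open>Each term of this sequence contains witnesses for all environments with values
    in \<open>V\<close> of the preceding term. So \<open>V l\<close>, with \<open>l\<close> the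
    supremum, contains witnesses for its own environments.\<close>
  define b where "b n = nrec \<alpha> (\<lambda>_. B) n" for n
  have F: "dft False (\<lambda>e. B (e (Suc 0)))" by (intro dB dfn_intros)
  have b0: "b zero = \<alpha>" unfolding b_def by (rule nrec_zero[where F="\<lambda>_. B", OF F])
  have bS: "b (succ n) = B (b n)" if "n \<epsilon> omega" for n
    unfolding b_def by (rule nrec_succ[where F="\<lambda>_. B", OF F that])
  have db: "dft False (\<lambda>e. b (e 0))" unfolding b_def by (intro dfn_intros dB)
  have ob: "Ord (b n)" if "n \<epsilon> omega" for n
    using that
    by (rule omega_induct[where P="\<lambda>n. Ord (b n)"])
      (intro dfn_intros db, simp_all add: b0 bS B assms)
  define l where "l = Uni (img omega b)"
  have meml: "x \<epsilon> l \<longleftrightarrow> (\<exists>n. n \<epsilon> omega \<and> x \<epsilon> b n)" for x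
    unfolding l_def mem_Uni mem_img[OF db] by blast
  have ol: "Ord l" unfolding l_def by (rule Ord_Uni) (use ob in \<open>auto simp: mem_img[OF db]\<close>)
  have bl: "b n \<epsilon> l" if "n \<epsilon> omega" for n
    unfolding meml using that bS B ob by (intro exI[of _ "succ n"]) simp
  have Vl: "\<exists>n. n \<epsilon> omega \<and> z \<epsilon> V (b n)" if z: "z \<epsilon> V l" for z
  proof -
    obtain y where y: "y \<epsilon> l" "subset z (V y)" using z mem_V[OF ol] by blast
    then obtain n where "n \<epsilon> omega" "y \<epsilon> b n" using meml by blast
    then show ?thesis using y mem_V[OF ob] by blast
  qed
  \<comment> \<open>The only place where finiteness of the set of variables is essential: an entire
    environment with values in \<open>V l\<close> need not fit into a single
    \<open>V (b m)\<close>.\<close>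
  have fin: "\<exists>m. m \<epsilon> omega \<and> (\<forall>n<j. e n \<epsilon> V (b m))" if e: "\<And>n. e n \<epsilon> V l" for e :: "nat \<Rightarrow> 'v" and j
  proof (induction j)
    case (Suc j)
    then obtain m where m: "m \<epsilon> omega" "\<forall>n<j. e n \<epsilon> V (b m)" by blast
    obtain m' where m': "m' \<epsilon> omega" "e j \<epsilon> V (b m')" using Vl[OF e[of j]] by blast
    note mono = V_mono[OF ob[OF m(1)] ob[OF m'(1)]] V_mono[OF ob[OF m'(1)] ob[OF m(1)]]
    consider "subset (b m) (b m')" | "subset (b m') (b m)"
      using Ord_linear[OF ob[OF m(1)] ob[OF m'(1)]] Ord_subset_iff ob m(1) m'(1) by blast
    then show ?case
    proof cases
      case 1
      then have "\<forall>n<j. e n \<epsilon> V (b m')" using m(2) mono(1) by simp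
      then show ?thesis using m' by (intro exI[of _ m']) (simp add: less_Suc_eq)
    next
      case 2
      then have "e j \<epsilon> V (b m)" using mono(2) m'(2) by simp
      then show ?thesis using m by (intro exI[of _ m]) (simp add: less_Suc_eq)
    qed
  qed (auto intro!: exI[of _ zero])
  have "wit \<phi> e l" if e: "\<And>n. e n \<epsilon> V l" for e
  proof -
    obtain m where m: "m \<epsilon> omega" "\<forall>n<k. e n \<epsilon> V (b m)"
      using fin[where e=e and j=k, OF e] by blast
    have "R (b m) (b (succ m))" using bS[OF m(1)] B ob[OF m(1)] by simp
    then have "wit \<phi> (\<lambda>n. if n < k then e n else zero) (b (succ m))"
      unfolding R_def using allv_D[of k "wit \<phi>" "\<lambda>_. zero" "b m" "b (succ m)" e] m(2) by simp
    moreover have "wit \<phi> (\<lambda>n. if n < k then e n else zero) (b (succ m)) = wit \<phi> e (b (succ m))"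
      by (rule wit_cong) (use k in simp)
    moreover have s: "succ m \<epsilon> omega" using m by simp
    moreover have "subset (b (succ m)) l" using bl[OF s] Ord_trans[OF ol] by (auto simp: subset_def)
    ultimately show ?thesis using wit_mono ob[OF s] ol by blast
  qed
  then have "sat mem {y. y \<epsilon> V l} e \<phi> = sat mem UNIV e \<phi>" if "\<forall>n. e n \<epsilon> V l" for e
    using sat_V[of l \<phi> e] that by blast
  moreover have "\<alpha> \<epsilon> l" using bl[of zero] b0 by simp
  ultimately show ?thesis using ol by blast
qed

theorem ordinal_definableI:
  assumes "dfn True (\<lambda>e. P (e 0))" "\<And>z. z \<epsilon> X \<longleftrightarrow> P z"
  shows "ordinal_definable X"
proof -
  obtain \<phi> a where a: "\<And>n. Ord (a n)" and \<phi>: "\<And>e. P (e 0) \<longleftrightarrow> sat mem UNIV (mix e a) \<phi>"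
    using assms(1) unfolding dfn_def by blast
  obtain k where k: "\<forall>i\<in>vars \<phi>. i < k" using finite_vars finite_nat_set_iff_bounded by blast
  \<comment> \<open>\<open>ordinal_definable\<close> demands that all parameters lie in one
    \<open>V l\<close>, which may fail for an infinite sequence \<open>a\<close>. So only the
    finitely many that \<open>\<phi>\<close> can mention are kept, at their odd positions, and the
    rest is filled with \<open>zero\<close>.\<close>
  define e where "e n = (if n < k \<and> odd n then a (n div 2) else zero)" for n
  have oe: "Ord (e n)" for n by (simp add: e_def a)
  have "\<exists>c. Ord c \<and> (\<forall>n<j. subset (succ (e n)) c)" for j
  proof (induction j)
    case (Suc j)
    then obtain c where c: "Ord c" "\<forall>n<j. subset (succ (e n)) c" by blast
    obtain d where "Ord d" "subset c d" "subset (succ (e j)) d"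
      using Ord_upper[OF c(1), of "succ (e j)"] oe by auto
    then show ?case using c by (intro exI[of _ d]) (auto simp: less_Suc_eq subset_def)
  qed (auto intro!: exI[of _ zero])
  then obtain c where c: "Ord c" "\<forall>n<k. subset (succ (e n)) c" by blast
  \<comment> \<open>Placing \<open>X\<close> in \<open>V l\<close> as well guarantees that
    restricting \<open>z\<close> to \<open>V l\<close> loses no elements.\<close>
  obtain g where g: "Ord g" "X \<epsilon> V g" using V_universal by blast
  obtain d where d: "Ord d" "subset c d" "subset g d" using Ord_upper[OF c(1) g(1)] by blast
  obtain l where l: "Ord l" "d \<epsilon> l"
    and refl: "\<And>e. (\<forall>n. e n \<epsilon> V l) \<Longrightarrow> sat mem {y. y \<epsilon> V l} e \<phi> = sat mem UNIV e \<phi>"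
    using reflection[OF d(1)] by blast
  have Vdl: "z \<epsilon> V l" if "z \<epsilon> V d" for z using V_mono_in[OF l that] .
  have "zero \<epsilon> V l" using l by (auto simp: mem_V subset_def)
  moreover have "e n \<epsilon> V l" if n: "n < k" for n
  proof -
    have "subset (succ (e n)) d" using c(2) d(2) n by (auto simp: subset_def)
    from V_mono[OF _ d(1) this Ord_in_V[OF oe]] have "e n \<epsilon> V d" using oe by simp
    then show ?thesis by (rule Vdl)
  qed
  ultimately have eV: "e n \<epsilon> V l" for n by (cases "n < k") (auto simp: e_def)
  have XV: "z \<epsilon> V l" if "z \<epsilon> X" for z
    using V_trans[OF g(1,2) that] V_mono[OF g(1) d(1,3)] Vdl by blast
  have "P z \<longleftrightarrow> sat mem UNIV (e(0 := z)) \<phi>" for z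
  proof -
    let ?e = "\<lambda>n. if n = 0 then z else zero"
    have "sat mem UNIV (mix ?e a) \<phi> = sat mem UNIV (e(0 := z)) \<phi>"
      by (rule sat_cong) (use k in \<open>auto simp: mix_def e_def elim: evenE\<close>)
    then show ?thesis using \<phi>[of ?e] by simp
  qed
  note P = this
  have "z \<epsilon> X \<longleftrightarrow> z \<epsilon> V l \<and> sat mem {y. y \<epsilon> V l} (e(0 := z)) \<phi>" for z
  proof (cases "z \<epsilon> V l")
    case True
    then have "\<forall>n. (e(0 := z)) n \<epsilon> V l" using eV by simp
    show ?thesis unfolding refl[OF \<open>\<forall>n. (e(0 := z)) n \<epsilon> V l\<close>] using True assms(2) P by simp
  qed (use XV in blast)
  then show ?thesis unfolding ordinal_definable_def
    by (intro exI[of _ l] exI[of _ \<phi>] exI[of _ e]) (simp add: Vset_eq[OF l(1)] l(1) oe eV)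
qed

subsection \<open>Reals\<close>

definition two :: 'v where "two = upair zero one"

definition R :: 'v where "R = Fsp omega two"

definition flip :: "'v \<Rightarrow> 'v" where "flip b = (if b = zero then one else zero)"

lemma mem_two: "x \<epsilon> two \<longleftrightarrow> x = zero \<or> x = one"
  by (simp add: two_def)

lemma Ord_two: "Ord two"
proof -
  have "two = succ one" by (rule extensionality) (auto simp: two_def one_def)
  then show ?thesis by simp
qed

lemma dft_two [dfn_intros]: "dft b (\<lambda>e. two)"
  by (rule dft_Ord) (rule Ord_two)

lemma dft_R [dfn_intros]: "dft b (\<lambda>e. R)"
  unfolding R_def by (intro dfn_intros)

lemma dft_flip [dfn_intros]: "dft b s \<Longrightarrow> dft b (\<lambda>e. flip (s e))"
  by (rule dft_sub1[where F=flip], unfold flip_def) (intro dfn_intros)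

lemma flip_two [simp]: "flip b \<epsilon> two"
  by (simp add: flip_def mem_two)

lemma flip_neq [simp]: "flip b \<noteq> b" "b \<noteq> flip b"
  by (auto simp: flip_def)

lemma mem_R: "x \<epsilon> R \<longleftrightarrow> fun_into x omega two"
  by (simp add: R_def)

lemma R_ap: "x \<epsilon> R \<Longrightarrow> n \<epsilon> omega \<Longrightarrow> ap x n = zero \<or> ap x n = one"
  by (simp add: mem_R fun_into_iff mem_two)

lemma R_ext: "x \<epsilon> R \<Longrightarrow> y \<epsilon> R \<Longrightarrow> (\<And>n. n \<epsilon> omega \<Longrightarrow> ap x n = ap y n) \<Longrightarrow> x = y"
  unfolding mem_R fun_into_iff using fun_ext by blast

lemma Lam_R:
  assumes "dft False (\<lambda>e. F (e 0))" "\<And>n. n \<epsilon> omega \<Longrightarrow> F n \<epsilon> two" shows "Lam omega F \<epsilon> R"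
  unfolding mem_R by (rule fun_into_Lam[OF assms])

text \<open>
  A code of the sequence of the first \<open>m\<close> values of \<open>y\<close>: its binary expansion is this sequence
  with an initial digit 1.
\<close>

definition code :: "'v \<Rightarrow> 'v \<Rightarrow> 'v" where
  "code y m = nrec one (\<lambda>k h. if ap y k = one then succ (dbl h) else dbl h) m"

lemma dft_code [dfn_intros]: "dft b s \<Longrightarrow> dft b t \<Longrightarrow> dft b (\<lambda>e. code (s e) (t e))"
  by (rule dft_sub2[where F=code], unfold code_def) (intro dfn_intros)

lemma
  shows code_zero: "code y zero = one"
    and code_succ: "m \<epsilon> omega \<Longrightarrow>
      code y (succ m) = (if ap y m = one then succ (dbl (code y m)) else dbl (code y m))"
proof -
  let ?F = "\<lambda>k h. if ap y k = one then succ (dbl h) else dbl h"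
  have F: "dft False (\<lambda>e. ?F (e 0) (e (Suc 0)))" by (intro dfn_intros)
  show "code y zero = one" unfolding code_def by (rule nrec_zero[OF F])
  show "code y (succ m) = (if ap y m = one then succ (dbl (code y m)) else dbl (code y m))"
    if "m \<epsilon> omega"
    unfolding code_def by (rule nrec_succ[OF F that])
qed

lemma dbl_eq_zero: "n \<epsilon> omega \<Longrightarrow> dbl n = zero \<longleftrightarrow> n = zero"
  using dbl_inj[of n zero] by simp

lemma code_omega: "m \<epsilon> omega \<Longrightarrow> code y m \<epsilon> omega \<and> code y m \<noteq> zero"
proof (rule omega_induct[where P="\<lambda>m. code y m \<epsilon> omega \<and> code y m \<noteq> zero"])
  show "dfn False (\<lambda>e. code y (e 0) \<epsilon> omega \<and> code y (e 0) \<noteq> zero)" by (intro dfn_intros)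
  show "code y zero \<epsilon> omega \<and> code y zero \<noteq> zero" by (simp add: code_zero) (simp add: one_def)
  show "code y (succ k) \<epsilon> omega \<and> code y (succ k) \<noteq> zero"
    if "k \<epsilon> omega" "code y k \<epsilon> omega \<and> code y k \<noteq> zero" for k
    using that by (simp add: code_succ dbl_eq_zero)
qed

lemma code_one: "y \<epsilon> R \<Longrightarrow> m \<epsilon> omega \<Longrightarrow> code y m = one \<Longrightarrow> m = zero"
proof (rule ccontr)
  assume "y \<epsilon> R" "m \<epsilon> omega" and c: "code y m = one" and "m \<noteq> zero"
  then obtain k where k: "k \<epsilon> omega" "m = succ k" using omega_cases by blast
  have "code y k \<epsilon> omega" "code y k \<noteq> zero" using code_omega k(1) by blast+
  moreover have "one = succ (dbl zero)" by (simp add: one_def)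
  ultimately show False
    using c dbl_neq_succ_dbl[of "code y k" zero] dbl_eq_zero[of "code y k"]
    unfolding k(2) code_succ[OF k(1)] by (simp split: if_splits)
qed

lemma code_inj:
  assumes "y \<epsilon> R" "z \<epsilon> R" "m \<epsilon> omega" "n \<epsilon> omega" "code y m = code z n"
  shows "m = n \<and> (\<forall>i. i \<epsilon> m \<longrightarrow> ap y i = ap z i)"
proof -
  have "\<forall>n. n \<epsilon> omega \<longrightarrow> code y m = code z n \<longrightarrow> m = n \<and> (\<forall>i. i \<epsilon> m \<longrightarrow> ap y i = ap z i)"
    using assms(3)
  proof (rule omega_induct[where P="\<lambda>m. \<forall>n. n \<epsilon> omega \<longrightarrow> code y m = code z n \<longrightarrow>
      m = n \<and> (\<forall>i. i \<epsilon> m \<longrightarrow> ap y i = ap z i)"])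
    show "dfn False (\<lambda>e. \<forall>n. n \<epsilon> omega \<longrightarrow> code y (e 0) = code z n \<longrightarrow>
      e 0 = n \<and> (\<forall>i. i \<epsilon> e 0 \<longrightarrow> ap y i = ap z i))" by (intro dfn_intros)
    show "\<forall>n. n \<epsilon> omega \<longrightarrow> code y zero = code z n \<longrightarrow>
      zero = n \<and> (\<forall>i. i \<epsilon> zero \<longrightarrow> ap y i = ap z i)"
    proof (intro allI impI)
      fix n assume "n \<epsilon> omega" "code y zero = code z n"
      then have "n = zero" using code_one[OF assms(2), of n] by (simp add: code_zero)
      then show "zero = n \<and> (\<forall>i. i \<epsilon> zero \<longrightarrow> ap y i = ap z i)" by simp
    qed
    fix k assume k: "k \<epsilon> omega"
      and IH: "\<forall>n. n \<epsilon> omega \<longrightarrow> code y k = code z n \<longrightarrow> k = n \<and> (\<forall>i. i \<epsilon> k \<longrightarrow> ap y i = ap z i)"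
    show "\<forall>n. n \<epsilon> omega \<longrightarrow> code y (succ k) = code z n \<longrightarrow>
      succ k = n \<and> (\<forall>i. i \<epsilon> succ k \<longrightarrow> ap y i = ap z i)"
    proof (intro allI impI)
      fix n assume n: "n \<epsilon> omega" and eq: "code y (succ k) = code z n"
      have "n \<noteq> zero"
      proof
        assume "n = zero"
        then have "succ k = zero"
          using code_one[OF assms(1), of "succ k"] k eq by (simp add: code_zero)
        then show False by simp
      qed
      then obtain j where j: "j \<epsilon> omega" "n = succ j" using omega_cases n by blast
      have o: "code y k \<epsilon> omega" "code z j \<epsilon> omega" using code_omega k j by blast+
      have "code y k = code z j \<and> ap y k = ap z j"
        using eq R_ap[OF assms(1) k] R_ap[OF assms(2) j(1)]
          dbl_neq_succ_dbl[OF o] dbl_neq_succ_dbl[OF o(2,1)] dbl_inj[OF o]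
        unfolding j(2) code_succ[OF k] code_succ[OF j(1)] by (auto split: if_splits)
      then show "succ k = n \<and> (\<forall>i. i \<epsilon> succ k \<longrightarrow> ap y i = ap z i)"
        using IH[rule_format, OF j(1)] j(2) by auto
    qed
  qed
  then show ?thesis using assms(4,5) by blast
qed

subsection \<open>Countability\<close>

lemma countable_iff: "at_most_countable x \<longleftrightarrow> (\<exists>f. fun_into f x omega \<and>
    (\<forall>u v. u \<epsilon> x \<longrightarrow> v \<epsilon> x \<longrightarrow> ap f u = ap f v \<longrightarrow> u = v))"
proof -
  have "app f u = ap f u" if "fun_into f x omega" "u \<epsilon> x" for f u
    using that app_ap unfolding fun_into_def by blast
  then show ?thesis unfolding at_most_countable_def
    by (intro ex_cong1 conj_cong refl all_cong1 imp_cong) simp_all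
qed

lemma dfn_countable [dfn_intros]: "dft b s \<Longrightarrow> dfn b (\<lambda>e. at_most_countable (s e))"
  by (rule dfn_sub1[where P=at_most_countable], unfold countable_iff) (intro dfn_intros)

lemma countableI:
  assumes "dft False (\<lambda>e. F (e 0))" "\<And>u. u \<epsilon> x \<Longrightarrow> F u \<epsilon> omega"
    "\<And>u v. u \<epsilon> x \<Longrightarrow> v \<epsilon> x \<Longrightarrow> F u = F v \<Longrightarrow> u = v"
  shows "at_most_countable x"
  unfolding countable_iff
  by (rule exI[of _ "Lam x F"]) (use assms in \<open>simp add: fun_into_Lam ap_Lam\<close>)

lemma countable_subset: "at_most_countable y \<Longrightarrow> subset x y \<Longrightarrow> at_most_countable x"
proof -
  assume "at_most_countable y" and s: "subset x y"
  then obtain f where f: "fun_into f y omega"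
    "\<And>u v. u \<epsilon> y \<Longrightarrow> v \<epsilon> y \<Longrightarrow> ap f u = ap f v \<Longrightarrow> u = v" unfolding countable_iff by blast
  have d: "dft False (\<lambda>e. ap f (e 0))" by (intro dfn_intros)
  show ?thesis
    by (rule countableI[OF d]) (use f s in \<open>auto simp: fun_into_iff subset_def\<close>)
qed

lemma countable_omega: "at_most_countable omega"
  by (rule countableI[of "\<lambda>x. x"]) (auto intro: dft_var)

lemma countable_succ: "at_most_countable x \<Longrightarrow> at_most_countable (succ x)"
proof -
  assume "at_most_countable x"
  then obtain f where f: "fun_into f x omega"
    "\<And>u v. u \<epsilon> x \<Longrightarrow> v \<epsilon> x \<Longrightarrow> ap f u = ap f v \<Longrightarrow> u = v" unfolding countable_iff by blast
  have d: "dft False (\<lambda>e. if e 0 = x then zero else succ (ap f (e 0)))" by (intro dfn_intros)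
  show ?thesis
    by (rule countableI[OF d]) (use f in \<open>auto simp: fun_into_iff split: if_splits\<close>)
qed

text \<open>Cantor's argument. If \<open>c\<close> numbers \<open>D\<close>, then bit
  \<open>n\<close> of \<open>y\<close> is opposite to that of \<open>Y n\<close>, the real that
  \<open>\<Phi>\<close> maps to the element \<open>W d\<close> with \<open>d\<close> of number
  \<open>n\<close>. Injectivity of \<open>\<Phi>\<close> makes this real unique; if there is none,
  \<open>Y n\<close> is \<open>zero\<close> and the bit is harmless.\<close>

lemma diagonal:
  assumes "at_most_countable D"
    and \<Phi>: "dft False (\<lambda>e. \<Phi> (e 0))" and W: "dft False (\<lambda>e. W (e 0))"
    and inj: "\<And>y z. y \<epsilon> R \<Longrightarrow> z \<epsilon> R \<Longrightarrow> \<Phi> y = \<Phi> z \<Longrightarrow> y = z"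
  shows "\<exists>y. y \<epsilon> R \<and> (\<forall>d. d \<epsilon> D \<longrightarrow> \<Phi> y \<noteq> W d)"
proof -
  obtain c where c: "fun_into c D omega"
    "\<And>u v. u \<epsilon> D \<Longrightarrow> v \<epsilon> D \<Longrightarrow> ap c u = ap c v \<Longrightarrow> u = v"
    using assms(1) unfolding countable_iff by blast
  define Y where "Y n = the0 (\<lambda>y. y \<epsilon> R \<and> (\<exists>d. d \<epsilon> D \<and> ap c d = n \<and> \<Phi> y = W d))" for n
  have d: "dft False (\<lambda>e. flip (ap (Y (e 0)) (e 0)))" unfolding Y_def
    by (intro dfn_intros dft_sub1[where F=\<Phi>, OF \<Phi>] dft_sub1[where F=W, OF W])
  define y where "y = Lam omega (\<lambda>n. flip (ap (Y n) n))"
  have yR: "y \<epsilon> R" unfolding y_def by (rule Lam_R[OF d]) simp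
  have "\<Phi> y \<noteq> W u" if u: "u \<epsilon> D" for u
  proof
    assume eq: "\<Phi> y = W u"
    have n: "ap c u \<epsilon> omega" using c(1) u by (simp add: fun_into_iff)
    have "Y (ap c u) = y" unfolding Y_def
    proof (rule the0_eq)
      show "y \<epsilon> R \<and> (\<exists>d. d \<epsilon> D \<and> ap c d = ap c u \<and> \<Phi> y = W d)" using yR u eq by blast
      fix z assume "z \<epsilon> R \<and> (\<exists>d. d \<epsilon> D \<and> ap c d = ap c u \<and> \<Phi> z = W d)"
      then have "z \<epsilon> R" "\<Phi> z = \<Phi> y" using c(2) u eq by metis+
      then show "z = y" using inj yR by blast
    qed
    then have "ap y (ap c u) = flip (ap y (ap c u))"
      using ap_Lam[OF d n] unfolding y_def by simp
    then show False by simp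
  qed
  then show ?thesis using yR by blast
qed

text \<open>Transfinite choice without repetition: \<open>P \<alpha>\<close> is taken from
  \<open>B \<alpha>\<close> after removing the earlier values, as long as anything is left.
  \<open>Z\<close> is there because \<open>choice_ex\<close> provides choices only for subsets of
  one fixed set.\<close>

lemma representatives:
  assumes B: "dft False (\<lambda>e. B (e 0))"
  shows "\<exists>P. dft False (\<lambda>e. P (e 0)) \<and> (\<forall>\<alpha>. Ord \<alpha> \<longrightarrow> subset (B \<alpha>) Z \<longrightarrow>
    (\<exists>w. w \<epsilon> B \<alpha> \<and> (\<forall>\<beta>. \<beta> \<epsilon> \<alpha> \<longrightarrow> w \<noteq> P \<beta>)) \<longrightarrow>
    P \<alpha> \<epsilon> B \<alpha> \<and> (\<forall>\<beta>. \<beta> \<epsilon> \<alpha> \<longrightarrow> P \<alpha> \<noteq> P \<beta>))"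
proof -
  obtain C where C: "\<forall>A. subset A Z \<longrightarrow> (\<exists>w. w \<epsilon> A) \<longrightarrow> (\<exists>!w. w \<epsilon> A \<and> opair A w \<epsilon> C)"
    using choice_ex by blast
  define A where "A \<alpha> g = coll (\<lambda>w. w \<epsilon> B \<alpha> \<and> (\<forall>\<beta>. \<beta> \<epsilon> \<alpha> \<longrightarrow> w \<noteq> ap g \<beta>))" for \<alpha> g
  define G where "G \<alpha> g = the0 (\<lambda>w. w \<epsilon> A \<alpha> g \<and> opair (A \<alpha> g) w \<epsilon> C)" for \<alpha> g
  have dA: "dft False (\<lambda>e. A (s e) (t e))" if "dft False s" "dft False t" for s t
    by (rule dft_sub2[where F=A, OF _ that], unfold A_def)
      (intro dfn_intros dft_sub1[where F=B, OF B])
  have G: "dft False (\<lambda>e. G (e 0) (e (Suc 0)))" unfolding G_def by (intro dfn_intros dA)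
  define P where "P = trec G"
  have dP: "dft False (\<lambda>e. P (e 0))" unfolding P_def by (rule dft_trec1[OF G])
  have "P \<alpha> \<epsilon> B \<alpha> \<and> (\<forall>\<beta>. \<beta> \<epsilon> \<alpha> \<longrightarrow> P \<alpha> \<noteq> P \<beta>)"
    if \<alpha>: "Ord \<alpha>" "subset (B \<alpha>) Z" "\<exists>w. w \<epsilon> B \<alpha> \<and> (\<forall>\<beta>. \<beta> \<epsilon> \<alpha> \<longrightarrow> w \<noteq> P \<beta>)" for \<alpha>
  proof -
    let ?A = "A \<alpha> (Lam \<alpha> P)"
    have d: "dfn False (\<lambda>e. e 0 \<epsilon> B \<alpha> \<and> (\<forall>\<beta>. \<beta> \<epsilon> \<alpha> \<longrightarrow> e 0 \<noteq> ap (Lam \<alpha> P) \<beta>))"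
      by (intro dfn_intros)
    have A: "w \<epsilon> ?A \<longleftrightarrow> w \<epsilon> B \<alpha> \<and> (\<forall>\<beta>. \<beta> \<epsilon> \<alpha> \<longrightarrow> w \<noteq> P \<beta>)" for w
      unfolding A_def using mem_coll_sep[OF d, of "B \<alpha>"] ap_Lam[OF dP] by auto
    have "subset ?A Z" "\<exists>w. w \<epsilon> ?A" using \<alpha>(2,3) unfolding subset_def A by blast+
    then have "\<exists>!w. w \<epsilon> ?A \<and> opair ?A w \<epsilon> C" using C by blast
    from the0I[OF this] have "G \<alpha> (Lam \<alpha> P) \<epsilon> ?A" unfolding G_def by blast
    then have "P \<alpha> \<epsilon> ?A" using trec_unfold[OF G \<alpha>(1)] unfolding P_def by simp
    then show ?thesis unfolding A .
  qed
  then show ?thesis using dP by blast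
qed

text \<open>By diagonalization countably many earlier values never exhaust \<open>R\<close>, so the
  choice goes on at all countable stages.\<close>

lemma distinct_reals:
  "\<exists>P. dft False (\<lambda>e. P (e 0)) \<and> (\<forall>a. Ord a \<longrightarrow> at_most_countable a \<longrightarrow>
    P a \<epsilon> R \<and> (\<forall>b. b \<epsilon> a \<longrightarrow> P a \<noteq> P b))"
proof -
  have dR: "dft False (\<lambda>e. R)" by (intro dfn_intros)
  obtain P where P: "dft False (\<lambda>e. P (e 0))" and
    rep: "\<forall>\<alpha>. Ord \<alpha> \<longrightarrow> subset R R \<longrightarrow> (\<exists>w. w \<epsilon> R \<and> (\<forall>\<beta>. \<beta> \<epsilon> \<alpha> \<longrightarrow> w \<noteq> P \<beta>)) \<longrightarrow>
      P \<alpha> \<epsilon> R \<and> (\<forall>\<beta>. \<beta> \<epsilon> \<alpha> \<longrightarrow> P \<alpha> \<noteq> P \<beta>)"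
    using representatives[where B="\<lambda>_. R" and Z=R, OF dR] by blast
  have "P a \<epsilon> R \<and> (\<forall>b. b \<epsilon> a \<longrightarrow> P a \<noteq> P b)" if "Ord a" "at_most_countable a" for a
    using rep that(1) diagonal[of a "\<lambda>x. x" P, OF that(2) dft_var P] by (simp add: subset_def)
  then show ?thesis using P by blast
qed

text \<open>A replacement for Hartogs' construction: if all ordinals were countable,
  \<open>P\<close> would map them injectively into the set \<open>R\<close>, and applying the
  inverse \<open>Q\<close> to \<open>R\<close> would collect all ordinals in a set.\<close>

lemma uncountable_Ord_ex: "\<exists>a. Ord a \<and> \<not> at_most_countable a"
proof (rule ccontr)
  assume "\<not> ?thesis"
  then have cnt: "\<And>a. Ord a \<Longrightarrow> at_most_countable a" by blast
  obtain P where P: "dft False (\<lambda>e. P (e 0))" and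
    "\<forall>a. Ord a \<longrightarrow> at_most_countable a \<longrightarrow> P a \<epsilon> R \<and> (\<forall>b. b \<epsilon> a \<longrightarrow> P a \<noteq> P b)"
    using distinct_reals by blast
  then have PR: "P a \<epsilon> R \<and> (\<forall>b. b \<epsilon> a \<longrightarrow> P a \<noteq> P b)" if "Ord a" for a
    using cnt that by blast
  have inj: "a = b" if "Ord a" "Ord b" "P a = P b" for a b
    using that PR Ord_linear by metis
  define Q where "Q y = the0 (\<lambda>a. Ord a \<and> P a = y)" for y
  have dQ: "dft False (\<lambda>e. Q (e 0))" unfolding Q_def
    by (intro dfn_intros dft_sub1[where F=P, OF P])
  have QP: "Q (P a) = a" if "Ord a" for a
    unfolding Q_def by (rule the0_eq) (use that inj in auto)
  have "dfn False (\<lambda>e. Ord (e 0))" by (intro dfn_intros)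
  from sep_ex[of Ord, OF this, of "img R Q"]
  obtain S where S: "\<forall>z. z \<epsilon> S \<longleftrightarrow> z \<epsilon> img R Q \<and> Ord z" by blast
  have mS: "z \<epsilon> S \<longleftrightarrow> Ord z" for z
  proof
    assume z: "Ord z"
    then have "z \<epsilon> img R Q" unfolding mem_img[OF dQ] using PR QP by (intro exI[of _ "P z"]) simp
    then show "z \<epsilon> S" using S z by blast
  qed (use S in blast)
  have "Ord S"
  proof (rule OrdI)
    show "Ord x" if "x \<epsilon> S" for x using that mS by simp
    show "y \<epsilon> S" if "x \<epsilon> S" "y \<epsilon> x" for x y using that mS Ord_in[of x y] by simp
  qed
  then show False using mS mem_irrefl by blast
qed

lemma Ord_omega1 [simp]: "Ord omega1"
  and uncountable_omega1: "\<not> at_most_countable omega1"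
  and countable_in_omega1: "a \<epsilon> omega1 \<Longrightarrow> at_most_countable a"
proof -
  obtain a where a: "Ord a" "\<not> at_most_countable a" using uncountable_Ord_ex by blast
  have "dfn False (\<lambda>e. \<not> at_most_countable (e 0))" by (intro dfn_intros)
  from Ord_least[of a "\<lambda>a. \<not> at_most_countable a", OF a(1) this a(2)]
  obtain m where m: "Ord m" "\<not> at_most_countable m" "\<forall>b. b \<epsilon> m \<longrightarrow> at_most_countable b" by blast
  have "omega1 = m" unfolding omega1_def
    by (rule the_equality) (use m Ord_linear in blast)+
  then show "Ord omega1" "\<not> at_most_countable omega1" "a \<epsilon> omega1 \<Longrightarrow> at_most_countable a" for a
    using m by blast+
qed

lemma countable_Ord_omega1: "Ord a \<Longrightarrow> at_most_countable a \<Longrightarrow> a \<epsilon> omega1"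
  using Ord_linear[of a omega1] uncountable_omega1 countable_subset[of a omega1]
    Ord_subset_iff[of omega1 a] by simp blast

lemma Limit_omega1: "Limit omega1"
proof -
  have "at_most_countable zero" using countable_subset[OF countable_omega] by (simp add: subset_def)
  then have "zero \<epsilon> omega1" by (intro countable_Ord_omega1) simp_all
  moreover have "succ a \<epsilon> omega1" if "a \<epsilon> omega1" for a
    using that countable_in_omega1 countable_succ countable_Ord_omega1 Ord_in[of omega1 a] by simp
  ultimately show ?thesis by (simp add: Limit_def)
qed

lemma dft_omega1 [dfn_intros]: "dft b (\<lambda>e. omega1)"
  by (rule dft_Ord) simp

text \<open>The number \<open>2\<^sup>m (2 n + 1)\<close>.\<close>

definition pcode :: "'v \<Rightarrow> 'v \<Rightarrow> 'v" where
  "pcode m n = nrec (succ (dbl n)) (\<lambda>_ h. dbl h) m"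

lemma dft_pcode [dfn_intros]: "dft b s \<Longrightarrow> dft b t \<Longrightarrow> dft b (\<lambda>e. pcode (s e) (t e))"
  by (rule dft_sub2[where F=pcode], unfold pcode_def) (intro dfn_intros)

lemma
  shows pcode_zero: "pcode zero n = succ (dbl n)"
    and pcode_succ: "m \<epsilon> omega \<Longrightarrow> pcode (succ m) n = dbl (pcode m n)"
proof -
  have F: "dft False (\<lambda>e. dbl (e (Suc 0)))" by (intro dfn_intros)
  show "pcode zero n = succ (dbl n)" unfolding pcode_def by (rule nrec_zero[where F="\<lambda>_. dbl", OF F])
  show "pcode (succ m) n = dbl (pcode m n)" if "m \<epsilon> omega"
    unfolding pcode_def by (rule nrec_succ[where F="\<lambda>_. dbl", OF F that])
qed

lemma pcode_omega: "m \<epsilon> omega \<Longrightarrow> n \<epsilon> omega \<Longrightarrow> pcode m n \<epsilon> omega"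
  by (rule omega_induct[where P="\<lambda>m. pcode m n \<epsilon> omega"]; (intro dfn_intros)?;
    simp add: pcode_zero pcode_succ)

lemma pcode_inj:
  assumes "m \<epsilon> omega" "n \<epsilon> omega" "m' \<epsilon> omega" "n' \<epsilon> omega" "pcode m n = pcode m' n'"
  shows "m = m' \<and> n = n'"
proof -
  have "\<forall>m'. m' \<epsilon> omega \<longrightarrow> pcode m n = pcode m' n' \<longrightarrow> m = m' \<and> n = n'"
    using assms(1)
  proof (rule omega_induct[where P="\<lambda>m. \<forall>m'. m' \<epsilon> omega \<longrightarrow> pcode m n = pcode m' n' \<longrightarrow> m = m' \<and> n = n'"])
    show "dfn False (\<lambda>e. \<forall>m'. m' \<epsilon> omega \<longrightarrow> pcode (e 0) n = pcode m' n' \<longrightarrow> e 0 = m' \<and> n = n')"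
      by (intro dfn_intros)
    show "\<forall>m'. m' \<epsilon> omega \<longrightarrow> pcode zero n = pcode m' n' \<longrightarrow> zero = m' \<and> n = n'"
    proof (intro allI impI)
      fix m' assume m': "m' \<epsilon> omega" and eq: "pcode zero n = pcode m' n'"
      have "m' = zero"
      proof (rule ccontr)
        assume "m' \<noteq> zero"
        then obtain j where j: "j \<epsilon> omega" "m' = succ j" using omega_cases m' by blast
        then show False
          using eq dbl_neq_succ_dbl[OF pcode_omega[OF j(1) assms(4)] assms(2)]
          by (simp add: pcode_zero pcode_succ)
      qed
      then show "zero = m' \<and> n = n'" using eq dbl_inj assms(2,4) by (simp add: pcode_zero)
    qed
    fix k assume k: "k \<epsilon> omega"
      and IH: "\<forall>m'. m' \<epsilon> omega \<longrightarrow> pcode k n = pcode m' n' \<longrightarrow> k = m' \<and> n = n'"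
    show "\<forall>m'. m' \<epsilon> omega \<longrightarrow> pcode (succ k) n = pcode m' n' \<longrightarrow> succ k = m' \<and> n = n'"
    proof (intro allI impI)
      fix m' assume m': "m' \<epsilon> omega" and eq: "pcode (succ k) n = pcode m' n'"
      have "m' \<noteq> zero"
        using eq dbl_neq_succ_dbl[OF pcode_omega[OF k assms(2)] assms(4)]
        by (auto simp: pcode_zero pcode_succ k)
      then obtain j where j: "j \<epsilon> omega" "m' = succ j" using omega_cases m' by blast
      then have "pcode k n = pcode j n'"
        using eq dbl_inj[OF pcode_omega pcode_omega] k assms(2,4) by (simp add: pcode_succ)
      then show "succ k = m' \<and> n = n'" using IH[rule_format, OF j(1)] j(2) by simp
    qed
  qed
  then show ?thesis using assms(3,5) by blast
qed

definition L :: 'v where "L = coll (\<lambda>l. l \<epsilon> omega1 \<and> LZ l)"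

lemma mem_L: "l \<epsilon> L \<longleftrightarrow> l \<epsilon> omega1 \<and> LZ l"
  unfolding L_def by (rule mem_coll_sep[where x=omega1]) (intro dfn_intros, blast)

lemma dft_L [dfn_intros]: "dft b (\<lambda>e. L)"
  unfolding L_def by (intro dfn_intros)

text \<open>Every ordinal below \<open>omega1\<close> is the sum of an element of \<open>L\<close>
  and a natural number. A numbering of \<open>L\<close> would thus give one of
  \<open>omega1\<close>, through the pairing function \<open>pcode\<close>.\<close>

lemma uncountable_L: "\<not> at_most_countable L"
proof
  assume "at_most_countable L"
  then obtain c where c: "fun_into c L omega"
    "\<And>u v. u \<epsilon> L \<Longrightarrow> v \<epsilon> L \<Longrightarrow> ap c u = ap c v \<Longrightarrow> u = v" unfolding countable_iff by blast
  define F where "F a = the0 (\<lambda>w. \<exists>l n. LZ l \<and> n \<epsilon> omega \<and> a = l \<oplus> n \<and> w = pcode (ap c l) n)" for a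
  have F: "F (l \<oplus> n) = pcode (ap c l) n" if "LZ l" "n \<epsilon> omega" for l n
    unfolding F_def by (rule the0_eq) (use that Ord_decomp_unique in blast)+
  have dF: "dft False (\<lambda>e. F (e 0))" unfolding F_def by (intro dfn_intros)
  have dec: "\<exists>l n. l \<epsilon> L \<and> n \<epsilon> omega \<and> a = l \<oplus> n" if a: "a \<epsilon> omega1" for a
  proof -
    obtain l n where ln: "LZ l" "n \<epsilon> omega" "a = l \<oplus> n" using Ord_decomp Ord_in[OF Ord_omega1 a] by blast
    have "l \<epsilon> omega1"
    proof (cases "n = zero")
      case False
      then have "zero \<epsilon> n" using Ord_linear[of n zero] omega_Ord[OF ln(2)] by auto
      then have "l \<epsilon> a" using pl_mono[OF ln(2), of zero l] ln(3) by simp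
      then show ?thesis using a Ord_trans[OF Ord_omega1] by blast
    qed (use ln a in simp)
    then show ?thesis using ln by (auto simp: mem_L)
  qed
  have "at_most_countable omega1"
  proof (rule countableI[OF dF])
    show "F u \<epsilon> omega" if "u \<epsilon> omega1" for u
      using dec[OF that] F pcode_omega c(1) by (auto simp: mem_L fun_into_iff)
    fix u v assume u: "u \<epsilon> omega1" and v: "v \<epsilon> omega1" and eq: "F u = F v"
    obtain l n where ln: "l \<epsilon> L" "n \<epsilon> omega" "u = l \<oplus> n" using dec[OF u] by blast
    obtain k m where km: "k \<epsilon> L" "m \<epsilon> omega" "v = k \<oplus> m" using dec[OF v] by blast
    have "pcode (ap c l) n = pcode (ap c k) m"
      using eq F[of l n] F[of k m] ln km by (simp add: mem_L)
    moreover have "ap c l \<epsilon> omega" "ap c k \<epsilon> omega" using c(1) ln km by (auto simp: fun_into_iff)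
    ultimately have "ap c l = ap c k \<and> n = m" using pcode_inj ln(2) km(2) by blast
    then show "u = v" using c(2)[of l k] ln km by simp
  qed
  then show False using uncountable_omega1 by blast
qed

subsection \<open>A set of reals without large closed subsets\<close>

text \<open>The continuous map given by \<open>r\<close>, as a labelling of the finite sequences.\<close>

definition cmap :: "'v \<Rightarrow> 'v \<Rightarrow> 'v" where
  "cmap r y = Lam omega (\<lambda>m. ap r (code y m))"

lemma dft_cmap [dfn_intros]: "dft b s \<Longrightarrow> dft b t \<Longrightarrow> dft b (\<lambda>e. cmap (s e) (t e))"
  by (rule dft_sub2[where F=cmap], unfold cmap_def) (intro dfn_intros)

lemma ap_cmap: "m \<epsilon> omega \<Longrightarrow> ap (cmap r y) m = ap r (code y m)"
  unfolding cmap_def by (rule ap_Lam) (intro dfn_intros)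

lemma cmap_R: "r \<epsilon> R \<Longrightarrow> cmap r y \<epsilon> R"
  unfolding cmap_def by (rule Lam_R) (intro dfn_intros, simp add: mem_R fun_into_iff code_omega)

definition cmap_inj :: "'v \<Rightarrow> bool" where
  "cmap_inj r \<longleftrightarrow> (\<forall>y z. y \<epsilon> R \<longrightarrow> z \<epsilon> R \<longrightarrow> cmap r y = cmap r z \<longrightarrow> y = z)"

lemma dfn_cmap_inj [dfn_intros]: "dft b s \<Longrightarrow> dfn b (\<lambda>e. cmap_inj (s e))"
  by (rule dfn_sub1[where P=cmap_inj], unfold cmap_inj_def) (intro dfn_intros)

text \<open>The second property says that the range of \<open>X\<close> is uncountable, in the form
  that contradicts \<open>greedy\<close>; the third is the one that makes the coded position safe.
  The cases are whether \<open>L\<close> can be mapped onto \<open>R\<close>. If it can, distinct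
  reals might exhaust \<open>R\<close>; if not, \<open>L\<close> is too short for a diagonalization
  against all maps.\<close>

lemma bernstein:
  obtains X where "fun_into X L R"
    and "\<And>c. fun_into c L omega \<Longrightarrow>
      \<exists>k l. k \<epsilon> L \<and> l \<epsilon> L \<and> ap c k = ap c l \<and> ap X k \<noteq> ap X l"
    and "\<And>r. r \<epsilon> R \<Longrightarrow> cmap_inj r \<Longrightarrow> \<exists>y. y \<epsilon> R \<and> (\<forall>l. l \<epsilon> L \<longrightarrow> ap X l \<noteq> cmap r y)"
proof (cases "\<exists>g. fun_into g L R \<and> (\<forall>y. y \<epsilon> R \<longrightarrow> (\<exists>l. l \<epsilon> L \<and> ap g l = y))")
  case False
  obtain P where P: "dft False (\<lambda>e. P (e 0))" and
    "\<forall>a. Ord a \<longrightarrow> at_most_countable a \<longrightarrow> P a \<epsilon> R \<and> (\<forall>b. b \<epsilon> a \<longrightarrow> P a \<noteq> P b)"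
    using distinct_reals by blast
  then have PR: "P a \<epsilon> R \<and> (\<forall>b. b \<epsilon> a \<longrightarrow> P a \<noteq> P b)" if "a \<epsilon> omega1" for a
    using that Ord_in[OF Ord_omega1] countable_in_omega1 by blast
  have inj: "k = l" if "k \<epsilon> L" "l \<epsilon> L" "P k = P l" for k l
    using that PR[of k] PR[of l] Ord_linear[of k l] LZ_Ord by (auto simp: mem_L)
  define X where "X = Lam L P"
  have apX: "ap X l = P l" if "l \<epsilon> L" for l unfolding X_def by (rule ap_Lam[OF P that])
  have "fun_into X L R" unfolding X_def
    by (rule fun_into_Lam[OF P]) (use PR in \<open>simp add: mem_L\<close>)
  moreover have "\<exists>k l. k \<epsilon> L \<and> l \<epsilon> L \<and> ap c k = ap c l \<and> ap X k \<noteq> ap X l" if "fun_into c L omega" for c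
  proof -
    obtain k l where kl: "k \<epsilon> L" "l \<epsilon> L" "ap c k = ap c l" "k \<noteq> l"
      using uncountable_L \<open>fun_into c L omega\<close> unfolding countable_iff by blast
    then have "ap X k \<noteq> ap X l" using apX inj[of k l] by auto
    then show ?thesis using kl by blast
  qed
  moreover have "\<exists>y. y \<epsilon> R \<and> (\<forall>l. l \<epsilon> L \<longrightarrow> ap X l \<noteq> cmap r y)" if r: "r \<epsilon> R" "cmap_inj r" for r
  proof (rule ccontr)
    assume n: "\<not> ?thesis"
    \<comment> \<open>The inverse of \<open>cmap r\<close> applied to the values of
      \<open>X\<close>, with \<open>r\<close> as a default element of \<open>R\<close>. If all
      values of \<open>cmap r\<close> occurred in \<open>X\<close>, this would map \<open>L\<close>
      onto \<open>R\<close>.\<close>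
    define F where "F l = (if \<exists>y. y \<epsilon> R \<and> cmap r y = ap X l
      then the0 (\<lambda>y. y \<epsilon> R \<and> cmap r y = ap X l) else r)" for l
    have dF: "dft False (\<lambda>e. F (e 0))" unfolding F_def by (intro dfn_intros)
    have F: "F l = y" if "y \<epsilon> R" "cmap r y = ap X l" for y l
    proof -
      have "the0 (\<lambda>y. y \<epsilon> R \<and> cmap r y = ap X l) = y"
        by (rule the0_eq) (use that r(2) in \<open>auto simp: cmap_inj_def\<close>)
      then show ?thesis unfolding F_def using that by auto
    qed
    have "F l \<epsilon> R" for l
    proof (cases "\<exists>y. y \<epsilon> R \<and> cmap r y = ap X l")
      case True
      then show ?thesis using F by blast
    next
      case False
      then have "F l = r" unfolding F_def by (rule if_not_P)
      then show ?thesis using r(1) by simp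
    qed
    then have "fun_into (Lam L F) L R" by (intro fun_into_Lam[OF dF])
    moreover have "\<exists>l. l \<epsilon> L \<and> ap (Lam L F) l = y" if y: "y \<epsilon> R" for y
    proof -
      obtain l where l: "l \<epsilon> L" "ap X l = cmap r y" using n y by blast
      then show ?thesis using F[OF y] ap_Lam[OF dF] by auto
    qed
    ultimately show False using False by blast
  qed
  ultimately show ?thesis using that by blast
next
  case True
  then obtain g where g: "fun_into g L R" "\<And>y. y \<epsilon> R \<Longrightarrow> \<exists>l. l \<epsilon> L \<and> ap g l = y" by blast
  have gR: "ap g l \<epsilon> R" if "l \<epsilon> L" for l using g(1) that by (simp add: fun_into_iff)
  \<comment> \<open>\<open>g\<close> lists all reals and thereby all maps. \<open>P l\<close> will
    be a point in the range of map number \<open>l\<close> whenever this map is injective; the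
    choice cannot get stuck, since such a range is uncountable and \<open>l\<close> is
    countable.\<close>
  define B where "B l = (if cmap_inj (ap g l) then img R (cmap (ap g l)) else R)" for l
  have dB: "dft False (\<lambda>e. B (e 0))" unfolding B_def by (intro dfn_intros)
  have dc: "dft False (\<lambda>e. cmap r (e 0))" for r by (intro dfn_intros)
  obtain P where P: "dft False (\<lambda>e. P (e 0))" and
    rep: "\<And>\<alpha>. Ord \<alpha> \<Longrightarrow> subset (B \<alpha>) R \<Longrightarrow> (\<exists>w. w \<epsilon> B \<alpha> \<and> (\<forall>\<beta>. \<beta> \<epsilon> \<alpha> \<longrightarrow> w \<noteq> P \<beta>)) \<Longrightarrow>
      P \<alpha> \<epsilon> B \<alpha> \<and> (\<forall>\<beta>. \<beta> \<epsilon> \<alpha> \<longrightarrow> P \<alpha> \<noteq> P \<beta>)"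
    using representatives[where B=B and Z=R, OF dB] by blast
  have BR: "subset (B l) R" if "l \<epsilon> L" for l
    using gR[OF that] cmap_R by (auto simp: B_def subset_def mem_img[OF dc])
  have PB: "P l \<epsilon> B l \<and> (\<forall>b. b \<epsilon> l \<longrightarrow> P l \<noteq> P b)" if l: "l \<epsilon> L" for l
  proof (rule rep[OF _ BR[OF l]])
    show "Ord l" using l LZ_Ord by (simp add: mem_L)
    have c: "at_most_countable l" using l countable_in_omega1 by (simp add: mem_L)
    show "\<exists>w. w \<epsilon> B l \<and> (\<forall>\<beta>. \<beta> \<epsilon> l \<longrightarrow> w \<noteq> P \<beta>)"
    proof (cases "cmap_inj (ap g l)")
      case True
      then obtain y where "y \<epsilon> R" "\<forall>d. d \<epsilon> l \<longrightarrow> cmap (ap g l) y \<noteq> P d"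
        using diagonal[OF c dc P, of "ap g l"] unfolding cmap_inj_def by blast
      then show ?thesis using True by (auto simp: B_def mem_img[OF dc])
    next
      case False
      then show ?thesis using diagonal[of l "\<lambda>x. x" P, OF c dft_var P] by (simp add: B_def)
    qed
  qed
  have inj: "k = l" if "k \<epsilon> L" "l \<epsilon> L" "P k = P l" for k l
    using that PB[of k] PB[of l] Ord_linear[of k l] LZ_Ord by (auto simp: mem_L)
  \<comment> \<open>\<open>code\<close> never takes the value \<open>zero\<close>, so bit 0 of
    \<open>r\<close> has no influence on \<open>cmap r\<close> and can serve as a mark.
    \<open>X\<close> receives the points \<open>P l\<close> of marked \<open>g l\<close> only. Each
    map also has an unmarked name, whose point is therefore missing from \<open>X\<close>.\<close>
  let ?fl = "\<lambda>l. ap (ap g l) zero = one"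
  have do: "dft False (\<lambda>e. one)" by (intro dfn_intros)
  have "Lam omega (\<lambda>_. one) \<epsilon> R" by (rule Lam_R[OF do]) (simp add: mem_two)
  then obtain l1 where l1: "l1 \<epsilon> L" "ap g l1 = Lam omega (\<lambda>_. one)" using g(2) by blast
  then have fl1: "?fl l1" using ap_Lam[OF do zero_omega] by simp
  define F where "F l = (if ?fl l then P l else P l1)" for l
  have dF: "dft False (\<lambda>e. F (e 0))" unfolding F_def
    by (intro dfn_intros dft_sub1[where F=P, OF P])
  have PR: "P l \<epsilon> R" if "l \<epsilon> L" for l using PB[OF that] BR[OF that] by (auto simp: subset_def)
  define X where "X = Lam L F"
  have apX: "ap X l = F l" if "l \<epsilon> L" for l unfolding X_def by (rule ap_Lam[OF dF that])
  have "fun_into X L R" unfolding X_def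
    by (rule fun_into_Lam[OF dF]) (use PR l1 in \<open>simp add: F_def\<close>)
  moreover have "\<exists>k l. k \<epsilon> L \<and> l \<epsilon> L \<and> ap c k = ap c l \<and> ap X k \<noteq> ap X l" if c: "fun_into c L omega" for c
  proof (rule ccontr)
    assume n: "\<not> ?thesis"
    have cinj: "k = l" if "k \<epsilon> L" "l \<epsilon> L" "?fl k" "?fl l" "ap c k = ap c l" for k l
    proof -
      have "ap X k = ap X l" using n that by blast
      then show ?thesis using that apX inj[OF that(1,2)] by (simp add: F_def)
    qed
    \<comment> \<open>A diagonal real that is itself marked. Bit 0 is taken up by the mark, so the
      real with number \<open>ap c l\<close> is contradicted at the next bit,
      \<open>succ (ap c l)\<close>.\<close>
    define D where "D m = (if m = zero then one else
      flip (ap (ap g (the0 (\<lambda>l. l \<epsilon> L \<and> ?fl l \<and> succ (ap c l) = m))) m))" for m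
    have dD: "dft False (\<lambda>e. D (e 0))" unfolding D_def by (intro dfn_intros)
    have "Lam omega D \<epsilon> R" by (rule Lam_R[OF dD]) (simp add: D_def mem_two flip_two[unfolded mem_two])
    then obtain l where l: "l \<epsilon> L" "ap g l = Lam omega D" using g(2) by blast
    have "D zero = one" by (simp add: D_def)
    then have fl: "?fl l" unfolding l(2) ap_Lam[OF dD zero_omega] .
    let ?m = "succ (ap c l)"
    have m: "?m \<epsilon> omega" using c l(1) by (simp add: fun_into_iff)
    have "the0 (\<lambda>k. k \<epsilon> L \<and> ?fl k \<and> succ (ap c k) = ?m) = l"
      by (rule the0_eq) (use l(1) fl cinj in auto)
    then have "D ?m = flip (ap (ap g l) ?m)" by (simp add: D_def)
    also have "ap (ap g l) ?m = D ?m" unfolding l(2) by (rule ap_Lam[OF dD m])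
    finally show False by simp
  qed
  moreover have "\<exists>y. y \<epsilon> R \<and> (\<forall>l. l \<epsilon> L \<longrightarrow> ap X l \<noteq> cmap r y)" if r: "r \<epsilon> R" "cmap_inj r" for r
  proof -
    have d: "dft False (\<lambda>e. if e 0 = zero then zero else ap r (e 0))" by (intro dfn_intros)
    \<comment> \<open>The unmarked name of the map given by \<open>r\<close>. As \<open>P\<close> is
      injective on \<open>L\<close> and only marked indices contribute to \<open>X\<close>, the
      point chosen for this name is avoided.\<close>
    define r' where "r' = Lam omega (\<lambda>n. if n = zero then zero else ap r n)"
    have r'R: "r' \<epsilon> R" unfolding r'_def
      by (rule Lam_R[OF d]) (use r(1) in \<open>auto simp: mem_R fun_into_iff mem_two\<close>)
    have eq: "cmap r' y = cmap r y" for y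
    proof (rule R_ext[OF cmap_R[OF r'R] cmap_R[OF r(1)]])
      fix n assume n: "n \<epsilon> omega"
      then show "ap (cmap r' y) n = ap (cmap r y) n"
        using ap_Lam[OF d, of "code y n" omega] code_omega[OF n] by (simp add: ap_cmap r'_def)
    qed
    obtain l where l: "l \<epsilon> L" "ap g l = r'" using g(2) r'R by blast
    have nfl: "\<not> ?fl l" using ap_Lam[OF d zero_omega] l(2) by (simp add: r'_def)
    have "cmap_inj r'" using r(2) by (simp add: cmap_inj_def eq)
    then obtain y where y: "y \<epsilon> R" "P l = cmap r y"
      using PB[OF l(1)] l(2) eq by (auto simp: B_def mem_img[OF dc])
    have "ap X k \<noteq> P l" if k: "k \<epsilon> L" for k
    proof (cases "?fl k")
      case True
      then have "k \<noteq> l" using nfl by auto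
      then show ?thesis using True apX[OF k] inj[OF k l(1)] by (auto simp: F_def)
    next
      case False
      have "l1 \<noteq> l" using nfl fl1 by auto
      then show ?thesis using False apX[OF k] inj[OF l1(1) l(1)] by (auto simp: F_def)
    qed
    then show ?thesis using y by auto
  qed
  ultimately show ?thesis using that by blast
qed

subsection \<open>The game\<close>

text \<open>
  Round \<open>m\<close> of the last \<open>\<omega>\<close> moves consists of a bit of the first player at \<open>pos m\<close>, an ignored
  move, the decision of the first player whether to give a signal at \<open>sp m\<close>, and the answer at
  \<open>ans m\<close>. The \<open>m\<close>-th bit of \<open>x\<^sub>\<lambda>\<close> is the move at \<open>\<lambda> + 4 m\<close>.
\<close>

definition len :: 'v where "len = omega1 \<oplus> omega"

definition pos :: "'v \<Rightarrow> 'v" where "pos m = omega1 \<oplus> dbl (dbl m)"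

definition ans :: "'v \<Rightarrow> 'v" where "ans m = succ (succ (succ (pos m)))"

definition sp :: "'v \<Rightarrow> 'v" where "sp m = succ (succ (pos m))"

definition sig :: "'v \<Rightarrow> 'v \<Rightarrow> bool" where "sig h m \<longleftrightarrow> ap h (sp m) = one"

lemma dft_len [dfn_intros]: "dft b (\<lambda>e. len)"
  unfolding len_def by (intro dfn_intros)

lemma dft_pos [dfn_intros]: "dft b s \<Longrightarrow> dft b (\<lambda>e. pos (s e))"
  unfolding pos_def by (intro dfn_intros)

lemma dft_sp [dfn_intros]: "dft b s \<Longrightarrow> dft b (\<lambda>e. sp (s e))"
  unfolding sp_def by (intro dfn_intros)

lemma dft_ans [dfn_intros]: "dft b s \<Longrightarrow> dft b (\<lambda>e. ans (s e))"
  unfolding ans_def by (intro dfn_intros)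

lemma dfn_sig [dfn_intros]: "dft b s \<Longrightarrow> dft b t \<Longrightarrow> dfn b (\<lambda>e. sig (s e) (t e))"
  unfolding sig_def by (intro dfn_intros)

lemma Ord_len [simp]: "Ord len"
  by (simp add: len_def Ord_pl_omega)

lemma mem_len: "a \<epsilon> len \<longleftrightarrow> a \<epsilon> omega1 \<or> (\<exists>n. n \<epsilon> omega \<and> a = omega1 \<oplus> n)"
  by (simp add: len_def mem_pl_omega)

lemma len_induct:
  assumes "dfn False (\<lambda>e. P (e 0))" "\<And>a. a \<epsilon> len \<Longrightarrow> (\<And>x. x \<epsilon> a \<Longrightarrow> P x) \<Longrightarrow> P a" "a \<epsilon> len"
  shows "P a"
proof -
  have "a \<epsilon> len \<longrightarrow> P a"
  proof (rule Ord_induct[where P="\<lambda>a. a \<epsilon> len \<longrightarrow> P a"])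
    show "Ord a" using Ord_in[OF Ord_len assms(3)] .
    show "dfn False (\<lambda>e. e 0 \<epsilon> len \<longrightarrow> P (e 0))" by (intro dfn_intros assms(1))
    show "a \<epsilon> len \<longrightarrow> P a" if "\<And>x. x \<epsilon> a \<Longrightarrow> x \<epsilon> len \<longrightarrow> P x" for a
      using that assms(2)[of a] Ord_trans[OF Ord_len] by blast
  qed
  then show ?thesis using assms(3) by blast
qed

lemma omega1_len: "a \<epsilon> omega1 \<Longrightarrow> a \<epsilon> len"
  by (simp add: mem_len)

lemma LZ_omega1: "LZ omega1"
  by (simp add: LZ_def Limit_omega1)

lemma pos_succ: "m \<epsilon> omega \<Longrightarrow> pos (succ m) = succ (ans m)"
  by (simp add: pos_def ans_def)

lemma pos_shift:
  assumes "m \<epsilon> omega"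
  shows "sp m = omega1 \<oplus> succ (succ (dbl (dbl m)))"
    and "ans m = omega1 \<oplus> succ (succ (succ (dbl (dbl m))))"
  using assms by (simp_all add: pos_def sp_def ans_def)

lemma in_len:
  assumes "m \<epsilon> omega" shows "pos m \<epsilon> len" "sp m \<epsilon> len" "ans m \<epsilon> len"
  using assms unfolding pos_shift[OF assms] unfolding len_def pos_def by (simp_all add: pl_omega_mem del: pl_succ_omega)

lemma not_in_omega1:
  assumes "m \<epsilon> omega"
  shows "\<not> pos m \<epsilon> omega1" "\<not> sp m \<epsilon> omega1" "\<not> ans m \<epsilon> omega1"
  using assms unfolding pos_shift[OF assms] unfolding pos_def by (simp_all add: pl_not_mem del: pl_succ_omega)

lemma turn_pos:
  assumes m: "m \<epsilon> omega"
  shows "first_turn (pos m)" "first_turn (sp m)" "\<not> first_turn (ans m)"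
    "\<not> first_turn (succ (pos m))"
proof -
  have *: "succ (succ (dbl (dbl m))) = dbl (succ (dbl m))" using m by simp
  show "first_turn (pos m)" unfolding pos_def first_turn_iff[OF LZ_omega1 dbl_omega[OF dbl_omega[OF m]]]
    using m dbl_omega by blast
  have o: "succ (succ (dbl (dbl m))) \<epsilon> omega" "succ (succ (succ (dbl (dbl m)))) \<epsilon> omega"
    using m by simp_all
  have d: "succ (dbl m) \<epsilon> omega" using m by simp
  show "first_turn (sp m)"
    unfolding pos_shift[OF m] first_turn_iff[OF LZ_omega1 o(1)] unfolding * using d by blast
  show "\<not> first_turn (ans m)"
    unfolding pos_shift[OF m] first_turn_iff[OF LZ_omega1 o(2)] unfolding *
    using dbl_neq_succ_dbl[OF _ d] by metis
  have "succ (dbl (dbl m)) \<epsilon> omega" "succ (pos m) = omega1 \<oplus> succ (dbl (dbl m))"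
    using m by (simp_all add: pos_def)
  then show "\<not> first_turn (succ (pos m))"
    using first_turn_iff[OF LZ_omega1] dbl_neq_succ_dbl[OF _ dbl_omega[OF m]] by metis
qed

lemma len_cases:
  assumes "a \<epsilon> len" "\<not> a \<epsilon> omega1"
  obtains k where "k \<epsilon> omega" "a = pos k" | k where "k \<epsilon> omega" "a = succ (pos k)"
    | k where "k \<epsilon> omega" "a = sp k" | k where "k \<epsilon> omega" "a = ans k"
proof -
  obtain n where n: "n \<epsilon> omega" "a = omega1 \<oplus> n" using assms mem_len by blast
  obtain j where j: "j \<epsilon> omega" "n = dbl j \<or> n = succ (dbl j)" using parity[OF n(1)] by blast
  obtain k where k: "k \<epsilon> omega" "j = dbl k \<or> j = succ (dbl k)" using parity[OF j(1)] by blast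
  have "a = pos k \<or> a = succ (pos k) \<or> a = sp k \<or> a = ans k"
    unfolding pos_def sp_def ans_def using j k n(2) by auto
  then show ?thesis using that k(1) by blast
qed

lemma pos_inj: "m \<epsilon> omega \<Longrightarrow> k \<epsilon> omega \<Longrightarrow> pos m = pos k \<longleftrightarrow> m = k"
  by (simp add: pos_def pl_inj dbl_inj)

lemma ans_inj: "m \<epsilon> omega \<Longrightarrow> k \<epsilon> omega \<Longrightarrow> ans m = ans k \<longleftrightarrow> m = k"
  by (simp add: ans_def pos_inj)

lemma pos_neq: "m \<epsilon> omega \<Longrightarrow> k \<epsilon> omega \<Longrightarrow> pos m \<noteq> sp k"
proof
  assume m: "m \<epsilon> omega" and k: "k \<epsilon> omega" and "pos m = sp k"
  then have "dbl (dbl m) = dbl (succ (dbl k))"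
    unfolding pos_shift[OF k] unfolding pos_def by (simp add: pl_inj del: pl_succ_omega)
  then have "dbl m = succ (dbl k)" using m k dbl_inj[of "dbl m" "succ (dbl k)"] by simp
  then show False using dbl_neq_succ_dbl m k by blast
qed

lemma ans_less: "m \<epsilon> omega \<Longrightarrow> j \<epsilon> m \<Longrightarrow> ans j \<epsilon> pos m"
proof -
  assume m: "m \<epsilon> omega" and j: "j \<epsilon> m"
  have "j \<epsilon> m \<longrightarrow> ans j \<epsilon> pos m"
    using m
  proof (rule omega_induct[where P="\<lambda>m. j \<epsilon> m \<longrightarrow> ans j \<epsilon> pos m"])
    show "dfn False (\<lambda>e. j \<epsilon> e 0 \<longrightarrow> ans j \<epsilon> pos (e 0))" by (intro dfn_intros)
    fix k assume "k \<epsilon> omega" "j \<epsilon> k \<longrightarrow> ans j \<epsilon> pos k"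
    then show "j \<epsilon> succ k \<longrightarrow> ans j \<epsilon> pos (succ k)" by (auto simp: pos_succ) (simp add: ans_def)
  qed simp
  then show ?thesis using j by blast
qed

lemma Ord_pos: "m \<epsilon> omega \<Longrightarrow> Ord (pos m)"
  by (simp add: pos_def)

lemma ans_less_iff:
  assumes m: "m \<epsilon> omega" and j: "j \<epsilon> omega" and l: "ans j \<epsilon> succ (pos m)" shows "j \<epsilon> m"
proof (rule ccontr)
  assume "\<not> j \<epsilon> m"
  then have "m = j \<or> m \<epsilon> j" using Ord_linear omega_Ord m j by blast
  then have "pos m \<epsilon> ans j"
  proof
    assume "m \<epsilon> j"
    then have "ans m \<epsilon> pos j" using ans_less j by blast
    then have "pos m \<epsilon> pos j" using Ord_trans[OF Ord_pos[OF j], of "ans m" "pos m"] by (simp add: ans_def)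
    then show ?thesis by (simp add: ans_def)
  qed (simp add: ans_def)
  then show False using l mem_asym[of "pos m" "ans j"] by auto
qed

text \<open>An answer binds the bit of the following round, so bit 0 is always free. If
  \<open>X\<^sub>l\<close> denotes the coded family, the first clause says that the bits played form
  one of its members.\<close>

definition won :: "'v \<Rightarrow> bool" where
  "won h \<longleftrightarrow> (\<exists>l. l \<epsilon> L \<and> (\<forall>m. m \<epsilon> omega \<longrightarrow> ap h (l \<oplus> dbl (dbl m)) = ap h (pos m))) \<and>
     (\<forall>m. m \<epsilon> omega \<longrightarrow> sig h m \<longrightarrow> ap h (pos (succ m)) = ap h (ans m)) \<and>
     (\<forall>m. m \<epsilon> omega \<longrightarrow> (\<exists>k. k \<epsilon> omega \<and> m \<epsilon> k \<and> sig h k))"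

text \<open>Because \<open>ap\<close> is total, any set with this property can be consulted at every
  position; strategies for the last part of the game thus require no domain of their own.\<close>

definition legal :: "'v \<Rightarrow> bool" where "legal \<sigma> \<longleftrightarrow> (\<forall>p. ap \<sigma> p \<epsilon> two)"

definition agree :: "'v \<Rightarrow> 'v \<Rightarrow> bool" where
  "agree f h \<longleftrightarrow> (\<forall>a. a \<epsilon> omega1 \<longrightarrow> ap h a = ap f a)"

definition tailplay :: "'v \<Rightarrow> 'v \<Rightarrow> 'v \<Rightarrow> bool" where
  "tailplay f \<sigma> h \<longleftrightarrow> fun_into h len two \<and> agree f h \<and>
     (\<forall>a. a \<epsilon> len \<longrightarrow> \<not> a \<epsilon> omega1 \<longrightarrow> first_turn a \<longrightarrow> ap h a = ap \<sigma> (restr h a))"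

text \<open>\<open>f\<close> enters only through \<open>agree\<close>, that is, through its moves
  before \<open>omega1\<close>. So safety is settled before the perfect set game begins, and plays
  with the same beginning share it.\<close>

definition safe :: "'v \<Rightarrow> bool" where
  "safe f \<longleftrightarrow> \<not> (\<exists>\<sigma>. legal \<sigma> \<and> (\<forall>h. tailplay f \<sigma> h \<longrightarrow> won h))"

definition payoff :: 'v where
  "payoff = coll (\<lambda>f. fun_into f len two \<and> won f \<and> safe f)"

lemma oadd_dbl: "m \<epsilon> omega \<Longrightarrow> oadd k (oadd m m) = k \<oplus> dbl m"
  by (simp add: oadd_pl omega_Ord dbl_def[symmetric])

lemma oadd_succ_dbl: "m \<epsilon> omega \<Longrightarrow> oadd k (succ (oadd m m)) = k \<oplus> succ (dbl m)"
  by (simp add: oadd_pl omega_Ord dbl_def[symmetric])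

lemma dfn_first_turn [dfn_intros]: "dft b s \<Longrightarrow> dfn b (\<lambda>e. first_turn (s e))"
proof (rule dfn_sub1[where P=first_turn])
  have "first_turn = (\<lambda>a. \<exists>k m. LZ k \<and> m \<epsilon> omega \<and> a = k \<oplus> dbl m)"
    unfolding first_turn_def LZ_def using oadd_dbl by metis
  then show "dfn b (\<lambda>e. first_turn (e 0))" by (simp only:) (intro dfn_intros)
qed

lemma dfn_second_turn [dfn_intros]: "dft b s \<Longrightarrow> dfn b (\<lambda>e. second_turn (s e))"
proof (rule dfn_sub1[where P=second_turn])
  have "second_turn = (\<lambda>a. \<exists>k m. LZ k \<and> m \<epsilon> omega \<and> a = k \<oplus> succ (dbl m))"
    unfolding second_turn_def LZ_def using oadd_succ_dbl by metis
  then show "dfn b (\<lambda>e. second_turn (e 0))" by (simp only:) (intro dfn_intros)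
qed

text \<open>All constants involved are ordinals or definable, so the flag can be left open:
  \<open>False\<close> yields the existence of the payoff set, \<open>True\<close> its ordinal
  definability.\<close>

lemma dfn_payoff: "dfn b (\<lambda>e. fun_into (e 0) len two \<and> won (e 0) \<and> safe (e 0))"
  unfolding won_def safe_def legal_def tailplay_def agree_def by (intro dfn_intros)

lemma mem_payoff: "f \<epsilon> payoff \<longleftrightarrow> fun_into f len two \<and> won f \<and> safe f"
  unfolding payoff_def by (rule mem_coll_sep[OF dfn_payoff, of "Fsp len two"]) simp

lemma ordinal_definable_payoff: "ordinal_definable payoff"
  by (rule ordinal_definableI[OF dfn_payoff]) (rule mem_payoff)

section \<open>Plays and strategies\<close>

lemma restr_eq:
  assumes "fun_on f d" "fun_on g d'" "subset a d" "subset a d'" "\<And>x. x \<epsilon> a \<Longrightarrow> ap f x = ap g x"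
  shows "restr f a = restr g a"
  by (rule fun_ext[OF fun_on_restr[OF assms(1,3)] fun_on_restr[OF assms(2,4)]])
    (simp add: ap_restr assms(5))

lemma subset_len: "a \<epsilon> len \<Longrightarrow> subset a len"
  using Ord_trans[OF Ord_len] by (simp add: subset_def)

lemma restr_eq_len:
  "fun_into f len two \<Longrightarrow> fun_into g len two \<Longrightarrow> a \<epsilon> len \<Longrightarrow> (\<And>x. x \<epsilon> a \<Longrightarrow> ap f x = ap g x) \<Longrightarrow>
    restr f a = restr g a"
  using restr_eq subset_len unfolding fun_into_iff by blast

text \<open>\<open>G\<close> combines the behaviour of both players: it maps the index of a move and
  the position before it to the move.\<close>

definition play :: "('v \<Rightarrow> 'v \<Rightarrow> 'v) \<Rightarrow> 'v" where
  "play G = Lam len (trec G)"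

lemma dft_play [dfn_intros]:
  assumes "dft b (\<lambda>e. G (e 0) (e (Suc 0)) (\<lambda>n. e (Suc (Suc n))))"
  shows "dft b (\<lambda>e. play (\<lambda>x f. G x f e))"
proof -
  have 1: "dft b (\<lambda>e. G (e 0) (e (Suc 0)) (\<lambda>n. e (Suc (Suc (Suc n)))))"
    using dft_ren[OF assms, of "case_nat 0 (case_nat 1 (\<lambda>n. Suc (Suc (Suc n))))"] by simp
  show ?thesis unfolding play_def by (intro dfn_intros 1)
qed

lemma
  assumes G: "dft False (\<lambda>e. G (e 0) (e (Suc 0)))"
    and two: "\<And>a p. a \<epsilon> len \<Longrightarrow> G a p \<epsilon> two"
  shows ap_play: "a \<epsilon> len \<Longrightarrow> ap (play G) a = G a (restr (play G) a)"
    and play_into: "fun_into (play G) len two"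
proof -
  note T = dft_trec1[OF G]
  have fon: "fun_on (play G) len" unfolding play_def by (rule fun_on_Lam[OF T])
  have *: "ap (play G) a = trec G a" if "a \<epsilon> len" for a
    unfolding play_def by (rule ap_Lam[OF T that])
  have eq: "ap (play G) a = G a (restr (play G) a)" if a: "a \<epsilon> len" for a
  proof -
    have "restr (play G) a = Lam a (trec G)"
      by (rule fun_ext[OF fun_on_restr[OF fon subset_len[OF a]] fun_on_Lam[OF T]])
        (use * Ord_trans[OF Ord_len a] in \<open>simp add: ap_restr ap_Lam[OF T]\<close>)
    then show ?thesis using *[OF a] trec_unfold[OF G Ord_in[OF Ord_len a]] by simp
  qed
  then show "a \<epsilon> len \<Longrightarrow> ap (play G) a = G a (restr (play G) a)" for a .
  show "fun_into (play G) len two" unfolding fun_into_iff using fon eq two by simp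
qed

lemma mem_positions:
  assumes T: "dfn False (\<lambda>e. T (e 0))"
  shows "p \<epsilon> positions T d S \<longleftrightarrow> (\<exists>a. a \<epsilon> d \<and> T a \<and> fun_into p a S)"
  unfolding positions_def
proof (rule set_of_mem)
  have dF: "dft False (\<lambda>e. Fsp (e 0) S)" by (intro dfn_intros)
  have "dfn False (\<lambda>e. \<exists>a. a \<epsilon> d \<and> T a \<and> fun_into (e 0) a S)"
    by (intro dfn_intros dfn_sub1[where P=T, OF T])
  from sep_ex[of "\<lambda>p. \<exists>a. a \<epsilon> d \<and> T a \<and> fun_into p a S", OF this, of "Uni (img d (\<lambda>a. Fsp a S))"]
  obtain y where y: "\<forall>p. p \<epsilon> y \<longleftrightarrow> p \<epsilon> Uni (img d (\<lambda>a. Fsp a S)) \<and>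
    (\<exists>a. a \<epsilon> d \<and> T a \<and> fun_into p a S)" by blast
  have "p \<epsilon> Uni (img d (\<lambda>a. Fsp a S))" if "a \<epsilon> d" "fun_into p a S" for p a
    unfolding mem_Uni mem_img[OF dF] using that by (intro exI[of _ "Fsp a S"]) auto
  then show "\<exists>y. \<forall>p. p \<epsilon> y \<longleftrightarrow> (\<exists>a. a \<epsilon> d \<and> T a \<and> fun_into p a S)"
    using y by (intro exI[of _ y]) blast
qed

lemma strategy_legal:
  assumes "strategy T len two \<sigma>" shows "legal \<sigma>"
  unfolding legal_def
proof
  fix p
  show "ap \<sigma> p \<epsilon> two"
  proof (cases "p \<epsilon> positions T len two")
    case True
    then show ?thesis using assms by (simp add: strategy_def fun_into_iff)
  next
    case False
    \<comment> \<open>Outside its domain \<open>\<sigma>\<close> is read as \<open>zero\<close> by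
      \<open>ap\<close>, and \<open>zero\<close> is a valid move.\<close>
    then have "\<not> (\<exists>!y. opair p y \<epsilon> \<sigma>)"
      using assms fun_on_dom unfolding strategy_def fun_into_def by blast
    then show ?thesis by (simp add: ap_def the0_def mem_two)
  qed
qed

lemma follows_iff:
  assumes T: "dfn False (\<lambda>e. T (e 0))" and "strategy T len two \<sigma>" "fun_into f len two"
  shows "follows T len f \<sigma> \<longleftrightarrow> (\<forall>a. a \<epsilon> len \<longrightarrow> T a \<longrightarrow> ap f a = ap \<sigma> (restr f a))"
proof -
  have "app f a = ap f a \<and> app \<sigma> (restr f a) = ap \<sigma> (restr f a)" if a: "a \<epsilon> len" "T a" for a
  proof
    show "app f a = ap f a" using assms(3) a app_ap[of f len a] by (simp add: fun_into_iff)
    have "fun_into (restr f a) a two" by (rule fun_into_restr[OF assms(3) subset_len[OF a(1)]])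
    then have "restr f a \<epsilon> positions T len two" unfolding mem_positions[OF T] using a by blast
    then show "app \<sigma> (restr f a) = ap \<sigma> (restr f a)"
      using assms(2) app_ap unfolding strategy_def fun_into_iff by blast
  qed
  then show ?thesis unfolding follows_def by auto
qed

text \<open>A play that follows a winning \<open>\<sigma>\<close> belongs to the payoff set, hence
  is safe. But every continuation of its first \<open>omega1\<close> moves in which
  \<open>\<sigma>\<close> is followed is again won, so \<open>\<sigma>\<close> itself witnesses that
  the play is not safe.\<close>

lemma first_not_winning: "\<not> first_wins_by len two payoff \<sigma>"
proof
  assume "first_wins_by len two payoff \<sigma>"
  then have st: "strategy first_turn len two \<sigma>"
    and win: "\<And>f. fun_into f len two \<Longrightarrow> follows first_turn len f \<sigma> \<Longrightarrow> f \<epsilon> payoff"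
    unfolding first_wins_by_def by blast+
  have dT: "dfn False (\<lambda>e. first_turn (e 0))" by (intro dfn_intros)
  have leg: "legal \<sigma>" by (rule strategy_legal[OF st])
  \<comment> \<open>One opponent suffices; this one always plays \<open>zero\<close>.\<close>
  define G where "G a p = (if first_turn a then ap \<sigma> p else zero)" for a p
  have G: "dft False (\<lambda>e. G (e 0) (e (Suc 0)))" unfolding G_def by (intro dfn_intros)
  have G2: "G a p \<epsilon> two" for a p using leg by (simp add: G_def legal_def mem_two)
  note f = ap_play[OF G G2] play_into[OF G G2]
  let ?f = "play G"
  have fol: "ap ?f a = ap \<sigma> (restr ?f a)" if "a \<epsilon> len" "first_turn a" for a
    unfolding f(1)[OF that(1)] unfolding G_def using that(2) by simp
  have "?f \<epsilon> payoff" by (rule win[OF f(2)]) (use fol in \<open>simp add: follows_iff[OF dT st f(2)]\<close>)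
  then have "safe ?f" by (simp add: mem_payoff)
  moreover have "won h" if h: "tailplay ?f \<sigma> h" for h
  proof -
    have hf: "fun_into h len two" and ag: "\<And>a. a \<epsilon> omega1 \<Longrightarrow> ap h a = ap ?f a"
      and tl: "\<And>a. a \<epsilon> len \<Longrightarrow> \<not> a \<epsilon> omega1 \<Longrightarrow> first_turn a \<Longrightarrow> ap h a = ap \<sigma> (restr h a)"
      using h unfolding tailplay_def agree_def by blast+
    have "ap h a = ap \<sigma> (restr h a)" if a: "a \<epsilon> len" "first_turn a" for a
    proof (cases "a \<epsilon> omega1")
      case True
      have "restr h a = restr ?f a"
        by (rule restr_eq_len[OF hf f(2) a(1)]) (use ag Ord_trans[OF Ord_omega1 True] in blast)
      then show ?thesis using ag[OF True] fol[OF a] by simp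
    qed (use tl a in blast)
    then have "h \<epsilon> payoff" by (intro win[OF hf]) (simp add: follows_iff[OF dT st hf])
    then show ?thesis by (simp add: mem_payoff)
  qed
  ultimately show False using leg unfolding safe_def by blast
qed

subsection \<open>Counting signals\<close>

text \<open>The number of signals before round \<open>m\<close>. When the answers are taken from a
  real, this is the index of the bit that answers a signal in round \<open>m\<close>.\<close>

definition cnt :: "'v \<Rightarrow> 'v \<Rightarrow> 'v" where
  "cnt p m = nrec zero (\<lambda>k c. if sig p k then succ c else c) m"

lemma dft_cnt [dfn_intros]: "dft b s \<Longrightarrow> dft b t \<Longrightarrow> dft b (\<lambda>e. cnt (s e) (t e))"
  by (rule dft_sub2[where F=cnt], unfold cnt_def) (intro dfn_intros)

lemma
  shows cnt_zero: "cnt p zero = zero"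
    and cnt_succ: "m \<epsilon> omega \<Longrightarrow> cnt p (succ m) = (if sig p m then succ (cnt p m) else cnt p m)"
proof -
  let ?F = "\<lambda>k c. if sig p k then succ c else c"
  have F: "dft False (\<lambda>e. ?F (e 0) (e (Suc 0)))" by (intro dfn_intros)
  show "cnt p zero = zero" unfolding cnt_def by (rule nrec_zero[OF F])
  show "cnt p (succ m) = (if sig p m then succ (cnt p m) else cnt p m)" if "m \<epsilon> omega"
    unfolding cnt_def by (rule nrec_succ[OF F that])
qed

text \<open>At most one bit of the guiding real is consumed per round. This rate is what allows the
  map from it to the first player's bits to have the form \<open>cmap r\<close>.\<close>

lemma cnt_le: "m \<epsilon> omega \<Longrightarrow> cnt p m \<epsilon> succ m"
proof (rule omega_induct[where P="\<lambda>m. cnt p m \<epsilon> succ m"])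
  show "dfn False (\<lambda>e. cnt p (e 0) \<epsilon> succ (e 0))" by (intro dfn_intros)
  fix k assume k: "k \<epsilon> omega" "cnt p k \<epsilon> succ k"
  then have "succ (cnt p k) \<epsilon> succ (succ k)" by (simp only: succ_mem_succ Ord_succ omega_Ord)
  then show "cnt p (succ k) \<epsilon> succ (succ k)" using k by (cases "sig p k") (auto simp: cnt_succ)
qed (simp_all add: cnt_zero)

lemma cnt_cong:
  assumes "m \<epsilon> omega" "\<And>k. k \<epsilon> m \<Longrightarrow> sig p k \<longleftrightarrow> sig p' k" shows "cnt p m = cnt p' m"
proof -
  have "(\<forall>k. k \<epsilon> m \<longrightarrow> sig p k = sig p' k) \<longrightarrow> cnt p m = cnt p' m"
    using assms(1)
  proof (rule omega_induct[where P="\<lambda>m. (\<forall>k. k \<epsilon> m \<longrightarrow> sig p k = sig p' k) \<longrightarrow> cnt p m = cnt p' m"])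
    show "dfn False (\<lambda>e. (\<forall>k. k \<epsilon> e 0 \<longrightarrow> sig p k = sig p' k) \<longrightarrow> cnt p (e 0) = cnt p' (e 0))"
      by (intro dfn_intros)
  qed (simp_all add: cnt_zero cnt_succ)
  then show ?thesis using assms(2) by blast
qed

text \<open>The least signal from round \<open>m\<close> on is taken; no signals lie between, so the
  count is unchanged. In the induction, indices below \<open>m\<close> satisfy the claim
  vacuously.\<close>

lemma next_signal:
  assumes inf: "\<And>m. m \<epsilon> omega \<Longrightarrow> \<exists>k. k \<epsilon> omega \<and> m \<epsilon> k \<and> sig h k" and m: "m \<epsilon> omega"
  shows "\<exists>k. k \<epsilon> omega \<and> sig h k \<and> cnt h k = cnt h m"
proof -
  obtain k where k: "k \<epsilon> omega" "m \<epsilon> k" "sig h k" using inf[OF m] by blast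
  then have *: "k \<epsilon> omega \<and> \<not> k \<epsilon> m \<and> sig h k" using mem_asym by blast
  have "dfn False (\<lambda>e. e 0 \<epsilon> omega \<and> \<not> e 0 \<epsilon> m \<and> sig h (e 0))" by (intro dfn_intros)
  from Ord_least[of k "\<lambda>k. k \<epsilon> omega \<and> \<not> k \<epsilon> m \<and> sig h k", OF omega_Ord[OF k(1)] this *]
  obtain n where n: "n \<epsilon> omega" "\<not> n \<epsilon> m" "sig h n"
    and least: "\<And>y. y \<epsilon> n \<Longrightarrow> \<not> (y \<epsilon> omega \<and> \<not> y \<epsilon> m \<and> sig h y)" by blast
  have "\<not> n \<epsilon> m \<longrightarrow> (\<forall>y. y \<epsilon> n \<longrightarrow> \<not> y \<epsilon> m \<longrightarrow> \<not> sig h y) \<longrightarrow> cnt h n = cnt h m"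
    using n(1)
  proof (rule omega_induct[where P="\<lambda>n. \<not> n \<epsilon> m \<longrightarrow> (\<forall>y. y \<epsilon> n \<longrightarrow> \<not> y \<epsilon> m \<longrightarrow> \<not> sig h y) \<longrightarrow> cnt h n = cnt h m"])
    show "dfn False (\<lambda>e. \<not> e 0 \<epsilon> m \<longrightarrow> (\<forall>y. y \<epsilon> e 0 \<longrightarrow> \<not> y \<epsilon> m \<longrightarrow> \<not> sig h y) \<longrightarrow>
      cnt h (e 0) = cnt h m)" by (intro dfn_intros)
    show "\<not> zero \<epsilon> m \<longrightarrow> (\<forall>y. y \<epsilon> zero \<longrightarrow> \<not> y \<epsilon> m \<longrightarrow> \<not> sig h y) \<longrightarrow> cnt h zero = cnt h m"
      using Ord_linear[OF Ord_zero omega_Ord[OF m]] by auto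
    fix j assume j: "j \<epsilon> omega"
      and IH: "\<not> j \<epsilon> m \<longrightarrow> (\<forall>y. y \<epsilon> j \<longrightarrow> \<not> y \<epsilon> m \<longrightarrow> \<not> sig h y) \<longrightarrow> cnt h j = cnt h m"
    show "\<not> succ j \<epsilon> m \<longrightarrow> (\<forall>y. y \<epsilon> succ j \<longrightarrow> \<not> y \<epsilon> m \<longrightarrow> \<not> sig h y) \<longrightarrow> cnt h (succ j) = cnt h m"
    proof (intro impI)
      assume a: "\<not> succ j \<epsilon> m" "\<forall>y. y \<epsilon> succ j \<longrightarrow> \<not> y \<epsilon> m \<longrightarrow> \<not> sig h y"
      show "cnt h (succ j) = cnt h m"
      proof (cases "j \<epsilon> m")
        case True
        have "succ j \<epsilon> succ m" using True succ_mem_succ[OF omega_Ord[OF m]] by simp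
        then have "succ j = m" using a(1) by simp
        then show ?thesis by simp
      next
        case False
        then show ?thesis using a(2) IH j by (simp add: cnt_succ)
      qed
    qed
  qed
  then show ?thesis using n least omega_trans[OF n(1)] by blast
qed

text \<open>Ensures that every bit of the guiding real is used as an answer at some time, so that
  the real can be recovered from the play.\<close>

lemma signals_onto:
  assumes inf: "\<And>m. m \<epsilon> omega \<Longrightarrow> \<exists>k. k \<epsilon> omega \<and> m \<epsilon> k \<and> sig h k" and n: "n \<epsilon> omega"
  shows "\<exists>k. k \<epsilon> omega \<and> sig h k \<and> cnt h k = n"
  using n
proof (rule omega_induct[where P="\<lambda>n. \<exists>k. k \<epsilon> omega \<and> sig h k \<and> cnt h k = n"])
  show "dfn False (\<lambda>e. \<exists>k. k \<epsilon> omega \<and> sig h k \<and> cnt h k = e 0)" by (intro dfn_intros)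
  show "\<exists>k. k \<epsilon> omega \<and> sig h k \<and> cnt h k = zero"
    using next_signal[OF inf zero_omega] by (simp add: cnt_zero)
  fix n assume "n \<epsilon> omega" "\<exists>k. k \<epsilon> omega \<and> sig h k \<and> cnt h k = n"
  then obtain k where k: "k \<epsilon> omega" "sig h k" "cnt h k = n" by blast
  have "succ k \<epsilon> omega" using k(1) by simp
  from next_signal[OF inf this] show "\<exists>k. k \<epsilon> omega \<and> sig h k \<and> cnt h k = succ n"
    using k by (simp add: cnt_succ)
qed

lemma sp_less: "m \<epsilon> omega \<Longrightarrow> k \<epsilon> m \<Longrightarrow> sp k \<epsilon> pos m"
  using Ord_trans[OF Ord_pos ans_less] by (simp add: ans_def sp_def)

text \<open>The signal of round \<open>m\<close> precedes the answer of that round, so it is visible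
  in the position at \<open>ans m\<close>; this is why the bound is \<open>succ m\<close>.\<close>

lemma sig_restr:
  assumes "m \<epsilon> omega" "k \<epsilon> succ m" shows "sig (restr h (ans m)) k \<longleftrightarrow> sig h k"
proof -
  have "sp k \<epsilon> ans m"
    using assms sp_less[OF assms(1), of k] by (auto simp: ans_def sp_def)
  then show ?thesis by (simp add: sig_def ap_restr)
qed

lemma cnt_restr: "m \<epsilon> omega \<Longrightarrow> cnt (restr h (ans m)) m = cnt h m"
  by (rule cnt_cong) (simp_all add: sig_restr)

section \<open>From a winning strategy for the last part to a continuous injection\<close>

text \<open>
  The second player answers the signals by the successive values of \<open>y\<close>. The first player's moves
  then depend continuously and injectively on \<open>y\<close>.
\<close>

lemma guided:
  assumes f0: "fun_into f0 len two" and leg: "legal \<sigma>"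
    and all: "\<And>h. tailplay f0 \<sigma> h \<Longrightarrow> won h"
  shows "\<exists>r. r \<epsilon> R \<and> cmap_inj r \<and> (\<forall>y. y \<epsilon> R \<longrightarrow>
    (\<exists>h. tailplay f0 \<sigma> h \<and> (\<forall>m. m \<epsilon> omega \<longrightarrow> ap (cmap r y) m = ap h (pos m))))"
proof -
  \<comment> \<open>Without a signal the second player's move is \<open>zero\<close>, so
    \<open>y\<close> influences the play only through answers to signals.\<close>
  define G where "G y a p = (if a \<epsilon> omega1 then ap f0 a else if first_turn a then ap \<sigma> p else
    if \<exists>m. m \<epsilon> omega \<and> a = ans m \<and> sig p m \<and> ap y (cnt p m) = one then one else zero)" for y a p
  have dG: "dft False (\<lambda>e. G (s e) (t e) (u e))" if "dft False s" "dft False t" "dft False u" for s t u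
    by (rule dft_sub3[where F=G, OF _ that], unfold G_def) (intro dfn_intros)
  have G2: "G y a p \<epsilon> two" if "a \<epsilon> len" for y a p
    using that f0 leg by (simp add: G_def fun_into_iff legal_def mem_two)
  define F where "F y = play (G y)" for y
  have dF: "dft False (\<lambda>e. F (s e))" if "dft False s" for s
  proof (rule dft_sub1[where F=F, OF _ that])
    have "dft False (\<lambda>e. G (e (Suc (Suc 0))) (e 0) (e (Suc 0)))" by (intro dG dfn_intros)
    then show "dft False (\<lambda>e. F (e 0))" unfolding F_def
      by (rule dft_play[where G="\<lambda>a p e. G (e 0) a p"])
  qed
  have dGy: "dft False (\<lambda>e. G y (e 0) (e (Suc 0)))" for y by (intro dG dfn_intros)
  have apF: "ap (F y) a = G y a (restr (F y) a)" if "a \<epsilon> len" for y a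
    unfolding F_def by (rule ap_play[OF dGy G2 that])
  have Finto: "fun_into (F y) len two" for y
    unfolding F_def by (rule play_into[OF dGy G2])
  have tail: "tailplay f0 \<sigma> (F y)" for y
    unfolding tailplay_def agree_def using Finto apF omega1_len by (simp add: G_def)
  have won: "won (F y)" for y by (rule all[OF tail])
  have inf: "\<exists>k. k \<epsilon> omega \<and> m \<epsilon> k \<and> sig (F y) k" if "m \<epsilon> omega" for m y
    using won[of y] that unfolding won_def by blast
  have rule: "ap (F y) (pos (succ m)) = ap (F y) (ans m)" if "m \<epsilon> omega" "sig (F y) m" for m y
    using won[of y] that unfolding won_def by blast
  have Fans: "ap (F y) (ans m) = (if sig (F y) m \<and> ap y (cnt (F y) m) = one then one else zero)"
    if m: "m \<epsilon> omega" for y m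
  proof -
    have "(\<exists>k. k \<epsilon> omega \<and> ans m = ans k \<and> sig (restr (F y) (ans m)) k \<and>
        ap y (cnt (restr (F y) (ans m)) k) = one) \<longleftrightarrow> sig (F y) m \<and> ap y (cnt (F y) m) = one"
      (is "?l \<longleftrightarrow> ?r")
    proof
      assume ?l
      then obtain k where k: "k \<epsilon> omega" "ans m = ans k" "sig (restr (F y) (ans m)) k"
        "ap y (cnt (restr (F y) (ans m)) k) = one" by blast
      have "k = m" using ans_inj[OF m k(1)] k(2) by simp
      then show ?r using k(3,4) sig_restr[OF m, of m] cnt_restr[OF m] by simp
    next
      assume ?r
      then show ?l using m sig_restr[OF m, of m] cnt_restr[OF m] by (intro exI[of _ m]) simp
    qed
    then show ?thesis
      unfolding apF[OF in_len(3)[OF m]] unfolding G_def using turn_pos(3)[OF m] not_in_omega1(3)[OF m] by simp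
  qed
  \<comment> \<open>Two such plays can part for the first time only at an answer to a signal, all
    other moves being determined by the position. There the counts agree, so the same bit of
    \<open>y\<close> and of \<open>z\<close> is consulted.\<close>
  have step: "ap (F y) a = ap (F z) a"
    if a: "a \<epsilon> len" and IH: "\<And>x. x \<epsilon> a \<Longrightarrow> ap (F y) x = ap (F z) x"
      and S: "\<And>m. m \<epsilon> omega \<Longrightarrow> a = ans m \<Longrightarrow> sig (F y) m \<Longrightarrow> sig (F z) m \<Longrightarrow>
        cnt (F y) m = cnt (F z) m \<Longrightarrow> ap y (cnt (F y) m) = one \<longleftrightarrow> ap z (cnt (F z) m) = one"
    for a y z
  proof -
    have r: "restr (F y) a = restr (F z) a" by (rule restr_eq_len[OF Finto Finto a IH])
    show ?thesis
    proof (cases "\<exists>m. m \<epsilon> omega \<and> a = ans m")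
      case True
      then obtain m where m: "m \<epsilon> omega" "a = ans m" by blast
      have "sig (F y) m \<longleftrightarrow> sig (F z) m" "cnt (F y) m = cnt (F z) m"
        using r sig_restr[OF m(1), of m] cnt_restr[OF m(1)] m(2) by (metis mem_succ)+
      then show ?thesis using S[OF m] unfolding m(2) Fans[OF m(1)] by auto
    next
      case False
      then show ?thesis unfolding apF[OF a] r unfolding G_def by auto
    qed
  qed
  \<comment> \<open>Continuity with a modulus: up to and including \<open>pos m\<close>, only bits
    with index below \<open>m\<close> have been consulted.\<close>
  have lip: "ap (F y) a = ap (F z) a"
    if m: "m \<epsilon> omega" and eq: "\<And>i. i \<epsilon> m \<Longrightarrow> ap y i = ap z i" and a: "a \<epsilon> succ (pos m)" for y z m a
  proof -
    have om: "Ord (succ (pos m))" using Ord_pos[OF m] by simp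
    have "a \<epsilon> succ (pos m) \<longrightarrow> ap (F y) a = ap (F z) a"
      using Ord_in[OF om a]
    proof (rule Ord_induct[where P="\<lambda>a. a \<epsilon> succ (pos m) \<longrightarrow> ap (F y) a = ap (F z) a"])
      show "dfn False (\<lambda>e. e 0 \<epsilon> succ (pos m) \<longrightarrow> ap (F y) (e 0) = ap (F z) (e 0))" by (intro dfn_intros)
      fix a assume IH: "\<And>x. x \<epsilon> a \<Longrightarrow> x \<epsilon> succ (pos m) \<longrightarrow> ap (F y) x = ap (F z) x"
      show "a \<epsilon> succ (pos m) \<longrightarrow> ap (F y) a = ap (F z) a"
      proof
        assume a: "a \<epsilon> succ (pos m)"
        show "ap (F y) a = ap (F z) a"
        proof (rule step)
          show "a \<epsilon> len" using a in_len(1)[OF m] Ord_trans[OF Ord_len] by auto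
          show "ap (F y) x = ap (F z) x" if "x \<epsilon> a" for x using IH that Ord_trans[OF om a that] by blast
          fix j assume j: "j \<epsilon> omega" "a = ans j" "cnt (F y) j = cnt (F z) j"
          have jm: "j \<epsilon> m" by (rule ans_less_iff[OF m j(1)]) (use a j(2) in simp)
          have "cnt (F y) j \<epsilon> m"
            using cnt_le[OF j(1), of "F y"] jm Ord_trans[OF omega_Ord[OF m] jm] by auto
          then show "ap y (cnt (F y) j) = one \<longleftrightarrow> ap z (cnt (F z) j) = one" using eq j(3) by simp
        qed
      qed
    qed
    then show ?thesis using a by blast
  qed
  \<comment> \<open>Each signalled answer reappears as the bit of the next round, because the plays
    are won. Hence equal bits of the first player force equal answers, thus equal plays, and these
    contain all bits of \<open>y\<close> and \<open>z\<close>.\<close>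
  have inj: "y = z" if yz: "y \<epsilon> R" "z \<epsilon> R" and eq: "\<And>m. m \<epsilon> omega \<Longrightarrow> ap (F y) (pos m) = ap (F z) (pos m)" for y z
  proof -
    have all: "ap (F y) a = ap (F z) a" if a: "a \<epsilon> len" for a
    proof (rule len_induct[where P="\<lambda>a. ap (F y) a = ap (F z) a", OF _ _ a])
      show "dfn False (\<lambda>e. ap (F y) (e 0) = ap (F z) (e 0))" by (intro dfn_intros dF)
      fix a assume a: "a \<epsilon> len" and IH: "\<And>x. x \<epsilon> a \<Longrightarrow> ap (F y) x = ap (F z) x"
      show "ap (F y) a = ap (F z) a"
      proof (rule step[OF a IH])
        fix m assume m: "m \<epsilon> omega" and s: "sig (F y) m" "sig (F z) m"
        have "ap (F y) (ans m) = ap (F z) (ans m)"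
          using rule[OF m s(1)] rule[OF m s(2)] eq[of "succ m"] m by simp
        then show "ap y (cnt (F y) m) = one \<longleftrightarrow> ap z (cnt (F z) m) = one"
          using s unfolding Fans[OF m] by (auto split: if_splits)
      qed
    qed
    have sig: "sig (F y) k \<longleftrightarrow> sig (F z) k" if "k \<epsilon> omega" for k
      unfolding sig_def using all[OF in_len(2)[OF that]] by simp
    show "y = z"
    proof (rule R_ext[OF yz])
      fix n assume n: "n \<epsilon> omega"
      obtain k where k: "k \<epsilon> omega" "sig (F y) k" "cnt (F y) k = n" using signals_onto[OF inf n] by blast
      have "cnt (F z) k = n" using k(3) cnt_cong[OF k(1), of "F y" "F z"] sig omega_trans[OF k(1)] by simp
      then have "ap y n = one \<longleftrightarrow> ap z n = one"
        using all[OF in_len(3)[OF k(1)]] k sig[OF k(1)] unfolding Fans[OF k(1)] by (auto split: if_splits)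
      then show "ap y n = ap z n" using R_ap[OF yz(1) n] R_ap[OF yz(2) n] by auto
    qed
  qed
  \<comment> \<open>The label of a finite sequence is the bit at \<open>pos m\<close> in the play
    guided by any real that extends it; by \<open>lip\<close> all extensions give the same
    bit.\<close>
  define E where "E k = (if \<exists>y m. y \<epsilon> R \<and> m \<epsilon> omega \<and> code y m = k \<and> ap (F y) (pos m) = one then one else zero)" for k
  have dE: "dft False (\<lambda>e. E (e 0))" unfolding E_def by (intro dfn_intros dF)
  define r where "r = Lam omega E"
  have r: "r \<epsilon> R" unfolding r_def by (rule Lam_R[OF dE]) (simp add: E_def mem_two)
  have cm: "ap (cmap r y) m = ap (F y) (pos m)" if y: "y \<epsilon> R" and m: "m \<epsilon> omega" for y m
  proof -
    have "(\<exists>z n. z \<epsilon> R \<and> n \<epsilon> omega \<and> code z n = code y m \<and> ap (F z) (pos n) = one) \<longleftrightarrow>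
      ap (F y) (pos m) = one"
    proof
      assume "\<exists>z n. z \<epsilon> R \<and> n \<epsilon> omega \<and> code z n = code y m \<and> ap (F z) (pos n) = one"
      then obtain z n where z: "z \<epsilon> R" "n \<epsilon> omega" "code z n = code y m" "ap (F z) (pos n) = one" by blast
      have zn: "n = m \<and> (\<forall>i. i \<epsilon> n \<longrightarrow> ap z i = ap y i)" by (rule code_inj[OF z(1) y z(2) m z(3)])
      have "ap (F z) (pos m) = ap (F y) (pos m)" by (rule lip[OF m]) (use zn in auto)
      then show "ap (F y) (pos m) = one" using z(4) zn by simp
    qed (use y m in blast)
    moreover have "ap (cmap r y) m = E (code y m)"
      unfolding ap_cmap[OF m] r_def by (rule ap_Lam[OF dE]) (use code_omega[OF m] in blast)
    moreover have "ap (F y) (pos m) = zero \<or> ap (F y) (pos m) = one"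
      using Finto in_len(1)[OF m] by (simp add: fun_into_iff mem_two)
    ultimately show ?thesis by (auto simp: E_def)
  qed
  have "cmap_inj r" unfolding cmap_inj_def
  proof (intro allI impI)
    fix y z assume yz: "y \<epsilon> R" "z \<epsilon> R" and eq: "cmap r y = cmap r z"
    show "y = z" by (rule inj[OF yz]) (use cm yz eq in metis)
  qed
  then show ?thesis using r cm tail by blast
qed

section \<open>From a strategy of the second player to a numbering of the family\<close>

text \<open>
  The first player makes the moves of \<open>X\<^sub>l\<close> and signals whenever the answer is the one he needs.
  From some point on this never happens, so that \<open>X\<^sub>l\<close> can be computed from the play up to there.
\<close>

lemma greedy:
  assumes f0: "fun_into f0 len two" and leg: "legal \<tau>" and X: "fun_into X L R"
    and tr: "\<And>l m. l \<epsilon> L \<Longrightarrow> m \<epsilon> omega \<Longrightarrow> ap f0 (l \<oplus> dbl (dbl m)) = ap (ap X l) m"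
    and lose: "\<And>h. fun_into h len two \<Longrightarrow> agree f0 h \<Longrightarrow>
      (\<And>a. a \<epsilon> len \<Longrightarrow> \<not> a \<epsilon> omega1 \<Longrightarrow> \<not> first_turn a \<Longrightarrow> ap h a = ap \<tau> (restr h a)) \<Longrightarrow> \<not> won h"
  shows "\<exists>c. fun_into c L omega \<and>
    (\<forall>k l. k \<epsilon> L \<longrightarrow> l \<epsilon> L \<longrightarrow> ap c k = ap c l \<longrightarrow> ap X k = ap X l)"
proof -
  have XR: "ap X l \<epsilon> R" if "l \<epsilon> L" for l using X that by (simp add: fun_into_iff)
  \<comment> \<open>The answer to a signal must be known before the signal is given:
    \<open>ext p a\<close> is the position \<open>p\<close>, of length \<open>a\<close>, prolonged
    by the move \<open>one\<close>.\<close>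
  define ext where "ext p a = Lam (succ a) (\<lambda>x. if x \<epsilon> a then ap p x else one)" for p a
  have dext: "dft False (\<lambda>e. ext (s e) (t e))" if "dft False s" "dft False t" for s t
    by (rule dft_sub2[where F=ext, OF _ that], unfold ext_def) (intro dfn_intros)
  have ext: "restr h (succ a) = ext (restr h a) a"
    if h: "fun_into h len two" "succ a \<epsilon> len" "ap h a = one" for h a
  proof -
    have d: "dft False (\<lambda>e. if e 0 \<epsilon> a then ap (restr h a) (e 0) else one)" by (intro dfn_intros)
    show ?thesis unfolding ext_def
    proof (rule fun_ext[OF _ fun_on_Lam[OF d]])
      show "fun_on (restr h (succ a)) (succ a)"
        using fun_on_restr[OF _ subset_len[OF h(2)]] h(1) by (simp add: fun_into_iff)
      fix x assume x: "x \<epsilon> succ a"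
      show "ap (restr h (succ a)) x = ap (Lam (succ a) (\<lambda>x. if x \<epsilon> a then ap (restr h a) x else one)) x"
        unfolding ap_Lam[OF d x] using x h(3) by (auto simp: ap_restr)
    qed
  qed
  \<comment> \<open>The answer of round \<open>m\<close> binds the next bit, so it is compared with
    bit \<open>succ m\<close>.\<close>
  define G where "G l a p = (if a \<epsilon> omega1 then ap f0 a else if first_turn a then
    (if \<exists>m. m \<epsilon> omega \<and> (a = pos m \<and> ap (ap X l) m = one \<or>
        a = sp m \<and> ap \<tau> (ext p a) = ap (ap X l) (succ m)) then one else zero)
    else ap \<tau> p)" for l a p
  have dG: "dft False (\<lambda>e. G (s e) (t e) (u e))" if "dft False s" "dft False t" "dft False u" for s t u
    by (rule dft_sub3[where F=G, OF _ that], unfold G_def) (intro dfn_intros dext)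
  have G2: "G l a p \<epsilon> two" if "a \<epsilon> len" for l a p
    using that f0 leg by (simp add: G_def fun_into_iff legal_def mem_two)
  define F where "F l = play (G l)" for l
  have dF: "dft False (\<lambda>e. F (s e))" if "dft False s" for s
  proof (rule dft_sub1[where F=F, OF _ that])
    have "dft False (\<lambda>e. G (e (Suc (Suc 0))) (e 0) (e (Suc 0)))" by (intro dG dfn_intros)
    then show "dft False (\<lambda>e. F (e 0))" unfolding F_def
      by (rule dft_play[where G="\<lambda>a p e. G (e 0) a p"])
  qed
  have dGl: "dft False (\<lambda>e. G l (e 0) (e (Suc 0)))" for l by (intro dG dfn_intros)
  have apF: "ap (F l) a = G l a (restr (F l) a)" if "a \<epsilon> len" for l a
    unfolding F_def by (rule ap_play[OF dGl G2 that])
  have Finto: "fun_into (F l) len two" for l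
    unfolding F_def by (rule play_into[OF dGl G2])
  have Ftwo: "ap (F l) a = zero \<or> ap (F l) a = one" if "a \<epsilon> len" for l a
    using Finto that by (simp add: fun_into_iff mem_two)
  have F0: "ap (F l) a = ap f0 a" if "a \<epsilon> omega1" for l a
    unfolding apF[OF omega1_len[OF that]] using that by (simp add: G_def)
  have Fsecond: "ap (F l) a = ap \<tau> (restr (F l) a)"
    if "a \<epsilon> len" "\<not> a \<epsilon> omega1" "\<not> first_turn a" for l a
    unfolding apF[OF that(1)] using that by (simp add: G_def)
  have Fpos: "ap (F l) (pos m) = ap (ap X l) m" if l: "l \<epsilon> L" and m: "m \<epsilon> omega" for l m
  proof -
    have "(\<exists>k. k \<epsilon> omega \<and> (pos m = pos k \<and> ap (ap X l) k = one \<or>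
        pos m = sp k \<and> P k)) \<longleftrightarrow> ap (ap X l) m = one" for P
      using m pos_inj[OF m] pos_neq[OF m] by auto
    then have "ap (F l) (pos m) = (if ap (ap X l) m = one then one else zero)"
      unfolding apF[OF in_len(1)[OF m]] unfolding G_def
      using turn_pos(1)[OF m] not_in_omega1(1)[OF m] by simp
    then show ?thesis using R_ap[OF XR[OF l] m] by auto
  qed
  have Fsig: "sig (F l) m \<longleftrightarrow> ap \<tau> (ext (restr (F l) (sp m)) (sp m)) = ap (ap X l) (succ m)"
    if m: "m \<epsilon> omega" for l m
  proof -
    have inj: "sp m = sp k \<longleftrightarrow> m = k" if "k \<epsilon> omega" for k using m that by (simp add: sp_def pos_inj)
    have "(\<exists>k. k \<epsilon> omega \<and> (sp m = pos k \<and> Q k \<or> sp m = sp k \<and> P k)) \<longleftrightarrow> P m" for P Q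
      using m inj pos_neq[OF _ m] by metis
    then have "ap (F l) (sp m) = (if ap \<tau> (ext (restr (F l) (sp m)) (sp m)) = ap (ap X l) (succ m)
        then one else zero)"
      unfolding apF[OF in_len(2)[OF m]] unfolding G_def
      using turn_pos(2)[OF m] not_in_omega1(2)[OF m] by simp
    then show ?thesis unfolding sig_def by simp
  qed
  \<comment> \<open>With signals in arbitrarily late rounds the play would be won, since each signal
    was given only when the answer would be correct.\<close>
  have fin: "\<exists>n. n \<epsilon> omega \<and> (\<forall>k. k \<epsilon> omega \<longrightarrow> n \<epsilon> k \<longrightarrow> \<not> sig (F l) k)" if l: "l \<epsilon> L" for l
  proof (rule ccontr)
    assume n: "\<not> ?thesis"
    have "won (F l)" unfolding won_def
    proof (intro conjI allI impI)
      have "ap (F l) (l \<oplus> dbl (dbl m)) = ap (F l) (pos m)" if m: "m \<epsilon> omega" for m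
      proof -
        have "l \<oplus> dbl (dbl m) \<epsilon> omega1"
          using l m Limit_pl[OF Limit_omega1] by (simp add: mem_L)
        then show ?thesis using F0 tr[OF l m] Fpos[OF l m] by simp
      qed
      then show "\<exists>l'. l' \<epsilon> L \<and> (\<forall>m. m \<epsilon> omega \<longrightarrow> ap (F l) (l' \<oplus> dbl (dbl m)) = ap (F l) (pos m))"
        using l by blast
      show "\<exists>k. k \<epsilon> omega \<and> m \<epsilon> k \<and> sig (F l) k" if "m \<epsilon> omega" for m
        using n that by blast
      fix m assume m: "m \<epsilon> omega" and s: "sig (F l) m"
      have e: "ans m = succ (sp m)" by (simp add: ans_def sp_def)
      have "ap (F l) (ans m) = ap \<tau> (restr (F l) (ans m))"
        by (rule Fsecond[OF in_len(3)[OF m] not_in_omega1(3)[OF m] turn_pos(3)[OF m]])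
      also have "restr (F l) (ans m) = ext (restr (F l) (sp m)) (sp m)"
        unfolding e by (rule ext[OF Finto]) (use in_len(3)[OF m] s in \<open>simp_all add: e sig_def\<close>)
      also have "ap \<tau> \<dots> = ap (ap X l) (succ m)" using Fsig[OF m] s by blast
      also have "\<dots> = ap (F l) (pos (succ m))" using Fpos[OF l, of "succ m"] m by simp
      finally show "ap (F l) (pos (succ m)) = ap (F l) (ans m)" by simp
    qed
    moreover have "agree f0 (F l)" using F0 by (simp add: agree_def)
    ultimately show False using lose[OF Finto _ Fsecond] by blast
  qed
  define N where "N l = ord_least (\<lambda>n. n \<epsilon> omega \<and> (\<forall>k. k \<epsilon> omega \<longrightarrow> n \<epsilon> k \<longrightarrow> \<not> sig (F l) k))" for l
  have N: "N l \<epsilon> omega \<and> (\<forall>k. k \<epsilon> omega \<longrightarrow> N l \<epsilon> k \<longrightarrow> \<not> sig (F l) k)" if l: "l \<epsilon> L" for l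
  proof -
    let ?Q = "\<lambda>n. n \<epsilon> omega \<and> (\<forall>k. k \<epsilon> omega \<longrightarrow> n \<epsilon> k \<longrightarrow> \<not> sig (F l) k)"
    obtain n where n: "?Q n" using fin[OF l] by blast
    have "dfn False (\<lambda>e. ?Q (e 0))" by (intro dfn_intros)
    from ord_least[of n ?Q, OF omega_Ord this n] n show ?thesis unfolding N_def by blast
  qed
  define g where "g l = Lam omega (\<lambda>n. ap (F l) (omega1 \<oplus> n))" for l
  have dg: "dft False (\<lambda>e. ap (F l) (omega1 \<oplus> e 0))" for l by (intro dfn_intros)
  have gR: "g l \<epsilon> R" for l unfolding g_def
    by (rule Lam_R[OF dg]) (use Finto in \<open>auto simp: fun_into_iff mem_len\<close>)
  have apg: "ap (g l) n = ap (F l) (omega1 \<oplus> n)" if "n \<epsilon> omega" for l n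
    unfolding g_def by (rule ap_Lam[OF dg that])
  \<comment> \<open>The length is 4(n+1)+1 for n = \<open>N l\<close>, so the coded moves reach up
    to and including \<open>pos (succ (N l))\<close>. The code also determines the length, hence
    \<open>N l\<close>.\<close>
  define c where "c l = code (g l) (succ (dbl (dbl (succ (N l)))))" for l
  have dc: "dft False (\<lambda>e. c (e 0))" unfolding c_def g_def N_def
    by (intro dfn_intros dF)
  have o: "succ (dbl (dbl (succ (N l)))) \<epsilon> omega" if "l \<epsilon> L" for l
    using N[OF that] by (simp del: dbl_succ)
  have eqX: "ap X k = ap X l" if k: "k \<epsilon> L" and l: "l \<epsilon> L" and eq: "c k = c l" for k l
  proof -
    define M where "M = succ (N k)"
    have ci: "succ (dbl (dbl (succ (N k)))) = succ (dbl (dbl (succ (N l)))) \<and>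
        (\<forall>i. i \<epsilon> succ (dbl (dbl (succ (N k)))) \<longrightarrow> ap (g k) i = ap (g l) i)"
      by (rule code_inj[OF gR gR o[OF k] o[OF l]]) (use eq in \<open>simp add: c_def\<close>)
    have Nl: "N l = N k" using ci dbl_inj N[OF k] N[OF l] by (simp del: dbl_succ)
    have M: "M \<epsilon> omega" using N[OF k] by (simp add: M_def)
    have nosig: "\<not> sig (F k) i \<and> \<not> sig (F l) i" if i: "i \<epsilon> omega" "\<not> i \<epsilon> M" for i
    proof -
      have "N k \<epsilon> i" using Ord_linear[OF omega_Ord[OF i(1)] omega_Ord[of "N k"]] i N[OF k]
        by (auto simp: M_def)
      then show ?thesis using N[OF k] N[OF l] Nl i(1) by simp
    qed
    have upto: "ap (F k) a = ap (F l) a" if a: "a \<epsilon> succ (pos M)" for a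
    proof (cases "a \<epsilon> omega1")
      case False
      have "a \<epsilon> omega1 \<oplus> succ (dbl (dbl M))" using a M by (simp add: pos_def)
      then obtain i where i: "i \<epsilon> succ (dbl (dbl M))" "a = omega1 \<oplus> i"
        using False M mem_pl[of "succ (dbl (dbl M))"] omega_Ord by auto
      then have "i \<epsilon> omega" using omega_trans[of "succ (dbl (dbl M))"] M by simp
      moreover have "ap (g k) i = ap (g l) i" using conjunct2[OF ci] i(1) unfolding M_def by blast
      ultimately show ?thesis using i(2) apg by simp
    qed (simp add: F0)
    \<comment> \<open>Beyond \<open>pos M\<close> there are three kinds of moves: the second
      player's, given by \<open>\<tau>\<close> from equal positions; decisions about signals, which
      are all negative; and bits, forced by the absence of a signal in the preceding round.\<close>
    have all: "ap (F k) a = ap (F l) a" if a: "a \<epsilon> len" for a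
    proof (rule len_induct[where P="\<lambda>a. ap (F k) a = ap (F l) a", OF _ _ a])
      show "dfn False (\<lambda>e. ap (F k) (e 0) = ap (F l) (e 0))" by (intro dfn_intros dF)
      fix a assume a: "a \<epsilon> len" and IH: "\<And>x. x \<epsilon> a \<Longrightarrow> ap (F k) x = ap (F l) x"
      have r: "restr (F k) a = restr (F l) a" by (rule restr_eq_len[OF Finto Finto a IH])
      consider "a \<epsilon> omega1" | "a \<epsilon> succ (pos M)" | "\<not> a \<epsilon> omega1" "\<not> first_turn a"
        | "\<not> a \<epsilon> omega1" "\<not> a \<epsilon> succ (pos M)" "first_turn a" by blast
      then show "ap (F k) a = ap (F l) a"
      proof cases
        case 3
        then show ?thesis using Fsecond[OF a] r by simp
      next
        case 4
        from a 4(1) show ?thesis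
        proof (cases rule: len_cases)
          case (1 j)
          have "j \<noteq> zero" "j \<noteq> M" "\<not> j \<epsilon> M"
          proof -
            show nM: "j \<noteq> M" using 1 4(2) by auto
            show njM: "\<not> j \<epsilon> M"
            proof
              assume "j \<epsilon> M"
              then have "ans j \<epsilon> pos M" by (rule ans_less[OF M])
              then have "pos j \<epsilon> pos M"
                using Ord_trans[OF Ord_pos[OF M], of "ans j" "pos j"] by (simp add: ans_def)
              then show False using 1 4(2) by simp
            qed
            show "j \<noteq> zero"
              using Ord_linear[OF Ord_zero omega_Ord[OF M]] nM njM by auto
          qed
          then obtain i where i: "i \<epsilon> omega" "j = succ i" using omega_cases 1(1) by blast
          have "\<not> i \<epsilon> M"
          proof
            assume "i \<epsilon> M"
            then have "succ i \<epsilon> succ M" using succ_mem_succ omega_Ord[OF M] by blast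
            then show False using i(2) \<open>j \<noteq> M\<close> \<open>\<not> j \<epsilon> M\<close> by simp
          qed
          then have ns: "\<not> sig (F k) i" "\<not> sig (F l) i" using nosig i(1) by blast+
          \<comment> \<open>Since no signal is given in round \<open>i\<close>, bit
            \<open>succ i\<close> of both reals differs from the answer that a signal would have
            received. Equal positions make this answer the same for both, and with only two values
            the bits coincide.\<close>
          have "restr (F k) (sp i) = restr (F l) (sp i)"
          proof (rule restr_eq_len[OF Finto Finto in_len(2)[OF i(1)]])
            fix x assume "x \<epsilon> sp i"
            moreover have "sp i \<epsilon> a" using sp_less[OF 1(1), of i] 1 i by simp
            ultimately show "ap (F k) x = ap (F l) x"
              using IH Ord_trans[OF Ord_in[OF Ord_len a]] by blast
          qed
          then have "ap (ap X k) j \<noteq> v" "ap (ap X l) j \<noteq> v"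
            if "v = ap \<tau> (ext (restr (F k) (sp i)) (sp i))" for v
            using ns Fsig[OF i(1)] i(2) that by auto
          moreover have "ap \<tau> (ext (restr (F k) (sp i)) (sp i)) \<epsilon> two" using leg by (simp add: legal_def)
          ultimately have "ap (ap X k) j = ap (ap X l) j"
            using R_ap[OF XR[OF k] 1(1)] R_ap[OF XR[OF l] 1(1)] by (auto simp: mem_two)
          then show ?thesis using Fpos[OF k 1(1)] Fpos[OF l 1(1)] 1(2) by simp
        next
          case (2 j)
          then show ?thesis using 4(3) turn_pos(4) by blast
        next
          case (3 j)
          have "\<not> j \<epsilon> M"
          proof
            assume "j \<epsilon> M"
            then have "sp j \<epsilon> pos M" by (rule sp_less[OF M])
            then show False using 3 4(2) by simp
          qed
          then have "\<not> sig (F k) j" "\<not> sig (F l) j" using nosig 3(1) by blast+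
          then show ?thesis using Ftwo[OF a, of k] Ftwo[OF a, of l] 3(2) by (auto simp: sig_def)
        next
          case (4 j)
          then show ?thesis using \<open>first_turn a\<close> turn_pos(3) by blast
        qed
      qed (simp_all add: F0 upto)
    qed
    show ?thesis
    proof (rule R_ext[OF XR[OF k] XR[OF l]])
      fix n assume n: "n \<epsilon> omega"
      show "ap (ap X k) n = ap (ap X l) n"
        using all[OF in_len(1)[OF n]] Fpos[OF k n] Fpos[OF l n] by simp
    qed
  qed
  have "fun_into (Lam L c) L omega"
    by (rule fun_into_Lam[OF dc]) (use code_omega[OF o] in \<open>simp add: c_def\<close>)
  moreover have "ap X k = ap X l" if "k \<epsilon> L" "l \<epsilon> L" "ap (Lam L c) k = ap (Lam L c) l" for k l
    by (rule eqX[OF that(1,2)]) (use that(3) in \<open>simp only: ap_Lam[OF dc that(1)] ap_Lam[OF dc that(2)]\<close>)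
  ultimately show ?thesis by blast
qed

section \<open>Refuting the second player and conclusion\<close>

lemma second_not_winning: "\<not> second_wins_by len two payoff \<tau>"
proof
  assume "second_wins_by len two payoff \<tau>"
  then have st: "strategy second_turn len two \<tau>"
    and win: "\<And>f. fun_into f len two \<Longrightarrow> follows second_turn len f \<tau> \<Longrightarrow> \<not> f \<epsilon> payoff"
    unfolding second_wins_by_def by blast+
  have dT: "dfn False (\<lambda>e. second_turn (e 0))" by (intro dfn_intros)
  have leg: "legal \<tau>" by (rule strategy_legal[OF st])
  obtain X where X: "fun_into X L R"
    and Xunc: "\<And>c. fun_into c L omega \<Longrightarrow>
      \<exists>k l. k \<epsilon> L \<and> l \<epsilon> L \<and> ap c k = ap c l \<and> ap X k \<noteq> ap X l"
    and Xb: "\<And>r. r \<epsilon> R \<Longrightarrow> cmap_inj r \<Longrightarrow> \<exists>y. y \<epsilon> R \<and> (\<forall>l. l \<epsilon> L \<longrightarrow> ap X l \<noteq> cmap r y)"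
    using bernstein by blast
  have XR: "ap X l \<epsilon> R" if "l \<epsilon> L" for l using X that by (simp add: fun_into_iff)
  \<comment> \<open>The first player writes \<open>X\<close> into the play, bit \<open>m\<close> of
    \<open>ap X l\<close> at index l+4m, while the second player follows
    \<open>\<tau>\<close>.\<close>
  define G where "G a p = (if first_turn a then
    (if \<exists>l m. l \<epsilon> L \<and> m \<epsilon> omega \<and> a = l \<oplus> dbl (dbl m) \<and> ap (ap X l) m = one then one else zero)
    else ap \<tau> p)" for a p
  have G: "dft False (\<lambda>e. G (e 0) (e (Suc 0)))" unfolding G_def by (intro dfn_intros)
  have G2: "G a p \<epsilon> two" for a p using leg by (simp add: G_def legal_def mem_two)
  define f0 where "f0 = play G"
  have f0: "fun_into f0 len two" unfolding f0_def by (rule play_into[OF G G2])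
  have apf0: "ap f0 a = G a (restr f0 a)" if "a \<epsilon> len" for a
    unfolding f0_def by (rule ap_play[OF G G2 that])
  have in1: "l \<oplus> dbl (dbl m) \<epsilon> omega1" if "l \<epsilon> L" "m \<epsilon> omega" for l m
    using that Limit_pl[OF Limit_omega1] by (simp add: mem_L)
  have tr: "ap f0 (l \<oplus> dbl (dbl m)) = ap (ap X l) m" if l: "l \<epsilon> L" and m: "m \<epsilon> omega" for l m
  proof -
    have lz: "LZ l" using l by (simp add: mem_L)
    have "first_turn (l \<oplus> dbl (dbl m))"
      unfolding first_turn_iff[OF lz dbl_omega[OF dbl_omega[OF m]]] using m dbl_omega by blast
    moreover have "(\<exists>k n. k \<epsilon> L \<and> n \<epsilon> omega \<and> l \<oplus> dbl (dbl m) = k \<oplus> dbl (dbl n) \<and> ap (ap X k) n = one)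
      \<longleftrightarrow> ap (ap X l) m = one"
    proof
      assume "\<exists>k n. k \<epsilon> L \<and> n \<epsilon> omega \<and> l \<oplus> dbl (dbl m) = k \<oplus> dbl (dbl n) \<and> ap (ap X k) n = one"
      then obtain k n where kn: "k \<epsilon> L" "n \<epsilon> omega" "l \<oplus> dbl (dbl m) = k \<oplus> dbl (dbl n)"
        "ap (ap X k) n = one" by blast
      have "LZ k" using kn(1) by (simp add: mem_L)
      from Ord_decomp_unique[OF lz this _ _ kn(3)] have "l = k" "dbl (dbl m) = dbl (dbl n)"
        using m kn(2) by simp_all
      then show "ap (ap X l) m = one" using kn(4) m kn(2) dbl_inj by simp
    qed (use l m in blast)
    ultimately have "ap f0 (l \<oplus> dbl (dbl m)) = (if ap (ap X l) m = one then one else zero)"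
      unfolding apf0[OF omega1_len[OF in1[OF l m]]] by (simp add: G_def)
    then show ?thesis using R_ap[OF XR[OF l] m] by auto
  qed
  \<comment> \<open>Otherwise \<open>guided\<close> provides an injective \<open>cmap r\<close>
    whose values are bit sequences of won plays, hence members of the coded family; \<open>X\<close>
    was chosen to exclude this.\<close>
  have safe: "safe f0"
  proof (rule ccontr)
    assume "\<not> safe f0"
    then obtain \<sigma> where leg': "legal \<sigma>" and all: "\<And>h. tailplay f0 \<sigma> h \<Longrightarrow> won h"
      unfolding safe_def by blast
    obtain r where r: "r \<epsilon> R" "cmap_inj r"
      and h: "\<And>y. y \<epsilon> R \<Longrightarrow> \<exists>h. tailplay f0 \<sigma> h \<and> (\<forall>m. m \<epsilon> omega \<longrightarrow> ap (cmap r y) m = ap h (pos m))"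
      using guided[OF f0 leg' all] by blast
    obtain y where y: "y \<epsilon> R" "\<And>l. l \<epsilon> L \<Longrightarrow> ap X l \<noteq> cmap r y" using Xb[OF r] by blast
    obtain h where h: "tailplay f0 \<sigma> h" "\<And>m. m \<epsilon> omega \<Longrightarrow> ap (cmap r y) m = ap h (pos m)"
      using h[OF y(1)] by blast
    obtain l where l: "l \<epsilon> L" "\<And>m. m \<epsilon> omega \<Longrightarrow> ap h (l \<oplus> dbl (dbl m)) = ap h (pos m)"
      using all[OF h(1)] unfolding won_def by blast
    have ag: "ap h a = ap f0 a" if "a \<epsilon> omega1" for a
      using h(1) that unfolding tailplay_def agree_def by blast
    have "ap X l = cmap r y"
    proof (rule R_ext[OF XR[OF l(1)] cmap_R[OF r(1)]])
      fix m assume m: "m \<epsilon> omega"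
      show "ap (ap X l) m = ap (cmap r y) m"
        using tr[OF l(1) m] ag[OF in1[OF l(1) m]] l(2)[OF m] h(2)[OF m] by simp
    qed
    then show False using y(2) l(1) by blast
  qed
  \<comment> \<open>A continuation of the first \<open>omega1\<close> moves of \<open>f0\<close>
    that obeys \<open>\<tau>\<close> from then on obeys it throughout, so it is outside the payoff
    set. Being safe, it can only fail to be won.\<close>
  have "\<not> won h" if h: "fun_into h len two" "agree f0 h"
    and tl: "\<And>a. a \<epsilon> len \<Longrightarrow> \<not> a \<epsilon> omega1 \<Longrightarrow> \<not> first_turn a \<Longrightarrow> ap h a = ap \<tau> (restr h a)" for h
  proof -
    have "ap h a = ap \<tau> (restr h a)" if a: "a \<epsilon> len" "second_turn a" for a
    proof (cases "a \<epsilon> omega1")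
      case True
      have "restr h a = restr f0 a"
        by (rule restr_eq_len[OF h(1) f0 a(1)])
          (use h(2) Ord_trans[OF Ord_omega1 True] in \<open>auto simp: agree_def\<close>)
      moreover have "\<not> first_turn a" using turn_cases[OF Ord_in[OF Ord_len a(1)]] a(2) by blast
      ultimately show ?thesis using h(2) True apf0[OF a(1)] by (simp add: agree_def G_def)
    next
      case False
      then show ?thesis using tl a turn_cases[OF Ord_in[OF Ord_len a(1)]] by blast
    qed
    then have "\<not> h \<epsilon> payoff" by (intro win[OF h(1)]) (simp add: follows_iff[OF dT st h(1)])
    \<comment> \<open>Safety passes from \<open>f0\<close> to \<open>h\<close> because the two agree
      before \<open>omega1\<close>.\<close>
    moreover have "tailplay h = tailplay f0"
      using h(2) by (intro ext) (auto simp: tailplay_def agree_def)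
    then have "safe h" using safe by (simp add: safe_def)
    ultimately show ?thesis using h(1) by (simp add: mem_payoff)
  qed
  from greedy[OF f0 leg X tr this] obtain c where "fun_into c L omega"
    "\<forall>k l. k \<epsilon> L \<longrightarrow> l \<epsilon> L \<longrightarrow> ap c k = ap c l \<longrightarrow> ap X k = ap X l" by blast
  then show False using Xunc by blast
qed

lemma undetermined:
  "game len two payoff \<and> ordinal_definable payoff \<and> \<not> determined len two payoff"
  using first_not_winning second_not_winning ordinal_definable_payoff
  by (auto simp: game_def determined_def mem_payoff mem_two)

end

theorem theorem3:
  fixes mem :: "'v \<Rightarrow> 'v \<Rightarrow> bool"
  assumes "ZFC mem"
  shows "\<exists>\<theta> S A. \<theta> = ZFC.oadd mem (ZFC.omega1 mem) (ZFC.omega mem) \<and>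
    S = ZFC.upair mem (ZFC.zero mem) (ZFC.one mem) \<and>
    ZFC.game mem \<theta> S A \<and>
    ZFC.ordinal_definable mem A \<and>
    \<not> ZFC.determined mem \<theta> S A"
proof -
  interpret ZFC mem by (rule assms)
  have "len = oadd omega1 omega" by (simp add: len_def oadd_pl)
  then show ?thesis using undetermined two_def by blast
qed

end
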